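(* Let $d\ge 1$ be an integer and let $\mathrm{div}$ be an inclusion-uniform subdivision acting non-trivially on $d$-dimensional complexes. Then there exists a function $\Lambda_d^{(\mathrm{div})}\in L^1([0,1])$ such that for every $d$-dimensional simplicial complex $K$ $$\Lambda(\mathcal{L}(\mathrm{div}^n K))\xrightarrow{n\to\infty}\Lambda_d^{(\mathrm{div})}\quad\text{in }L^1([0,1]).$$
   Context: All simplicial complexes are finite and are regarded as geometric simplicial complexes (an abstract complex is identified with a geometric realization). $\Delta_i=\mathrm{conv}(e_1,\dots,e_{i+1})$ (with all its faces) is the standard $i$-simplex; $F_i(K)$ is the set of $i$-dimensional faces of $K$, and $f_i(K)=\#F_i(K)$. Subdivisions. A subdivision procedure $\mathrm{div}$ associates to a geometric complex $K$ of dimension at most $d$ a geometric complex $\mathrm{div}K$ such that (i) every simplex of $\mathrm{div}K$ is contained in some simplex of $K$, and (ii) every simplex of $K$ is the union of finitely many simplices of $\mathrm{div}K$. For $\tau\in K$, $\mathrm{div}_K\tau$ denotes the subcomplex of $\mathrm{div}K$ of all simplices contained in $\tau$. The procedure is inclusion-uniform if for every complex $K$, every $i\in\{0,\dots,d\}$, every $i$-face $\tau=\mathrm{conv}(v_0,\dots,v_i)\in K$ and every bijection $f:\{v_0,\dots,v_i\}\to\{e_1,\dots,e_{i+1}\}$ there is a unique simplicial isomorphism $\tilde f:\mathrm{div}_K\tau\to\mathrm{div}\Delta_i$ that agrees with $f$ on $v_0,\dots,v_i$; these isomorphisms are compatible with faces, i.e. $\tilde f$ maps $\mathrm{div}_K\rho$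 onto $\mathrm{div}_{\Delta_i}f(\rho)$ for each face $\rho$ of $\tau$. Write $f_i(\mathrm{div}):=f_i(\mathrm{div}\Delta_i)$. Acting non-trivially on $d$-dimensional complexes means $f_d(\mathrm{div})>1$. $\mathrm{div}^n$ is the $n$-fold iterate. Laplacian. For a $d$-dimensional complex $K$ (with any orientation), $\mathcal{L}(K)=\partial_d^{t}\partial_d$, where $\partial_d:C_d(K)\to C_{d-1}(K)$ is the simplicial boundary operator with real coefficients, in the standard bases of oriented faces; its spectrum does not depend on the orientation. Spectral function. For a self-adjoint operator $L$ on $\mathbb{R}^N$ with eigenvalues $\lambda_1(L)\le\dots\le\lambda_N(L)$ listed with multiplicity, $\Lambda(L):=\sum_{j=1}^N\lambda_j(L)\,\mathbf{1}_{[(j-1)/N,\,j/N)}\in L^1([0,1])$. *)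

theory Defs
  imports
    "HOL-Analysis.Analysis"
    "HOL-Library.Poly_Mapping"
    "HOL-Combinatorics.Permutations"
    "Jordan_Normal_Form.Char_Poly"
begin

section \<open>The ambient space\<close>

text \<open>
  Geometric complexes live in Euclidean spaces of arbitrary dimension.  Their common ambient space
  is the space of finitely supported real sequences, the union of all the spaces \<open>R^N\<close>.
\<close>

instantiation poly_mapping :: (type, real_vector) real_vector
begin

lift_definition scaleR_poly_mapping :: "real \<Rightarrow> ('a \<Rightarrow>\<^sub>0 'b) \<Rightarrow> 'a \<Rightarrow>\<^sub>0 'b"
  is "\<lambda>r f k. r *\<^sub>R f k"
  by (erule finite_subset[rotated]) auto

instance
  by standard (transfer; simp add: fun_eq_iff scaleR_add_right scaleR_add_left)+

end

type_synonym point = "nat \<Rightarrow>\<^sub>0 real"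

section \<open>Geometric simplicial complexes\<close>

text \<open>
  A simplex is represented by its (finite, nonempty, affinely independent) set of vertices; the
  corresponding geometric simplex is the convex hull of that set.
\<close>

type_synonym complex_of_points = "point set set"

definition geometric_complex :: "complex_of_points \<Rightarrow> bool" where
  "geometric_complex K \<longleftrightarrow>
     finite K \<and>
     (\<forall>s\<in>K. finite s \<and> s \<noteq> {} \<and> \<not> affine_dependent s) \<and>
     (\<forall>s\<in>K. \<forall>t. t \<subseteq> s \<and> t \<noteq> {} \<longrightarrow> t \<in> K) \<and>
     (\<forall>s\<in>K. \<forall>t\<in>K. convex hull s \<inter> convex hull t = convex hull (s \<inter> t))"

definition faces :: "nat \<Rightarrow> complex_of_points \<Rightarrow> complex_of_points" where
  "faces i K = {s \<in> K. card s = i + 1}"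

definition dim_at_most :: "nat \<Rightarrow> complex_of_points \<Rightarrow> bool" where
  "dim_at_most d K \<longleftrightarrow> (\<forall>s\<in>K. card s \<le> d + 1)"

definition has_dim :: "nat \<Rightarrow> complex_of_points \<Rightarrow> bool" where
  "has_dim d K \<longleftrightarrow> dim_at_most d K \<and> faces d K \<noteq> {}"

definition unit_pt :: "nat \<Rightarrow> point" where
  "unit_pt k = Poly_Mapping.single k 1"

definition std_simplex :: "nat \<Rightarrow> complex_of_points" where
  "std_simplex i = {s. s \<subseteq> unit_pt ` {1..i+1} \<and> s \<noteq> {}}"

text \<open>
  A simplicial isomorphism is given by its vertex map; \<open>\<Union>A\<close> is the vertex set of \<open>A\<close>.
\<close>

definition simplicial_iso :: "(point \<Rightarrow> point) \<Rightarrow> complex_of_points \<Rightarrow> complex_of_points \<Rightarrow> bool" where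
  "simplicial_iso \<phi> A B \<longleftrightarrow> bij_betw \<phi> (\<Union>A) (\<Union>B) \<and> (`) \<phi> ` A = B"

section \<open>Subdivision procedures\<close>

definition is_subdivision_of :: "complex_of_points \<Rightarrow> complex_of_points \<Rightarrow> bool" where
  "is_subdivision_of D K \<longleftrightarrow>
     geometric_complex D \<and>
     (\<forall>s\<in>D. \<exists>t\<in>K. convex hull s \<subseteq> convex hull t) \<and>
     (\<forall>t\<in>K. \<exists>S\<subseteq>D. finite S \<and> convex hull t = (\<Union>s\<in>S. convex hull s))"

definition subdivision_procedure :: "nat \<Rightarrow> (complex_of_points \<Rightarrow> complex_of_points) \<Rightarrow> bool" where
  "subdivision_procedure d sd \<longleftrightarrow>
     (\<forall>K. geometric_complex K \<and> dim_at_most d K \<longrightarrow> is_subdivision_of (sd K) K)"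

text \<open>\<open>part_in (sd K) \<tau>\<close> is the subcomplex of \<open>sd K\<close> of all simplices contained in \<open>\<tau>\<close>.\<close>

definition part_in :: "complex_of_points \<Rightarrow> point set \<Rightarrow> complex_of_points" where
  "part_in D \<tau> = {s \<in> D. convex hull s \<subseteq> convex hull \<tau>}"

text \<open>
  Isomorphisms are required to be extensional, i.e. to take a fixed dummy value outside the vertex
  set, because uniqueness concerns only their values on vertices.
\<close>

definition extending_iso ::
  "(complex_of_points \<Rightarrow> complex_of_points) \<Rightarrow> complex_of_points \<Rightarrow> nat \<Rightarrow> point set
     \<Rightarrow> (point \<Rightarrow> point) \<Rightarrow> (point \<Rightarrow> point) \<Rightarrow> bool" where
  "extending_iso sd K i \<tau> f \<phi> \<longleftrightarrow>
     \<phi> \<in> extensional (\<Union>(part_in (sd K) \<tau>)) \<and>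
     simplicial_iso \<phi> (part_in (sd K) \<tau>) (sd (std_simplex i)) \<and>
     (\<forall>v\<in>\<tau>. \<phi> v = f v)"

definition inclusion_uniform :: "nat \<Rightarrow> (complex_of_points \<Rightarrow> complex_of_points) \<Rightarrow> bool" where
  "inclusion_uniform d sd \<longleftrightarrow>
     subdivision_procedure d sd \<and>
     (\<forall>K i \<tau> f.
        geometric_complex K \<and> dim_at_most d K \<and> i \<le> d \<and> \<tau> \<in> faces i K \<and>
        bij_betw f \<tau> (unit_pt ` {1..i+1}) \<longrightarrow>
          (\<exists>!\<phi>. extending_iso sd K i \<tau> f \<phi>) \<and>
          (\<forall>\<phi>. extending_iso sd K i \<tau> f \<phi> \<longrightarrow>
             (\<forall>\<rho>. \<rho> \<subseteq> \<tau> \<and> \<rho> \<noteq> {} \<longrightarrow>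
                (`) \<phi> ` part_in (sd K) \<rho> = part_in (sd (std_simplex i)) (f ` \<rho>))))"

definition acts_nontrivially :: "nat \<Rightarrow> (complex_of_points \<Rightarrow> complex_of_points) \<Rightarrow> bool" where
  "acts_nontrivially d sd \<longleftrightarrow> card (faces d (sd (std_simplex d))) > 1"

section \<open>Boundary operator and Laplacian\<close>

text \<open>
  An oriented simplex is a list of its vertices without repetition.  Even permutations of the
  list leave the orientation unchanged, odd ones reverse it.  \<open>oriented_basis i K B\<close> says that \<open>B\<close>
  lists every \<open>i\<close>-face of \<open>K\<close> exactly once, each with an arbitrarily chosen orientation.
\<close>

definition oriented_basis :: "nat \<Rightarrow> complex_of_points \<Rightarrow> point list list \<Rightarrow> bool" where
  "oriented_basis i K B \<longleftrightarrow>
     (\<forall>s\<in>set B. distinct s) \<and> distinct (map set B) \<and> set (map set B) = faces i K"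

text \<open>
  For lists without repetition the following sum has at most one term: it is the sign of the
  permutation taking \<open>r\<close> to \<open>s\<close> if these have the same elements, and \<open>0\<close> otherwise.
\<close>

definition relative_sign :: "'a list \<Rightarrow> 'a list \<Rightarrow> real" where
  "relative_sign r s = (\<Sum>p | p permutes {..<length r} \<and> permute_list p r = s. of_int (sign p))"

text \<open>
  Coefficient of \<open>r\<close> in the boundary of \<open>s = [v\<^sub>0, \<dots>, v\<^sub>d]\<close>, which is the alternating sum over \<open>j\<close> of
  the oriented simplices obtained by deleting \<open>v\<^sub>j\<close>.
\<close>

definition incidence :: "'a list \<Rightarrow> 'a list \<Rightarrow> real" where
  "incidence r s = (\<Sum>j<length s. (-1) ^ j * relative_sign r (take j s @ drop (Suc j) s))"

text \<open>Matrix of the boundary operator in the bases \<open>B\<close> of the domain and \<open>B'\<close> of the codomain.\<close>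

definition boundary_matrix :: "'a list list \<Rightarrow> 'a list list \<Rightarrow> real mat" where
  "boundary_matrix B' B =
     Matrix.mat (length B') (length B) (\<lambda>(i, j). incidence (B' ! i) (B ! j))"

definition laplacian :: "'a list list \<Rightarrow> 'a list list \<Rightarrow> real mat" where
  "laplacian B' B = transpose_mat (boundary_matrix B' B) * boundary_matrix B' B"

section \<open>Spectral functions\<close>

text \<open>
  All eigenvalues with multiplicity in increasing order.  For symmetric matrices, the only ones
  it is used for, the characteristic polynomial splits over the reals, so the list has full length.
\<close>

definition eigenvalue_list :: "real mat \<Rightarrow> real list" where
  "eigenvalue_list L = sorted_list_of_multiset (proots (char_poly L))"

definition spectral_function :: "real mat \<Rightarrow> real \<Rightarrow> real" where
  "spectral_function L x =
     (\<Sum>j = 1..dim_row L.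
        eigenvalue_list L ! (j - 1) *
        indicator {(real j - 1) / real (dim_row L) ..< real j / real (dim_row L)} x)"

text \<open>Functions represent classes in \<open>L\<^sup>1([0,1])\<close>.\<close>

definition L1_unit :: "(real \<Rightarrow> real) \<Rightarrow> bool" where
  "L1_unit g \<longleftrightarrow> set_integrable lborel {0..1} g"

definition L1_unit_tendsto :: "(nat \<Rightarrow> real \<Rightarrow> real) \<Rightarrow> (real \<Rightarrow> real) \<Rightarrow> bool" where
  "L1_unit_tendsto g h \<longleftrightarrow>
     (\<forall>n. L1_unit (g n)) \<and> L1_unit h \<and>
     (\<lambda>n. LINT x:{0..1}|lborel. \<bar>g n x - h x\<bar>) \<longlonglongrightarrow> 0"

end

theory Submission
  imports Defs "Jordan_Normal_Form.Schur_Decomposition"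
begin

text \<open>
  The Laplacian is the sum over the \<open>(d - 1)\<close>-faces \<open>r\<close> of the rank-one matrices of the rows of the
  boundary matrix.  Dropping the \<open>r\<close> that lie in a \<open>(d - 1)\<close>-face of \<open>K\<close> leaves a block diagonal
  matrix with one block for each \<open>d\<close>-face of \<open>K\<close>, and by inclusion-uniformity every block is, up to
  order and orientation, the one of the standard simplex.  Its spectral function \<open>f n\<close> is therefore
  independent of \<open>K\<close>.  The dropped part is positive semidefinite, so all eigenvalues move in the same
  direction and the \<open>L\<^sup>1\<close> distance of the two spectral functions is a normalized trace, at most
  \<open>(d + 1) * (a / b) ^ n\<close>: here \<open>b\<close> counts the top simplices in the subdivided standard simplex and
  \<open>a\<close> those with a facet on a fixed facet of it, and \<open>a < b\<close> as soon as \<open>b > 1\<close>.  Comparing the standard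
  simplex with its own subdivision shows in the same way that \<open>f n\<close> increases with \<open>n\<close>; its integrals
  are at most \<open>d + 1\<close>, so it converges in \<open>L\<^sup>1\<close> by monotone convergence.
\<close>

no_notation inner (infix \<open>\<bullet>\<close> 70)

section \<open>Eigenvalues of symmetric matrices\<close>

lemma symmetric_eigenvalue_real:
  fixes A :: "real mat"
  assumes A: "A \<in> carrier_mat n n" and sym: "transpose_mat A = A"
    and ev: "eigenvalue (map_mat complex_of_real A) a"
  shows "a \<in> \<real>"
proof -
  define C where "C = map_mat complex_of_real A"
  have C: "C \<in> carrier_mat n n" and symC: "transpose_mat C = C"
    using A sym unfolding C_def by (auto simp: map_mat_transpose)
  obtain v where v: "v \<in> carrier_vec n" "v \<noteq> 0\<^sub>v n" and Cv: "C *\<^sub>v v = a \<cdot>\<^sub>v v"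
    using ev C unfolding eigenvalue_def eigenvector_def C_def[symmetric] by auto
  have conj: "C *\<^sub>v conjugate v = conjugate (C *\<^sub>v v)"
    using A v unfolding C_def
    by (intro eq_vecI) (auto simp: scalar_prod_def)
  have "a * (v \<bullet>c v) = (C *\<^sub>v v) \<bullet>c v"
    using v by (simp add: Cv)
  also have "\<dots> = v \<bullet> (C *\<^sub>v conjugate v)"
    using C v symC
    by (metis carrier_vec_conjugate transpose_vec_mult_scalar)
  also have "\<dots> = cnj a * (v \<bullet>c v)"
    using v unfolding conj Cv by (simp add: conjugate_smult_vec)
  finally have "a = cnj a" using v conjugate_square_eq_0_vec[OF v(1)] by auto
  then show ?thesis using Reals_cnj_iff by metis
qed

lemma symmetric_char_poly_splits:
  fixes A :: "real mat"
  assumes A: "A \<in> carrier_mat n n" and sym: "transpose_mat A = A"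
  shows "\<exists>es. char_poly A = (\<Prod>e\<leftarrow>es. [:- e, 1:]) \<and> length es = n"
proof -
  interpret h: map_poly_inj_comm_ring_hom complex_of_real ..
  define C where "C = map_mat complex_of_real A"
  have C: "C \<in> carrier_mat n n" using A by (auto simp: C_def)
  obtain as where as: "char_poly C = (\<Prod>a\<leftarrow>as. [:- a, 1:])" "length as = n"
    using char_poly_factorized[OF C] by blast
  have "a \<in> \<real>" if "a \<in> set as" for a
    using symmetric_eigenvalue_real[OF A sym, of a, folded C_def] that
    unfolding eigenvalue_root_char_poly[OF C] as(1) poly_prod_list by (auto simp: prod_list_zero_iff)
  then have asr: "as = map (complex_of_real \<circ> Re) as" by (auto intro!: map_idI[symmetric])
  have "map_poly complex_of_real (char_poly A) = char_poly C"
    by (simp only: C_def of_real_hom.char_poly_hom[OF A])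
  also have "\<dots> = (\<Prod>a\<leftarrow>map (complex_of_real \<circ> Re) as. [:- a, 1:])" using as(1) asr by simp
  also have "\<dots> = map_poly complex_of_real (\<Prod>e\<leftarrow>map Re as. [:- e, 1:])"
    by (induction as) (auto simp: h.hom_mult map_poly_pCons simp del: mult_pCons_left)
  finally have "char_poly A = (\<Prod>e\<leftarrow>map Re as. [:- e, 1:])"
    by (rule h.injectivity)
  then show ?thesis using as(2) by (metis length_map)
qed

lemma orthonormal_matrix_extension:
  fixes v :: "real vec"
  assumes v: "v \<in> carrier_vec n" "v \<noteq> 0\<^sub>v n" and n: "n > 0"
  shows "\<exists>W c. W \<in> carrier_mat n n \<and> transpose_mat W * W = 1\<^sub>m n \<and> col W 0 = c \<cdot>\<^sub>v v"
proof -
  interpret cof_vec_space n "TYPE(real)" .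
  define b where "b = basis_completion v"
  define ws where "ws = gram_schmidt n b"
  from basis_completion[OF v, folded b_def]
  have dist_b: "distinct b" and indep: "\<not> lin_dep (set b)" and b: "set b \<subseteq> carrier_vec n"
    and hdb: "hd b = v" and len_b: "length b = n" by auto
  from hdb len_b n obtain vs where bv: "b = v # vs" by (cases b) auto
  from gram_schmidt_result[OF b dist_b indep refl, folded ws_def]
  have ws: "set ws \<subseteq> carrier_vec n" "corthogonal ws" "length ws = n"
    by (auto simp: len_b)
  from gram_schmidt_hd[OF v(1), of vs, folded bv] have hdws: "hd ws = v" unfolding ws_def .
  define us where "us = map (\<lambda>w. (1 / sqrt (w \<bullet> w)) \<cdot>\<^sub>v w) ws"
  define W where "W = mat_of_cols n us"
  have us: "length us = n" "\<And>i. i < n \<Longrightarrow> us ! i \<in> carrier_vec n"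
    using ws nth_mem unfolding us_def by fastforce+
  have wsc: "ws ! i \<in> carrier_vec n" if "i < n" for i
    using ws that nth_mem by blast
  have W: "W \<in> carrier_mat n n" unfolding W_def using us by auto
  have orth: "(ws ! i \<bullet> ws ! j = 0) = (i \<noteq> j)" if "i < n" "j < n" for i j
    using corthogonalD[OF ws(2), of i j] that ws wsc[of j]
    by (simp add: scalar_prod_def)
  have pos: "ws ! i \<bullet> ws ! i > 0" if "i < n" for i
  proof -
    have "ws ! i \<bullet> ws ! i \<ge> 0" by (auto simp: scalar_prod_def intro!: sum_nonneg)
    then show ?thesis using orth[OF that that] by linarith
  qed
  have "us ! i \<bullet> us ! j = (if i = j then 1 else 0)" if "i < n" "j < n" for i j
  proof -
    have "us ! i \<bullet> us ! j = (1 / sqrt (ws ! i \<bullet> ws ! i)) * (1 / sqrt (ws ! j \<bullet> ws ! j)) * (ws ! i \<bullet> ws ! j)"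
      using that ws wsc[of i] wsc[of j] by (simp add: us_def)
    then show ?thesis using orth[OF that] pos[OF that(1)] by (auto simp: real_sqrt_mult_self)
  qed
  then have "transpose_mat W * W = 1\<^sub>m n"
    using W us by (intro eq_matI) (auto simp: W_def)
  moreover have "ws ! 0 = v" using hdws ws n by (metis hd_conv_nth length_greater_0_conv)
  then have "col W 0 = (1 / sqrt (v \<bullet> v)) \<cdot>\<^sub>v v"
    using n ws us unfolding W_def by (auto simp: us_def)
  ultimately show ?thesis using W by blast
qed

lemma real_spectral_decomposition:
  fixes A :: "real mat"
  assumes "A \<in> carrier_mat n n" "transpose_mat A = A" "char_poly A = (\<Prod>e\<leftarrow>es. [:- e, 1:])"
  shows "\<exists>P \<in> carrier_mat n n. transpose_mat P * P = 1\<^sub>m n \<and>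
    transpose_mat P * A * P = mat n n (\<lambda>(i, j). if i = j then es ! i else 0)"
  using assms
proof (induction es arbitrary: n A)
  case Nil
  then have "n = 0" using degree_monic_char_poly[of A n] by auto
  then show ?case using Nil by (intro bexI[of _ "1\<^sub>m n"]) auto
next
  case (Cons e es)
  note A = Cons.prems(1) and sym = Cons.prems(2)
  define m where "m = n - 1"
  have "monic (\<Prod>e\<leftarrow>es. [:- e, 1:])" by (rule monic_prod_list) auto
  then have "degree (char_poly A) = Suc (degree (\<Prod>e\<leftarrow>es. [:- e, 1:]))"
    unfolding Cons.prems(3) list.map prod_list.Cons
    by (subst degree_mult_eq) auto
  then have n: "n = Suc m" using degree_monic_char_poly[OF A] by (auto simp: m_def)
  have "eigenvalue A e"
    unfolding eigenvalue_root_char_poly[OF A] Cons.prems(3) by simp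
  then obtain v where v: "v \<in> carrier_vec n" "v \<noteq> 0\<^sub>v n" and Av: "A *\<^sub>v v = e \<cdot>\<^sub>v v"
    using A unfolding eigenvalue_def eigenvector_def by auto
  obtain W c where W: "W \<in> carrier_mat n n" and WW: "transpose_mat W * W = 1\<^sub>m n" and W0: "col W 0 = c \<cdot>\<^sub>v v"
    using orthonormal_matrix_extension[OF v] n by auto
  define A' where "A' = transpose_mat W * A * W"
  have A': "A' \<in> carrier_mat n n" using A W by (auto simp: A'_def)
  have symA': "transpose_mat A' = A'"
  proof -
    have "transpose_mat A' = transpose_mat W * (transpose_mat A * W)"
      unfolding A'_def using A W
      by (subst transpose_mult[of _ n n]; simp add: transpose_mult[of _ n n])+ 
    then show ?thesis unfolding A'_def sym using A W by (simp add: assoc_mult_mat[of _ n n _ n _ n])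
  qed
  have WW': "W * transpose_mat W = 1\<^sub>m n"
    using mat_mult_left_right_inverse[OF _ W WW] W by auto
  have "similar_mat_wit A' A (transpose_mat W) W"
    by (rule similar_mat_witI[of _ _ n]) (use A W A' WW WW' in \<open>auto simp: A'_def\<close>)
  then have cpA': "char_poly A' = char_poly A"
    using char_poly_similar unfolding similar_mat_def by blast
  have colA': "A' $$ (i, 0) = (if i = 0 then e else 0)" if "i < n" for i
  proof -
    have "A *\<^sub>v col W 0 = e \<cdot>\<^sub>v col W 0"
      unfolding W0 using A v Av
      by (simp add: mult_mat_vec[OF A v(1)] smult_smult_assoc mult.commute)
    then have "col (A * W) 0 = e \<cdot>\<^sub>v col W 0" using A W n by (subst col_mult2) auto
    then have "A' $$ (i, 0) = col W i \<bullet> (e \<cdot>\<^sub>v col W 0)"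
      using A W that n unfolding A'_def by (simp add: assoc_mult_mat[of _ n n _ n _ n])
    also have "\<dots> = e * (transpose_mat W * W) $$ (i, 0)"
      using W that n by simp
    finally show ?thesis using that n by (simp add: WW)
  qed
  have rowA': "A' $$ (0, i) = (if i = 0 then e else 0)" if "i < n" for i
    using colA'[OF that] symA' A' that n by (metis carrier_matD index_transpose_mat(1) zero_less_Suc)
  define A3 where "A3 = mat m m (\<lambda>(i, j). A' $$ (Suc i, Suc j))"
  define A1 where "A1 = mat 1 1 (\<lambda>_. e)"
  have A3: "A3 \<in> carrier_mat m m" by (auto simp: A3_def)
  have blk: "A' = four_block_mat A1 (0\<^sub>m 1 m) (0\<^sub>m m 1) A3"
    using A' n rowA' colA' by (intro eq_matI) (auto simp: A1_def A3_def)
  have symA3: "transpose_mat A3 = A3"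
    using symA' A' n unfolding A3_def
    by (intro eq_matI) (auto, metis Suc_less_eq carrier_matD index_transpose_mat(1))
  have "char_poly A1 = [:- e, 1:]"
    by (simp add: A1_def char_poly_defs det_def sign_def)
  moreover have "char_poly A' = char_poly A1 * char_poly A3"
    unfolding blk by (rule char_poly_four_block_zeros_col[OF _ _ A3]) (auto simp: A1_def)
  ultimately have "[:- e, 1:] * char_poly A3 = [:- e, 1:] * (\<Prod>e\<leftarrow>es. [:- e, 1:])"
    using cpA' Cons.prems(3) by simp
  then have "char_poly A3 = (\<Prod>e\<leftarrow>es. [:- e, 1:])"
    by (metis mult_cancel_left pCons_eq_0_iff zero_neq_one)
  from Cons.IH[OF A3 symA3 this] obtain P where P: "P \<in> carrier_mat m m"
    and PP: "transpose_mat P * P = 1\<^sub>m m"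
    and PD: "transpose_mat P * A3 * P = mat m m (\<lambda>(i, j). if i = j then es ! i else 0)" by blast
  define R where "R = four_block_mat (1\<^sub>m 1) (0\<^sub>m 1 m) (0\<^sub>m m 1) P"
  have R: "R \<in> carrier_mat n n" unfolding R_def using P n by auto
  have RT: "transpose_mat R = four_block_mat (1\<^sub>m 1) (0\<^sub>m 1 m) (0\<^sub>m m 1) (transpose_mat P)"
    unfolding R_def using P by (subst transpose_four_block_mat) auto
  have RR: "transpose_mat R * R = 1\<^sub>m n"
    unfolding RT unfolding R_def using P PP n
    by (subst mult_four_block_mat) auto
  have "transpose_mat R * A' * R = four_block_mat A1 (0\<^sub>m 1 m) (0\<^sub>m m 1) (transpose_mat P * A3 * P)"
    unfolding RT unfolding R_def blk using P A3
    by (subst mult_four_block_mat; (subst mult_four_block_mat)?) (auto simp: A1_def)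
  also have "\<dots> = mat n n (\<lambda>(i, j). if i = j then (e # es) ! i else 0)"
    unfolding PD n by (intro eq_matI) (auto simp: A1_def nth_Cons')
  finally have D: "transpose_mat R * A' * R = mat n n (\<lambda>(i, j). if i = j then (e # es) ! i else 0)" .
  have T: "transpose_mat (W * R) = transpose_mat R * transpose_mat W"
    using W R by (rule transpose_mult)
  show ?case
  proof (intro bexI[of _ "W * R"] conjI)
    show "W * R \<in> carrier_mat n n" using W R by auto
    have "transpose_mat (W * R) * (W * R) = transpose_mat R * (transpose_mat W * W) * R"
      unfolding T using W R by (simp add: assoc_mult_mat[of _ n n _ n _ n])
    then show "transpose_mat (W * R) * (W * R) = 1\<^sub>m n" using R RR by (simp add: WW)
    have "transpose_mat (W * R) * A * (W * R) = transpose_mat R * A' * R"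
      unfolding T A'_def using W R A by (simp add: assoc_mult_mat[of _ n n _ n _ n])
    then show "transpose_mat (W * R) * A * (W * R) = mat n n (\<lambda>(i, j). if i = j then (e # es) ! i else 0)"
      using D by simp
  qed
qed

lemma quadratic_form_diagonalized:
  fixes A :: "real mat"
  assumes A: "A \<in> carrier_mat n n" and P: "P \<in> carrier_mat n n"
    and PP: "transpose_mat P * P = 1\<^sub>m n"
    and D: "transpose_mat P * A * P = mat n n (\<lambda>(i, j). if i = j then es ! i else 0)"
    and w: "w \<in> carrier_vec n"
  shows "(P *\<^sub>v w) \<bullet> (A *\<^sub>v (P *\<^sub>v w)) = (\<Sum>i<n. es ! i * (w $ i)\<^sup>2)"
    and "(P *\<^sub>v w) \<bullet> (P *\<^sub>v w) = (\<Sum>i<n. (w $ i)\<^sup>2)"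
proof -
  have adj: "(P *\<^sub>v w) \<bullet> y = w \<bullet> (transpose_mat P *\<^sub>v y)" if "y \<in> carrier_vec n" for y
    using transpose_vec_mult_scalar[OF _ that w, of "transpose_mat P"] P by simp
  have "(P *\<^sub>v w) \<bullet> (A *\<^sub>v (P *\<^sub>v w)) = w \<bullet> (transpose_mat P * A * P *\<^sub>v w)"
    using adj[of "A *\<^sub>v (P *\<^sub>v w)"] A P w
    by (simp add: assoc_mult_mat_vec[of _ n n _ n] assoc_mult_mat[of _ n n _ n _ n])
  also have "\<dots> = (\<Sum>i<n. es ! i * (w $ i)\<^sup>2)"
    using w unfolding D
    by (auto simp: scalar_prod_def lessThan_atLeast0 if_distrib[of "\<lambda>x. x * _"] power2_eq_square
        intro!: sum.cong cong: if_cong)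
  finally show "(P *\<^sub>v w) \<bullet> (A *\<^sub>v (P *\<^sub>v w)) = (\<Sum>i<n. es ! i * (w $ i)\<^sup>2)" .
  have "(P *\<^sub>v w) \<bullet> (P *\<^sub>v w) = w \<bullet> (transpose_mat P * P *\<^sub>v w)"
    using adj[of "P *\<^sub>v w"] P w by (simp add: assoc_mult_mat_vec[of _ n n _ n])
  then show "(P *\<^sub>v w) \<bullet> (P *\<^sub>v w) = (\<Sum>i<n. (w $ i)\<^sup>2)"
    unfolding PP using w by (simp add: scalar_prod_def lessThan_atLeast0 power2_eq_square)
qed

lemma exists_kernel_vec:
  fixes U :: "real mat"
  assumes U: "U \<in> carrier_mat n n" and j: "j < n"
  shows "\<exists>y \<in> carrier_vec n. (\<forall>i<n. j < i \<longrightarrow> y $ i = 0) \<and> (\<exists>i\<le>j. y $ i \<noteq> 0) \<and>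
    (\<forall>i<j. (U *\<^sub>v y) $ i = 0)"
proof -
  define M where "M = mat (Suc j) (Suc j) (\<lambda>(i, k). if i < j then U $$ (i, k) else 0)"
  have M: "M \<in> carrier_mat (Suc j) (Suc j)" by (auto simp: M_def)
  have "M $$ (j, k) = 0" if "k < Suc j" for k
    using that by (auto simp: M_def)
  then have "det M = 0" using laplace_expansion_row[OF M, of j] by simp
  then obtain z where z: "z \<in> carrier_vec (Suc j)" "z \<noteq> 0\<^sub>v (Suc j)" "M *\<^sub>v z = 0\<^sub>v (Suc j)"
    using det_0_iff_vec_prod_zero[OF M] by auto
  define y where "y = vec n (\<lambda>i. if i \<le> j then z $ i else 0)"
  have "(U *\<^sub>v y) $ i = 0" if "i < j" for i
  proof -
    have "(U *\<^sub>v y) $ i = (\<Sum>k<n. U $$ (i, k) * (if k \<le> j then z $ k else 0))"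
      using U that j by (simp add: y_def scalar_prod_def lessThan_atLeast0)
    also have "\<dots> = (\<Sum>k<Suc j. U $$ (i, k) * z $ k)"
      using j by (intro sum.mono_neutral_cong_right) auto
    also have "\<dots> = (M *\<^sub>v z) $ i"
      using that z(1) by (auto simp: M_def scalar_prod_def lessThan_atLeast0 intro!: sum.cong)
    finally show ?thesis using z(3) that by simp
  qed
  moreover have "\<exists>i\<le>j. z $ i \<noteq> 0"
  proof (rule ccontr)
    assume "\<not> (\<exists>i\<le>j. z $ i \<noteq> 0)"
    then have "z = 0\<^sub>v (Suc j)" using z(1) by (intro eq_vecI) auto
    then show False using z(2) by simp
  qed
  ultimately show ?thesis
    using j by (intro bexI[of _ y]) (auto simp: y_def)
qed

text \<open>A vector in the span of the first \<open>j + 1\<close> eigenvectors of \<open>B\<close> that is orthogonal to the first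
  \<open>j\<close> eigenvectors of \<open>A\<close> separates the two eigenvalues.\<close>

lemma eigenvalues_mono:
  fixes A B :: "real mat"
  assumes A: "A \<in> carrier_mat n n" "transpose_mat A = A" "char_poly A = (\<Prod>e\<leftarrow>as. [:- e, 1:])" "sorted as" "length as = n"
    and B: "B \<in> carrier_mat n n" "transpose_mat B = B" "char_poly B = (\<Prod>e\<leftarrow>bs. [:- e, 1:])" "sorted bs" "length bs = n"
    and le: "\<And>x. x \<in> carrier_vec n \<Longrightarrow> x \<bullet> (A *\<^sub>v x) \<le> x \<bullet> (B *\<^sub>v x)"
    and j: "j < n"
  shows "as ! j \<le> bs ! j"
proof -
  obtain P where P: "P \<in> carrier_mat n n" "transpose_mat P * P = 1\<^sub>m n"
    "transpose_mat P * A * P = mat n n (\<lambda>(i, j). if i = j then as ! i else 0)"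
    using real_spectral_decomposition[OF A(1-3)] by blast
  obtain Q where Q: "Q \<in> carrier_mat n n" "transpose_mat Q * Q = 1\<^sub>m n"
    "transpose_mat Q * B * Q = mat n n (\<lambda>(i, j). if i = j then bs ! i else 0)"
    using real_spectral_decomposition[OF B(1-3)] by blast
  have PP': "P * transpose_mat P = 1\<^sub>m n"
    using mat_mult_left_right_inverse[OF _ P(1,2)] P(1) by auto
  have U: "transpose_mat P * Q \<in> carrier_mat n n" using P(1) Q(1) by auto
  obtain y where y: "y \<in> carrier_vec n" "\<And>i. i < n \<Longrightarrow> j < i \<Longrightarrow> y $ i = 0" "\<exists>i\<le>j. y $ i \<noteq> 0"
    and Uy: "\<And>i. i < j \<Longrightarrow> ((transpose_mat P * Q) *\<^sub>v y) $ i = 0"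
    using exists_kernel_vec[OF U j] by blast
  define z where "z = (transpose_mat P * Q) *\<^sub>v y"
  define x where "x = Q *\<^sub>v y"
  have z: "z \<in> carrier_vec n" and x: "x \<in> carrier_vec n" using P Q y by (auto simp: z_def x_def)
  have xz: "x = P *\<^sub>v z"
  proof -
    have "P *\<^sub>v z = (P * transpose_mat P * Q) *\<^sub>v y"
      unfolding z_def using P Q y
      by (simp add: assoc_mult_mat_vec[of _ n n _ n] assoc_mult_mat[of _ n n _ n _ n])
    then show ?thesis unfolding PP' x_def using Q by simp
  qed
  note dA = quadratic_form_diagonalized[OF A(1) P z, folded xz]
  note dB = quadratic_form_diagonalized[OF B(1) Q y(1), folded x_def]
  have "as ! j * (x \<bullet> x) = (\<Sum>i<n. as ! j * (z $ i)\<^sup>2)" unfolding dA by (simp add: sum_distrib_left)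
  also have "\<dots> \<le> (\<Sum>i<n. as ! i * (z $ i)\<^sup>2)"
  proof (rule sum_mono)
    fix i assume "i \<in> {..<n}"
    then show "as ! j * (z $ i)\<^sup>2 \<le> as ! i * (z $ i)\<^sup>2"
      using Uy[of i] A(4,5) by (cases "i < j") (auto simp: z_def intro!: mult_right_mono sorted_nth_mono)
  qed
  also have "\<dots> \<le> x \<bullet> (B *\<^sub>v x)" using le[OF x] dA by simp
  also have "\<dots> \<le> (\<Sum>i<n. bs ! j * (y $ i)\<^sup>2)"
    unfolding dB
  proof (rule sum_mono)
    fix i assume "i \<in> {..<n}"
    then show "bs ! i * (y $ i)\<^sup>2 \<le> bs ! j * (y $ i)\<^sup>2"
      using y(2)[of i] B(4,5) j by (cases "j < i") (auto intro!: mult_right_mono sorted_nth_mono)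
  qed
  also have "\<dots> = bs ! j * (x \<bullet> x)" unfolding dB by (simp add: sum_distrib_left)
  finally have "as ! j * (x \<bullet> x) \<le> bs ! j * (x \<bullet> x)" .
  moreover obtain i where "i \<le> j" "y $ i \<noteq> 0" using y(3) by blast
  then have "x \<bullet> x > 0"
    unfolding dB using j by (intro sum_pos2[of _ i]) auto
  ultimately show ?thesis by simp
qed

lemma eigenvalue_list:
  fixes A :: "real mat"
  assumes "A \<in> carrier_mat n n" "transpose_mat A = A"
  shows "char_poly A = (\<Prod>e\<leftarrow>eigenvalue_list A. [:- e, 1:])"
    and "sorted (eigenvalue_list A)" and "length (eigenvalue_list A) = n"
proof -
  obtain es where es: "char_poly A = (\<Prod>e\<leftarrow>es. [:- e, 1:])" "length es = n"
    using symmetric_char_poly_splits[OF assms] by blast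
  have "(\<Prod>e\<leftarrow>xs. [:- e, 1:]) \<noteq> 0" for xs :: "real list"
    by (induction xs) (simp_all del: mult_pCons_left)
  then have "proots (\<Prod>e\<leftarrow>es. [:- e, 1:]) = mset es"
    by (induction es) (simp_all add: proots_mult del: mult_pCons_left)
  then have l: "eigenvalue_list A = sort es"
    unfolding eigenvalue_list_def es(1) by simp
  then show "sorted (eigenvalue_list A)" "length (eigenvalue_list A) = n" using es(2) by auto
  have "(\<Prod>e\<leftarrow>es. [:- e, 1:]) = (\<Prod>e\<leftarrow>sort es. [:- e, 1:])"
    by (simp flip: prod_mset_prod_list)
  then show "char_poly A = (\<Prod>e\<leftarrow>eigenvalue_list A. [:- e, 1:])" unfolding l es(1) .
qed

lemma sum_eigenvalues:
  fixes A :: "real mat"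
  assumes A: "A \<in> carrier_mat n n" "transpose_mat A = A"
  shows "(\<Sum>i<n. eigenvalue_list A ! i) = (\<Sum>i<n. A $$ (i, i))"
proof -
  define es where "es = eigenvalue_list A"
  obtain P where P: "P \<in> carrier_mat n n" "transpose_mat P * P = 1\<^sub>m n"
    "transpose_mat P * A * P = mat n n (\<lambda>(i, j). if i = j then es ! i else 0)"
    using real_spectral_decomposition[OF A eigenvalue_list(1)[OF A], folded es_def] by blast
  have PP': "P * transpose_mat P = 1\<^sub>m n"
    using mat_mult_left_right_inverse[OF _ P(1,2)] P(1) by auto
  have tr: "(\<Sum>i<n. (X * Y) $$ (i, i)) = (\<Sum>i<n. (Y * X) $$ (i, i))"
    if "X \<in> carrier_mat n n" "Y \<in> carrier_mat n n" for X Y :: "real mat"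
  proof -
    have "(\<Sum>i<n. (X * Y) $$ (i, i)) = (\<Sum>i<n. \<Sum>k<n. X $$ (i, k) * Y $$ (k, i))"
      using that by (auto simp: scalar_prod_def lessThan_atLeast0)
    also have "\<dots> = (\<Sum>k<n. \<Sum>i<n. Y $$ (k, i) * X $$ (i, k))"
      by (subst sum.swap) (simp add: mult.commute)
    also have "\<dots> = (\<Sum>i<n. (Y * X) $$ (i, i))"
      using that by (auto simp: scalar_prod_def lessThan_atLeast0)
    finally show ?thesis .
  qed
  have "(\<Sum>i<n. es ! i) = (\<Sum>i<n. (transpose_mat P * A * P) $$ (i, i))"
    unfolding P(3) by simp
  also have "\<dots> = (\<Sum>i<n. (P * (transpose_mat P * A)) $$ (i, i))"
    using P(1) A(1) by (intro tr) auto
  also have "P * (transpose_mat P * A) = A"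
    using P(1) A(1) PP' by (simp flip: assoc_mult_mat[of _ n n _ n _ n])
  finally show ?thesis by (simp add: es_def)
qed

lemma eigenvalue_nonneg:
  fixes A :: "real mat"
  assumes A: "A \<in> carrier_mat n n" "transpose_mat A = A"
    and psd: "\<And>x. x \<in> carrier_vec n \<Longrightarrow> 0 \<le> x \<bullet> (A *\<^sub>v x)" and j: "j < n"
  shows "0 \<le> eigenvalue_list A ! j"
proof -
  define es where "es = eigenvalue_list A"
  obtain P where P: "P \<in> carrier_mat n n" "transpose_mat P * P = 1\<^sub>m n"
    "transpose_mat P * A * P = mat n n (\<lambda>(i, j). if i = j then es ! i else 0)"
    using real_spectral_decomposition[OF A eigenvalue_list(1)[OF A], folded es_def] by blast
  have "(\<Sum>i<n. es ! i * (unit_vec n j $ i)\<^sup>2) = es ! j"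
    using j by (simp add: unit_vec_def if_distrib[of "\<lambda>x. _ * x"] if_distrib[of "\<lambda>x. x ^ 2"] cong: if_cong)
  then show ?thesis
    using quadratic_form_diagonalized(1)[OF A(1) P, of "unit_vec n j"] psd[of "P *\<^sub>v unit_vec n j"] P(1)
    by (simp add: es_def)
qed

section \<open>Matrices given by kernels on finite sets\<close>

definition fmat :: "('a \<Rightarrow> 'a \<Rightarrow> real) \<Rightarrow> 'a list \<Rightarrow> real mat" where
  "fmat M xs = mat (length xs) (length xs) (\<lambda>(i, j). M (xs ! i) (xs ! j))"

lemma fmat_carrier [simp]: "fmat M xs \<in> carrier_mat (length xs) (length xs)"
  by (simp add: fmat_def)

lemma fmat_dims [simp]: "dim_row (fmat M xs) = length xs" "dim_col (fmat M xs) = length xs"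
  by (simp_all add: fmat_def)

lemma fmat_symmetric:
  assumes "\<And>a b. a \<in> set xs \<Longrightarrow> b \<in> set xs \<Longrightarrow> M a b = M b a"
  shows "transpose_mat (fmat M xs) = fmat M xs"
  using assms by (intro eq_matI) (auto simp: fmat_def)

lemma sum_list_index: "distinct xs \<Longrightarrow> (\<Sum>k<length xs. f (xs ! k)) = (\<Sum>x\<in>set xs. f x)"
  using sum.reindex_bij_betw[OF bij_betw_nth[OF _ refl refl], of xs f] by simp

lemma char_poly_fmat_signed_reindex:
  assumes xs: "distinct xs" and ys: "distinct ys" and h: "bij_betw h (set ys) (set xs)"
    and \<epsilon>: "\<And>a. a \<in> set ys \<Longrightarrow> \<epsilon> a * \<epsilon> a = (1 :: real)"
    and M': "\<And>a b. a \<in> set ys \<Longrightarrow> b \<in> set ys \<Longrightarrow> M' a b = \<epsilon> a * \<epsilon> b * M (h a) (h b)"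
  shows "char_poly (fmat M' ys) = char_poly (fmat M xs)"
proof -
  define n where "n = length xs"
  have ny: "length ys = n"
    using bij_betw_same_card[OF h] xs ys by (simp add: n_def distinct_card)
  define S where "S = mat n n (\<lambda>(i, j). if h (ys ! i) = xs ! j then \<epsilon> (ys ! i) else 0)"
  have S: "S \<in> carrier_mat n n" by (simp add: S_def)
  have hm: "h (ys ! i) \<in> set xs" if "i < n" for i
    using h that ny by (auto simp: bij_betw_def)
  have SS: "S * transpose_mat S = 1\<^sub>m n"
  proof (intro eq_matI)
    fix i j assume "i < dim_row (1\<^sub>m n :: real mat)" "j < dim_col (1\<^sub>m n :: real mat)"
    then have ij: "i < n" "j < n" by auto
    have "(S * transpose_mat S) $$ (i, j) =
      (\<Sum>k<length xs. (if h (ys ! i) = xs ! k then \<epsilon> (ys ! i) else 0) * (if h (ys ! j) = xs ! k then \<epsilon> (ys ! j) else 0))"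
      using ij by (simp add: S_def scalar_prod_def lessThan_atLeast0 n_def)
    also have "\<dots> = (\<Sum>x\<in>set xs. (if h (ys ! i) = x then \<epsilon> (ys ! i) else 0) * (if h (ys ! j) = x then \<epsilon> (ys ! j) else 0))"
      by (rule sum_list_index[OF xs])
    also have "\<dots> = (if h (ys ! i) = h (ys ! j) then \<epsilon> (ys ! i) * \<epsilon> (ys ! j) else 0)"
      using hm[OF ij(1)] hm[OF ij(2)] by (simp add: mult_delta_left mult_delta_right)
    also have "h (ys ! i) = h (ys ! j) \<longleftrightarrow> i = j"
      using h ij ny ys unfolding bij_betw_def inj_on_def by (metis nth_eq_iff_index_eq nth_mem)
    also have "(if i = j then \<epsilon> (ys ! i) * \<epsilon> (ys ! j) else 0) = (1\<^sub>m n) $$ (i, j)"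
      using ij ny \<epsilon>[of "ys ! i"] by auto
    finally show "(S * transpose_mat S) $$ (i, j) = 1\<^sub>m n $$ (i, j)" .
  qed (use S in auto)
  moreover have "transpose_mat S * S = 1\<^sub>m n"
    using mat_mult_left_right_inverse[OF S _ SS] S by auto
  moreover have "fmat M' ys = S * fmat M xs * transpose_mat S"
  proof (intro eq_matI)
    fix i j assume "i < dim_row (S * fmat M xs * transpose_mat S)" "j < dim_col (S * fmat M xs * transpose_mat S)"
    then have ij: "i < n" "j < n" using S by auto
    have SM: "(S * fmat M xs) $$ (i, l) = \<epsilon> (ys ! i) * M (h (ys ! i)) (xs ! l)" if "l < n" for l
    proof -
      have "(S * fmat M xs) $$ (i, l) =
        (\<Sum>k<length xs. (if h (ys ! i) = xs ! k then \<epsilon> (ys ! i) else 0) * M (xs ! k) (xs ! l))"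
        using ij that by (simp add: S_def fmat_def scalar_prod_def lessThan_atLeast0 n_def)
      also have "\<dots> = (\<Sum>x\<in>set xs. (if h (ys ! i) = x then \<epsilon> (ys ! i) else 0) * M x (xs ! l))"
        by (rule sum_list_index[OF xs])
      finally show ?thesis
        using hm[OF ij(1)] by (simp add: mult_delta_left mult_delta_right)
    qed
    have "(S * fmat M xs * transpose_mat S) $$ (i, j) = (\<Sum>l<n. (S * fmat M xs) $$ (i, l) * S $$ (j, l))"
      using ij S
      by (auto simp: scalar_prod_def lessThan_atLeast0 n_def intro!: sum.cong)
    also have "\<dots> = (\<Sum>l<length xs. \<epsilon> (ys ! i) * M (h (ys ! i)) (xs ! l) * (if h (ys ! j) = xs ! l then \<epsilon> (ys ! j) else 0))"
      using ij SM by (intro sum.cong) (auto simp: S_def n_def)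
    also have "\<dots> = (\<Sum>x\<in>set xs. \<epsilon> (ys ! i) * M (h (ys ! i)) x * (if h (ys ! j) = x then \<epsilon> (ys ! j) else 0))"
      by (rule sum_list_index[OF xs])
    also have "\<dots> = \<epsilon> (ys ! i) * \<epsilon> (ys ! j) * M (h (ys ! i)) (h (ys ! j))"
      using hm[OF ij(2)] by (simp add: mult_delta_left mult_delta_right)
    also have "\<dots> = fmat M' ys $$ (i, j)"
      using ij ny M' by (simp add: fmat_def)
    finally show "fmat M' ys $$ (i, j) = (S * fmat M xs * transpose_mat S) $$ (i, j)" by simp
  qed (use S ny in \<open>auto simp: fmat_def\<close>)
  ultimately have "similar_mat_wit (fmat M' ys) (fmat M xs) S (transpose_mat S)"
    using S ny fmat_carrier[of M xs] fmat_carrier[of M' ys] by (intro similar_mat_witI[of _ _ n]) (auto simp: n_def)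
  then show ?thesis using char_poly_similar unfolding similar_mat_def by blast
qed

lemma char_poly_fmat_cong_set:
  assumes "distinct xs" "distinct ys" "set xs = set ys"
  shows "char_poly (fmat M xs) = char_poly (fmat M ys)"
  using assms by (intro char_poly_fmat_signed_reindex[where h = id and \<epsilon> = "\<lambda>_. 1"]) auto

lemma char_poly_fmat_append:
  assumes sym: "\<And>a b. a \<in> set (xs @ ys) \<Longrightarrow> b \<in> set (xs @ ys) \<Longrightarrow> M a b = M b a"
    and zero: "\<And>a b. a \<in> set xs \<Longrightarrow> b \<in> set ys \<Longrightarrow> M a b = 0"
  shows "char_poly (fmat M (xs @ ys)) = char_poly (fmat M xs) * char_poly (fmat M ys)"
proof (rule char_poly_0_block[where C = "0\<^sub>m (length xs) (length ys)" and n = "length xs" and m = "length ys"])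
  show "fmat M (xs @ ys) = four_block_mat (fmat M xs) (0\<^sub>m (length xs) (length ys)) (0\<^sub>m (length ys) (length xs)) (fmat M ys)"
  proof (intro eq_matI)
    fix i j assume ij: "i < dim_row (four_block_mat (fmat M xs) (0\<^sub>m (length xs) (length ys)) (0\<^sub>m (length ys) (length xs)) (fmat M ys))"
      "j < dim_col (four_block_mat (fmat M xs) (0\<^sub>m (length xs) (length ys)) (0\<^sub>m (length ys) (length xs)) (fmat M ys))"
    have "M (ys ! k) (xs ! l) = 0" if "k < length ys" "l < length xs" for k l
      using zero[of "xs ! l" "ys ! k"] sym[of "xs ! l" "ys ! k"] that by simp
    then show "fmat M (xs @ ys) $$ (i, j) =
      four_block_mat (fmat M xs) (0\<^sub>m (length xs) (length ys)) (0\<^sub>m (length ys) (length xs)) (fmat M ys) $$ (i, j)"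
      using ij zero by (auto simp: fmat_def nth_append)
  qed (auto simp: fmat_def)
  show "\<exists>es. char_poly (fmat M xs) = (\<Prod>a\<leftarrow>es. [:- a, 1:])"
    using symmetric_char_poly_splits[OF fmat_carrier fmat_symmetric, of xs M] sym by auto
  show "\<exists>es. char_poly (fmat M ys) = (\<Prod>a\<leftarrow>es. [:- a, 1:])"
    using symmetric_char_poly_splits[OF fmat_carrier fmat_symmetric, of ys M] sym by auto
qed auto

lemma char_poly_fmat_blocks:
  assumes "finite I" "distinct xs" "set xs = (\<Union>i\<in>I. S i)"
    and "\<And>i j. i \<in> I \<Longrightarrow> j \<in> I \<Longrightarrow> i \<noteq> j \<Longrightarrow> S i \<inter> S j = {}"
    and "\<And>a b. a \<in> set xs \<Longrightarrow> b \<in> set xs \<Longrightarrow> M a b = M b a"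
    and "\<And>i j a b. i \<in> I \<Longrightarrow> j \<in> I \<Longrightarrow> i \<noteq> j \<Longrightarrow> a \<in> S i \<Longrightarrow> b \<in> S j \<Longrightarrow> M a b = 0"
    and "\<And>i ys. i \<in> I \<Longrightarrow> distinct ys \<Longrightarrow> set ys = S i \<Longrightarrow> char_poly (fmat M ys) = q"
  shows "char_poly (fmat M xs) = q ^ card I"
  using assms
proof (induction I arbitrary: xs rule: finite_induct)
  case empty
  then show ?case by (simp add: fmat_def char_poly_defs)
next
  case (insert i I)
  have fin: "finite (S i)" "finite (\<Union>i\<in>I. S i)"
    using insert.prems(2) by (metis List.finite_set UN_insert finite_Un)+
  obtain ys where ys: "distinct ys" "set ys = S i" using finite_distinct_list[OF fin(1)] by metis
  obtain zs where zs: "distinct zs" "set zs = (\<Union>i\<in>I. S i)" using finite_distinct_list[OF fin(2)] by metis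
  have dis: "set ys \<inter> set zs = {}"
    unfolding ys zs using insert.prems(3)[of i] insert.hyps by blast
  have sub: "set ys \<subseteq> set xs" "set zs \<subseteq> set xs" using ys zs insert.prems(2) by auto
  have "char_poly (fmat M xs) = char_poly (fmat M (ys @ zs))"
    using insert.prems(1,2) ys zs dis by (intro char_poly_fmat_cong_set) auto
  also have "\<dots> = char_poly (fmat M ys) * char_poly (fmat M zs)"
  proof (rule char_poly_fmat_append)
    show "M a b = 0" if "a \<in> set ys" "b \<in> set zs" for a b
      using that insert.prems(5)[of i] insert.hyps ys zs by auto
    show "M a b = M b a" if "a \<in> set (ys @ zs)" "b \<in> set (ys @ zs)" for a b
      using that insert.prems(4) sub by auto
  qed
  also have "char_poly (fmat M ys) = q" using insert.prems(6)[of i ys] ys by auto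
  also have "char_poly (fmat M zs) = q ^ card I"
  proof (rule insert.IH[OF zs])
    show "S i \<inter> S j = {}" if "i \<in> I" "j \<in> I" "i \<noteq> j" for i j using insert.prems(3) that by auto
    show "M a b = M b a" if "a \<in> set zs" "b \<in> set zs" for a b using insert.prems(4) sub that by auto
    show "M a b = 0" if "i \<in> I" "j \<in> I" "i \<noteq> j" "a \<in> S i" "b \<in> S j" for i j a b
      using insert.prems(5)[of i j a b] that by auto
    show "char_poly (fmat M ys) = q" if "i \<in> I" "distinct ys" "set ys = S i" for i ys
      using insert.prems(6)[of i ys] that by auto
  qed
  finally show ?case using insert.hyps by simp
qed

section \<open>Spectral functions\<close>

lemma sorted_list_of_repeat_mset:
  "sorted_list_of_multiset (repeat_mset m (mset xs)) = concat (map (replicate m) (sort xs))"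
proof -
  have "mset (concat (map (replicate m) ys)) = repeat_mset m (mset ys)" for ys :: "'a list"
    by (induction ys) auto
  moreover have "sorted (concat (map (replicate m) ys))" if "sorted ys" for ys :: "'a list"
    using that by (induction ys) (auto simp: sorted_append)
  moreover have "repeat_mset m (mset xs) = repeat_mset m (mset (sort xs))" by simp
  ultimately show ?thesis
    by (metis sorted_list_of_multiset_mset sorted_sort sorted_sort_id)
qed

lemma nth_concat_replicate:
  "k < m * length xs \<Longrightarrow> concat (map (replicate m) xs) ! k = xs ! (k div m)"
proof (induction xs arbitrary: k)
  case (Cons x xs)
  then show ?case
    by (cases "k < m"; cases "m = 0") (auto simp: nth_append le_div_geq)
qed auto

lemma spectral_function_eq:
  assumes N: "dim_row L > 0"
  shows "spectral_function L x =
    (if 0 \<le> x \<and> x < 1 then eigenvalue_list L ! nat \<lfloor>x * real (dim_row L)\<rfloor> else 0)"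
proof -
  let ?N = "dim_row L"
  have iff: "x \<in> {(real j - 1) / real ?N..<real j / real ?N} \<longleftrightarrow> real j - 1 \<le> x * ?N \<and> x * ?N < real j" for j
    using N by (auto simp: field_simps)
  have "spectral_function L x = (\<Sum>j = 1..?N. if real j - 1 \<le> x * ?N \<and> x * ?N < real j then eigenvalue_list L ! (j - 1) else 0)"
    unfolding spectral_function_def indicator_def iff by (intro sum.cong) auto
  also have "\<dots> = (\<Sum>j = 1..?N. if 0 \<le> x \<and> j = nat \<lfloor>x * ?N\<rfloor> + 1 then eigenvalue_list L ! nat \<lfloor>x * ?N\<rfloor> else 0)"
  proof (intro sum.cong refl)
    fix j assume j: "j \<in> {1..?N}"
    have "real j - 1 \<le> x * ?N \<and> x * ?N < real j \<longleftrightarrow> \<lfloor>x * ?N\<rfloor> = int j - 1"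
      by (simp add: floor_eq_iff)
    also have "\<dots> \<longleftrightarrow> 0 \<le> \<lfloor>x * ?N\<rfloor> \<and> j = nat \<lfloor>x * ?N\<rfloor> + 1"
      using j by (auto simp: nat_eq_iff simp del: zero_le_floor)
    also have "0 \<le> \<lfloor>x * ?N\<rfloor> \<longleftrightarrow> 0 \<le> x"
      using N by (simp add: zero_le_mult_iff)
    finally show "(if real j - 1 \<le> x * ?N \<and> x * ?N < real j then eigenvalue_list L ! (j - 1) else 0) =
      (if 0 \<le> x \<and> j = nat \<lfloor>x * ?N\<rfloor> + 1 then eigenvalue_list L ! nat \<lfloor>x * ?N\<rfloor> else 0)" by auto
  qed
  also have "\<dots> = (if 0 \<le> x \<and> nat \<lfloor>x * ?N\<rfloor> + 1 \<in> {1..?N} then eigenvalue_list L ! nat \<lfloor>x * ?N\<rfloor> else 0)"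
    by (cases "0 \<le> x") auto
  also have "0 \<le> x \<and> nat \<lfloor>x * ?N\<rfloor> + 1 \<in> {1..?N} \<longleftrightarrow> 0 \<le> x \<and> x < 1"
  proof -
    have "nat \<lfloor>x * ?N\<rfloor> < ?N \<longleftrightarrow> x < 1" if "0 \<le> x"
      using that N by (simp add: nat_less_iff floor_less_iff)
    then show ?thesis by auto
  qed
  finally show ?thesis .
qed

lemma spectral_function_power:
  assumes A: "A \<in> carrier_mat N N" "transpose_mat A = A" "N > 0"
    and B: "B \<in> carrier_mat (m * N) (m * N)" and m: "m > 0"
    and cp: "char_poly B = char_poly A ^ m"
  shows "spectral_function B = spectral_function A"
proof
  fix x
  have "eigenvalue_list B = concat (map (replicate m) (eigenvalue_list A))"
    unfolding eigenvalue_list_def cp proots_power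
    by (metis mset_sorted_list_of_multiset sorted_list_of_repeat_mset sorted_sorted_list_of_multiset sort_key_id_if_sorted sorted_sort_id)
  then have nth: "eigenvalue_list B ! k = eigenvalue_list A ! (k div m)" if "k < m * N" for k
    using that eigenvalue_list(3)[OF A(1,2)] by (simp add: nth_concat_replicate)
  show "spectral_function B x = spectral_function A x"
  proof (cases "0 \<le> x \<and> x < 1")
    case True
    have "\<lfloor>x * real N\<rfloor> = \<lfloor>x * real (m * N) / real_of_int (int m)\<rfloor>" using m by simp
    also have "\<dots> = \<lfloor>x * real (m * N)\<rfloor> div int m" by (rule floor_divide_real_eq_div) simp
    finally have "nat \<lfloor>x * real (m * N)\<rfloor> div m = nat \<lfloor>x * real N\<rfloor>"
      by (simp add: nat_div_distrib')
    moreover have "nat \<lfloor>x * real (m * N)\<rfloor> < m * N"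
      using True A(3) m by (simp add: nat_less_iff floor_less_iff)
    ultimately show ?thesis using True nth A B m
      by (simp add: spectral_function_eq)
  qed (use A B m in \<open>auto simp: spectral_function_eq\<close>)
qed

lemma spectral_function_outside: "x \<notin> {0..1} \<Longrightarrow> spectral_function L x = 0"
  by (cases "dim_row L > 0") (auto simp: spectral_function_eq, auto simp: spectral_function_def)

lemma
  shows integrable_spectral_function: "integrable lborel (spectral_function L)"
    and integral_spectral_function:
      "(\<integral>x. spectral_function L x \<partial>lborel) = (\<Sum>i<dim_row L. eigenvalue_list L ! i) / dim_row L"
proof -
  let ?N = "dim_row L"
  have eq: "spectral_function L = (\<lambda>x. \<Sum>j = 1..?N. eigenvalue_list L ! (j - 1) *
      indicator {(real j - 1) / real ?N ..< real j / real ?N} x)"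
    by (rule ext) (rule spectral_function_def)
  have I: "integrable lborel (indicat_real {(real j - 1) / real ?N ..< real j / real ?N})" for j
    by (rule integrable_real_indicator) (auto simp: divide_right_mono)
  show "integrable lborel (spectral_function L)" unfolding eq using I by (intro Bochner_Integration.integrable_sum integrable_mult_right)
  have "(\<integral>x. spectral_function L x \<partial>lborel) = (\<Sum>j = 1..?N. eigenvalue_list L ! (j - 1) *
      measure lborel {(real j - 1) / real ?N ..< real j / real ?N})"
    unfolding eq using I by (subst Bochner_Integration.integral_sum) auto
  also have "\<dots> = (\<Sum>j = 1..?N. eigenvalue_list L ! (j - 1) / ?N)"
    by (intro sum.cong refl, subst measure_lborel_Ico) (auto simp: divide_right_mono field_simps)
  also have "\<dots> = (\<Sum>j = 1..?N. eigenvalue_list L ! (j - 1)) / ?N"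
    by (simp add: sum_divide_distrib)
  also have "(\<Sum>j = 1..?N. eigenvalue_list L ! (j - 1)) = (\<Sum>i<?N. eigenvalue_list L ! i)"
    by (rule sum.reindex_bij_witness[of _ Suc "\<lambda>j. j - 1"]) auto
  finally show "(\<integral>x. spectral_function L x \<partial>lborel) = (\<Sum>i<dim_row L. eigenvalue_list L ! i) / dim_row L" .
qed

lemma spectral_function_mono:
  assumes "dim_row A = n" "dim_row B = n" "n > 0"
    and "\<And>j. j < n \<Longrightarrow> eigenvalue_list A ! j \<le> eigenvalue_list B ! j"
  shows "spectral_function A x \<le> spectral_function B x"
proof -
  have "nat \<lfloor>x * real n\<rfloor> < n" if "0 \<le> x" "x < 1"
    using that assms(3) by (simp add: nat_less_iff floor_less_iff)
  then show ?thesis using assms by (simp add: spectral_function_eq)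
qed

lemma spectral_function_le_trace:
  assumes A: "A \<in> carrier_mat n n" "transpose_mat A = A" and n: "n > 0"
    and nn: "\<And>j. j < n \<Longrightarrow> 0 \<le> eigenvalue_list A ! j" and x: "0 \<le> x" "x < 1"
    and tr: "(\<Sum>i<n. A $$ (i, i)) \<le> C * real n"
  shows "spectral_function A x \<le> C / (1 - x)"
proof -
  define k where "k = nat \<lfloor>x * real n\<rfloor>"
  define es where "es = eigenvalue_list A"
  note es = eigenvalue_list[OF A, folded es_def]
  have k: "k < n" using x n by (simp add: nat_less_iff floor_less_iff k_def)
  have kx: "real k \<le> x * real n" using x by (simp add: k_def)
  have "0 \<le> es ! k" using nn k by (simp add: es_def)
  then have "es ! k * (real n * (1 - x)) \<le> es ! k * real (n - k)"
    using kx k by (intro mult_left_mono) (auto simp: algebra_simps of_nat_diff)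
  also have "\<dots> = (\<Sum>i\<in>{k..<n}. es ! k)" by simp
  also have "\<dots> \<le> (\<Sum>i\<in>{k..<n}. es ! i)"
    using es by (intro sum_mono sorted_nth_mono) auto
  also have "\<dots> \<le> (\<Sum>i<n. es ! i)"
    using nn by (intro sum_mono2) (auto simp: es_def)
  also have "\<dots> \<le> C * real n" using tr sum_eigenvalues[OF A] by (simp add: es_def)
  finally have "es ! k * (1 - x) \<le> C" using n by (simp add: mult.commute mult.left_commute)
  then have "es ! k \<le> C / (1 - x)" using x by (simp add: field_simps)
  then show ?thesis using x n A by (simp add: spectral_function_eq k_def es_def)
qed

lemma L1_unit_iff:
  assumes "\<And>x. x \<notin> {0..1} \<Longrightarrow> g x = 0"
  shows "L1_unit g \<longleftrightarrow> integrable lborel g"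
proof -
  have "(\<lambda>x. indicator {0..1} x *\<^sub>R g x) = g" using assms by (force simp: indicator_def)
  then show ?thesis by (simp add: L1_unit_def set_integrable_def)
qed

lemma L1_unit_tendsto_iff:
  assumes "\<And>n x. x \<notin> {0..1} \<Longrightarrow> g n x = 0" "\<And>x. x \<notin> {0..1} \<Longrightarrow> h x = 0"
  shows "L1_unit_tendsto g h \<longleftrightarrow> (\<forall>n. integrable lborel (g n)) \<and> integrable lborel h \<and>
    (\<lambda>n. \<integral>x. \<bar>g n x - h x\<bar> \<partial>lborel) \<longlonglongrightarrow> 0"
proof -
  have "(\<lambda>x. indicator {0..1} x *\<^sub>R \<bar>g n x - h x\<bar>) = (\<lambda>x. \<bar>g n x - h x\<bar>)" for n
    using assms by (force simp: indicator_def)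
  moreover have "L1_unit (g n) \<longleftrightarrow> integrable lborel (g n)" "L1_unit h \<longleftrightarrow> integrable lborel h" for n
    using assms by (intro L1_unit_iff; blast)+
  ultimately show ?thesis
    by (simp add: L1_unit_tendsto_def set_lebesgue_integral_def)
qed

lemma increasing_L1_limit:
  fixes f :: "nat \<Rightarrow> real \<Rightarrow> real"
  assumes int: "\<And>n. integrable lborel (f n)" and mono: "\<And>n x. f n x \<le> f (Suc n) x"
    and bound: "\<And>n x. f n x \<le> b x" and C: "\<And>n. (\<integral>x. f n x \<partial>lborel) \<le> C"
    and zero: "\<And>n x. x \<notin> {0..1} \<Longrightarrow> f n x = 0"
  shows "\<exists>\<Lambda>. (\<forall>x. x \<notin> {0..1} \<longrightarrow> \<Lambda> x = 0) \<and> integrable lborel \<Lambda> \<and>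
    (\<lambda>n. \<integral>x. \<bar>f n x - \<Lambda> x\<bar> \<partial>lborel) \<longlonglongrightarrow> 0"
proof -
  define \<Lambda> where "\<Lambda> x = lim (\<lambda>n. f n x)" for x
  have inc: "incseq (\<lambda>n. f n x)" for x using mono by (simp add: incseq_Suc_iff)
  have conv: "(\<lambda>n. f n x) \<longlonglongrightarrow> \<Lambda> x" for x
    unfolding \<Lambda>_def convergent_LIMSEQ_iff[symmetric]
    using incseq_convergent[OF inc, of x "b x"] bound by (metis convergentI)
  have le: "f n x \<le> \<Lambda> x" for n x using incseq_le[OF inc conv] .
  have "incseq (\<lambda>n. \<integral>x. f n x \<partial>lborel)"
    using mono int by (simp add: incseq_Suc_iff integral_mono)
  then obtain c where c: "(\<lambda>n. \<integral>x. f n x \<partial>lborel) \<longlonglongrightarrow> c"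
    using incseq_convergent[of _ C] C by metis
  have meas: "\<Lambda> \<in> borel_measurable lborel"
    using int by (intro borel_measurable_LIMSEQ_real[OF conv]) auto
  have AEmono: "AE x in lborel. mono (\<lambda>n. f n x)" using inc by auto
  have AElim: "AE x in lborel. (\<lambda>n. f n x) \<longlonglongrightarrow> \<Lambda> x" using conv by auto
  have I: "integrable lborel \<Lambda>" "integral\<^sup>L lborel \<Lambda> = c"
    using integrable_monotone_convergence[OF int AEmono AElim c meas]
      integral_monotone_convergence[OF int AEmono AElim c meas] by auto
  have "(\<integral>x. \<bar>f n x - \<Lambda> x\<bar> \<partial>lborel) = c - (\<integral>x. f n x \<partial>lborel)" for n
  proof -
    have "(\<lambda>x. \<bar>f n x - \<Lambda> x\<bar>) = (\<lambda>x. \<Lambda> x - f n x)" using le by fastforce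
    then show ?thesis using I int by simp
  qed
  then have "(\<lambda>n. \<integral>x. \<bar>f n x - \<Lambda> x\<bar> \<partial>lborel) \<longlonglongrightarrow> 0"
    using tendsto_diff[OF tendsto_const c, of c] by simp
  moreover have "\<Lambda> x = 0" if "x \<notin> {0..1}" for x
    using conv[of x] zero[OF that] by (simp add: LIMSEQ_const_iff)
  ultimately show ?thesis using I(1) by (intro exI[of _ \<Lambda>] conjI allI impI)
qed

section \<open>Gram kernels\<close>

definition gram :: "'b set \<Rightarrow> ('b \<Rightarrow> 'a \<Rightarrow> real) \<Rightarrow> 'a \<Rightarrow> 'a \<Rightarrow> real" where
  "gram R g a b = (\<Sum>\<rho>\<in>R. g \<rho> a * g \<rho> b)"

lemma gram_commute: "gram R g a b = gram R g b a"
  by (simp add: gram_def mult.commute)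

lemma quadratic_form_gram:
  assumes x: "x \<in> carrier_vec (length xs)"
  shows "x \<bullet> (fmat (gram R g) xs *\<^sub>v x) = (\<Sum>\<rho>\<in>R. (\<Sum>i<length xs. g \<rho> (xs ! i) * x $ i)\<^sup>2)"
proof -
  let ?n = "length xs"
  have "x \<bullet> (fmat (gram R g) xs *\<^sub>v x) = (\<Sum>i<?n. x $ i * (\<Sum>j<?n. gram R g (xs ! i) (xs ! j) * x $ j))"
    using x by (simp add: fmat_def scalar_prod_def lessThan_atLeast0)
  also have "\<dots> = (\<Sum>i<?n. \<Sum>j<?n. \<Sum>\<rho>\<in>R. (g \<rho> (xs ! i) * x $ i) * (g \<rho> (xs ! j) * x $ j))"
    by (simp add: gram_def sum_distrib_left sum_distrib_right mult.assoc mult.left_commute)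
  also have "\<dots> = (\<Sum>i<?n. \<Sum>\<rho>\<in>R. \<Sum>j<?n. (g \<rho> (xs ! i) * x $ i) * (g \<rho> (xs ! j) * x $ j))"
    by (intro sum.cong refl sum.swap)
  also have "\<dots> = (\<Sum>\<rho>\<in>R. \<Sum>i<?n. \<Sum>j<?n. (g \<rho> (xs ! i) * x $ i) * (g \<rho> (xs ! j) * x $ j))"
    by (rule sum.swap)
  finally show ?thesis by (simp add: power2_eq_square sum_product)
qed

lemma fmat_gram_symmetric: "transpose_mat (fmat (gram R g) xs) = fmat (gram R g) xs"
  by (rule fmat_symmetric) (rule gram_commute)

lemma eigenvalue_gram_mono:
  assumes "finite R" "R' \<subseteq> R" "j < length xs"
  shows "eigenvalue_list (fmat (gram R' g) xs) ! j \<le> eigenvalue_list (fmat (gram R g) xs) ! j"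
  by (rule eigenvalues_mono[OF fmat_carrier fmat_gram_symmetric _ _ _ fmat_carrier fmat_gram_symmetric])
    (use assms in \<open>auto simp: quadratic_form_gram eigenvalue_list(2)[OF fmat_carrier fmat_gram_symmetric]
        eigenvalue_list(3)[OF fmat_carrier fmat_gram_symmetric]
        simp flip: eigenvalue_list(1)[OF fmat_carrier fmat_gram_symmetric] intro!: sum_mono2\<close>)

lemma eigenvalue_gram_nonneg:
  "j < length xs \<Longrightarrow> 0 \<le> eigenvalue_list (fmat (gram R g) xs) ! j"
  by (rule eigenvalue_nonneg[OF fmat_carrier fmat_gram_symmetric])
    (auto simp: quadratic_form_gram intro: sum_nonneg)

lemma trace_fmat_gram:
  assumes "distinct xs"
  shows "(\<Sum>i<length xs. fmat (gram R g) xs $$ (i, i)) = (\<Sum>a\<in>set xs. \<Sum>\<rho>\<in>R. (g \<rho> a)\<^sup>2)"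
  using sum_list_index[OF assms, of "\<lambda>a. gram R g a a"]
  by (simp add: fmat_def gram_def power2_eq_square)

lemma integral_spectral_gram:
  assumes "distinct xs"
  shows "(\<integral>x. spectral_function (fmat (gram R g) xs) x \<partial>lborel) =
    (\<Sum>a\<in>set xs. \<Sum>\<rho>\<in>R. (g \<rho> a)\<^sup>2) / length xs"
  by (simp add: integral_spectral_function sum_eigenvalues[OF fmat_carrier fmat_gram_symmetric]
      trace_fmat_gram[OF assms])

section \<open>Incidence numbers\<close>

lemma permute_list_unique:
  assumes "distinct r" "p permutes {..<length r}" "q permutes {..<length r}"
    and "permute_list p r = permute_list q r"
  shows "p = q"
proof (rule ext)
  fix i show "p i = q i"
  proof (cases "i < length r")
    case True
    then have "r ! p i = r ! q i"
      using assms by (metis permute_list_nth)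
    moreover have "p i < length r" "q i < length r"
      using True permutes_in_image[OF assms(2)] permutes_in_image[OF assms(3)] by auto
    ultimately show ?thesis using assms(1) by (simp add: nth_eq_iff_index_eq)
  next
    case False
    then show ?thesis using assms by (simp add: permutes_def)
  qed
qed

lemma relative_sign_le_1:
  assumes "distinct r"
  shows "\<bar>relative_sign r s\<bar> \<le> 1"
proof (cases "\<exists>p. p permutes {..<length r} \<and> permute_list p r = s")
  case True
  then obtain p where "p permutes {..<length r}" "permute_list p r = s" by blast
  then have "{p. p permutes {..<length r} \<and> permute_list p r = s} = {p}"
    using permute_list_unique[OF assms] by blast
  then have "relative_sign r s = of_int (sign p)" by (simp add: relative_sign_def)
  then show ?thesis by (simp add: sign_def)
next
  case False
  then have "{p. p permutes {..<length r} \<and> permute_list p r = s} = {}" by blast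
  then show ?thesis unfolding relative_sign_def by (simp only: sum.empty abs_zero zero_le_one)
qed

lemma relative_sign_eq_0:
  assumes "mset r \<noteq> mset s"
  shows "relative_sign r s = 0"
proof -
  have "{p. p permutes {..<length r} \<and> permute_list p r = s} = {}"
    using assms by auto
  then show ?thesis unfolding relative_sign_def by (simp only: sum.empty)
qed

lemma incidence_eq_0:
  assumes "\<not> set r \<subseteq> set s"
  shows "incidence r s = 0"
proof -
  have "relative_sign r (take j s @ drop (Suc j) s) = 0" for j
  proof (rule relative_sign_eq_0)
    have "set (take j s @ drop (Suc j) s) \<subseteq> set s"
      using set_take_subset set_drop_subset by fastforce
    then show "mset r \<noteq> mset (take j s @ drop (Suc j) s)"
      using assms by (metis mset_eq_setD)
  qed
  then show ?thesis by (simp add: incidence_def)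
qed

lemma incidence_le_1:
  assumes r: "distinct r" and s: "distinct s"
  shows "\<bar>incidence r s\<bar> \<le> 1"
proof -
  define D where "D j = take j s @ drop (Suc j) s" for j
  have setD: "set (D j) = set s - {s ! j}" if "j < length s" for j
  proof -
    have "distinct (take j s @ s ! j # drop (Suc j) s)"
      using s that by (simp flip: id_take_nth_drop)
    moreover have "set s = set (take j s @ s ! j # drop (Suc j) s)"
      using that by (simp flip: id_take_nth_drop)
    ultimately show ?thesis by (auto simp: D_def)
  qed
  show ?thesis
  proof (cases "\<exists>j<length s. relative_sign r (D j) \<noteq> 0")
    case True
    then obtain j where j: "j < length s" "relative_sign r (D j) \<noteq> 0" by blast
    have "relative_sign r (D k) = 0" if k: "k < length s" "k \<noteq> j" for k
    proof (rule relative_sign_eq_0, rule notI)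
      assume "mset r = mset (D k)"
      moreover have "mset r = mset (D j)" using j relative_sign_eq_0 by blast
      ultimately have "set (D j) = set (D k)" by (metis mset_eq_setD)
      then have "s ! j \<in> set s - {s ! k} \<longrightarrow> s ! j \<in> set s - {s ! j}" using setD j k by simp
      then show False using s j k by (simp add: nth_eq_iff_index_eq)
    qed
    then have "incidence r s = (\<Sum>k<length s. if k = j then (-1) ^ j * relative_sign r (D j) else 0)"
      unfolding incidence_def D_def[symmetric] by (intro sum.cong) auto
    also have "\<dots> = (-1) ^ j * relative_sign r (D j)" using j by simp
    finally show ?thesis using relative_sign_le_1[OF r] by (simp add: abs_mult power_abs)
  next
    case False
    then show ?thesis by (simp add: incidence_def D_def)
  qed
qed

text \<open>Expanding along the row of ones recovers the boundary formula; the change of sign under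
  reordering then becomes that of a determinant under permutations of rows and columns.\<close>

definition incidence_mat :: "'a list \<Rightarrow> 'a list \<Rightarrow> real mat" where
  "incidence_mat r s = mat (length s) (length s)
     (\<lambda>(i, j). if i = 0 then 1 else if r ! (i - 1) = s ! j then 1 else 0)"

lemma relative_sign_det:
  assumes "distinct r" "length s = length r"
  shows "relative_sign r s = det (mat (length r) (length r) (\<lambda>(i, j). if r ! i = s ! j then 1 else 0))"
    (is "_ = det ?A")
proof -
  let ?n = "length r"
  have A: "?A \<in> carrier_mat ?n ?n" by simp
  have "(\<Prod>i = 0..<?n. if r ! p i = s ! i then 1 else 0) = (if permute_list p r = s then 1 else (0 :: real))"
    if p: "p permutes {..<?n}" for p
  proof (cases "permute_list p r = s")
    case True
    then have "r ! p i = s ! i" if "i < ?n" for i using permute_list_nth[OF p that] by simp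
    then show ?thesis using True by (simp add: prod.neutral)
  next
    case False
    then obtain i where "i < ?n" "r ! p i \<noteq> s ! i"
      using assms(2) p by (metis length_permute_list nth_equalityI permute_list_nth)
    then have "(\<Prod>i = 0..<?n. if r ! p i = s ! i then 1 else (0 :: real)) = 0"
      by (intro prod_zero) auto
    then show ?thesis using False by simp
  qed
  then have "(\<Sum>p | p permutes {..<?n}. of_int (sign p) * (\<Prod>i = 0..<?n. if r ! p i = s ! i then 1 else (0 :: real))) =
    (\<Sum>p | p permutes {..<?n}. if permute_list p r = s then of_int (sign p) else 0)"
    by (intro sum.cong) auto
  also have "\<dots> = relative_sign r s"
    unfolding relative_sign_def
    by (rule sum.inter_filter[symmetric, of "{p. p permutes {..<?n}}", simplified]) (simp add: finite_permutations)
  moreover have "det ?A = det (transpose_mat ?A)" using det_transpose[OF A] by simp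
  moreover have "det (transpose_mat ?A) =
      (\<Sum>p | p permutes {..<?n}. of_int (sign p) * (\<Prod>i = 0..<?n. if r ! p i = s ! i then 1 else (0 :: real)))"
    unfolding det_def'[OF transpose_carrier_mat[THEN iffD2, OF A]] lessThan_atLeast0
    by (intro sum.cong refl arg_cong2[of _ _ _ _ "(*)"] prod.cong)
      (auto simp: sign_def permutes_def dest: permutes_in_image)
  ultimately show ?thesis by simp
qed

lemma incidence_det:
  assumes r: "distinct r" and len: "length s = Suc (length r)"
  shows "incidence r s = det (incidence_mat r s)"
proof -
  let ?n = "length s"
  have M: "incidence_mat r s \<in> carrier_mat ?n ?n" by (simp add: incidence_mat_def)
  have "cofactor (incidence_mat r s) 0 j = (-1) ^ j * relative_sign r (take j s @ drop (Suc j) s)"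
    if j: "j < ?n" for j
  proof -
    have "mat_delete (incidence_mat r s) 0 j = mat (length r) (length r)
        (\<lambda>(i, k). if r ! i = (take j s @ drop (Suc j) s) ! k then 1 else 0)"
      using j len by (intro eq_matI) (auto simp: mat_delete_def incidence_mat_def nth_append min_def)
    then show ?thesis
      using j len r by (subst relative_sign_det) (auto simp: cofactor_def)
  qed
  then show ?thesis
    using laplace_expansion_row[OF M, of 0] len
    by (simp add: incidence_def incidence_mat_def)
qed

lemma sign_square: "(of_int (sign p) :: real) * of_int (sign p) = 1"
  by (simp add: sign_def)

lemma mset_permute_list:
  assumes "mset xs = mset ys"
  obtains p where "p permutes {..<length ys}" "permute_list p ys = xs"
  using mset_eq_permutation[OF assms] by blast

lemma incidence_permute_simplex:
  assumes "distinct s" "distinct s'" "set s = set s'"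
  shows "\<exists>\<epsilon>. \<epsilon> * \<epsilon> = (1 :: real) \<and>
    (\<forall>r. distinct r \<and> length s = Suc (length r) \<longrightarrow> incidence r s' = \<epsilon> * incidence r s)"
proof -
  have "mset s' = mset s" using assms set_eq_iff_mset_eq_distinct by metis
  then obtain p where p: "p permutes {..<length s}" "permute_list p s = s'"
    using mset_permute_list by metis
  have len: "length s' = length s" using p(2) by auto
  have p': "p permutes {0..<length s}" using p by (simp add: lessThan_atLeast0)
  have "incidence r s' = of_int (sign p) * incidence r s" if r: "distinct r" "length s = Suc (length r)" for r
  proof -
    have "transpose_mat (incidence_mat r s') =
      mat (length s) (length s) (\<lambda>(i, j). transpose_mat (incidence_mat r s) $$ (p i, j))"
      using permutes_in_image[OF p(1)] len
      by (intro eq_matI) (auto simp: incidence_mat_def permute_list_nth[OF p(1)] simp flip: p(2))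
    then have "det (transpose_mat (incidence_mat r s')) = of_int (sign p) * det (transpose_mat (incidence_mat r s))"
      using det_permute_rows[OF _ p', of "transpose_mat (incidence_mat r s)"]
      by (simp add: incidence_mat_def)
    then have "det (incidence_mat r s') = of_int (sign p) * det (incidence_mat r s)"
      using det_transpose[of "incidence_mat r s" "length s"] det_transpose[of "incidence_mat r s'" "length s"] len
      by (simp add: incidence_mat_def)
    then show ?thesis using incidence_det[OF r(1)] r(2) len by simp
  qed
  then show ?thesis using sign_square[of p] by (intro exI[of _ "of_int (sign p)"]) auto
qed

lemma incidence_permute_facet:
  assumes "distinct r" "distinct r'" "set r = set r'"
  shows "\<exists>\<epsilon>. \<epsilon> * \<epsilon> = (1 :: real) \<and>
    (\<forall>s. length s = Suc (length r) \<longrightarrow> incidence r' s = \<epsilon> * incidence r s)"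
proof -
  have "mset r' = mset r" using assms set_eq_iff_mset_eq_distinct by metis
  then obtain p where p: "p permutes {..<length r}" "permute_list p r = r'"
    using mset_permute_list by metis
  have len: "length r' = length r" using p(2) by auto
  obtain \<epsilon> :: real where \<epsilon>: "\<epsilon> * \<epsilon> = 1" "\<And>t. length t = length r \<Longrightarrow> relative_sign r' t = \<epsilon> * relative_sign r t"
  proof
    show "(of_int (sign p) :: real) * of_int (sign p) = 1" by (rule sign_square)
    fix t :: "'a list" assume t: "length t = length r"
    let ?M = "mat (length r) (length r) (\<lambda>(i, j). if r ! i = t ! j then 1 else 0) :: real mat"
    have p': "p permutes {0..<length r}" using p by (simp add: lessThan_atLeast0)
    have "mat (length r) (length r) (\<lambda>(i, j). if r' ! i = t ! j then 1 else 0) =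
      mat (length r) (length r) (\<lambda>(i, j). ?M $$ (p i, j))"
      using permutes_in_image[OF p(1)]
      by (intro eq_matI) (auto simp: permute_list_nth[OF p(1)] simp flip: p(2))
    then show "relative_sign r' t = of_int (sign p) * relative_sign r t"
      using det_permute_rows[OF _ p', of ?M] t len assms
      by (simp add: relative_sign_det)
  qed
  have "incidence r' s = \<epsilon> * incidence r s" if "length s = Suc (length r)" for s
    unfolding incidence_def sum_distrib_left
    using that by (intro sum.cong refl) (auto simp: \<epsilon>(2) min_def)
  then show ?thesis using \<epsilon>(1) by blast
qed

lemma incidence_map:
  assumes "inj_on f (set r \<union> set s)"
  shows "incidence (map f r) (map f s) = incidence r s"
proof -
  have "relative_sign (map f r) (map f t) = relative_sign r t" if t: "set t \<subseteq> set s" for t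
  proof -
    have "permute_list p (map f r) = map f t \<longleftrightarrow> permute_list p r = t" if p: "p permutes {..<length r}" for p
    proof -
      have "permute_list p (map f r) = map f (permute_list p r)"
        using p by (simp add: permute_list_map)
      moreover have "set (permute_list p r) = set r" using p by simp
      then have "inj_on f (set (permute_list p r) \<union> set t)"
        using t by (intro inj_on_subset[OF assms]) auto
      ultimately show ?thesis by (simp add: inj_on_map_eq_map)
    qed
    then have "{p. p permutes {..<length r} \<and> permute_list p (map f r) = map f t} =
        {p. p permutes {..<length r} \<and> permute_list p r = t}" by blast
    then show ?thesis by (simp add: relative_sign_def)
  qed
  moreover have "set (take j s @ drop (Suc j) s) \<subseteq> set s" for j
    using set_take_subset set_drop_subset by fastforce
  ultimately have "relative_sign (map f r) (map f (take j s @ drop (Suc j) s)) =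
      relative_sign r (take j s @ drop (Suc j) s)" for j by blast
  then show ?thesis by (simp add: incidence_def take_map drop_map)
qed

section \<open>Affinely independent sets\<close>

lemma affine_coordinates_unique:
  fixes T :: "'a::real_vector set"
  assumes "finite T" "\<not> affine_dependent T" "sum u T = sum v T"
    and "(\<Sum>x\<in>T. u x *\<^sub>R x) = (\<Sum>x\<in>T. v x *\<^sub>R x)" and "x \<in> T"
  shows "u x = v x"
proof (rule ccontr)
  assume "u x \<noteq> v x"
  then have "\<exists>U. sum U T = 0 \<and> (\<exists>v\<in>T. U v \<noteq> 0) \<and> (\<Sum>v\<in>T. U v *\<^sub>R v) = 0"
    using assms by (intro exI[of _ "\<lambda>x. u x - v x"])
      (auto simp: sum_subtractf scaleR_diff_left)
  then show False using assms(2) by (simp add: affine_dependent_explicit_finite[OF assms(1)])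
qed

lemma convex_hull_subset_coordinates:
  assumes "finite T" "F \<subseteq> T" "x \<in> convex hull F"
  obtains u where "\<And>y. 0 \<le> u y" "\<And>y. y \<notin> F \<Longrightarrow> u y = 0" "sum u T = 1" "(\<Sum>y\<in>T. u y *\<^sub>R y) = x"
proof -
  have F: "finite F" using assms finite_subset by blast
  obtain u where u: "\<forall>y\<in>F. 0 \<le> u y" "sum u F = 1" "(\<Sum>y\<in>F. u y *\<^sub>R y) = x"
    using assms(3) unfolding convex_hull_finite[OF F] by blast
  show ?thesis
  proof (rule that[of "\<lambda>y. if y \<in> F then u y else 0"])
    show "(\<Sum>y\<in>T. (if y \<in> F then u y else 0)) = 1"
      using u(2) assms(1,2) by (simp add: sum.If_cases Int_absorb1)
    have "(\<Sum>y\<in>T. (if y \<in> F then u y else 0) *\<^sub>R y) = (\<Sum>y\<in>F. u y *\<^sub>R y)"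
      using assms(1,2) by (intro sum.mono_neutral_cong_right) auto
    then show "(\<Sum>y\<in>T. (if y \<in> F then u y else 0) *\<^sub>R y) = x" using u(3) by simp
  qed (use u in auto)
qed

lemma coordinates_vanish:
  assumes "finite T" "\<not> affine_dependent T" "F \<subseteq> T" "(\<Sum>y\<in>T. u y *\<^sub>R y) \<in> convex hull F"
    and "sum u T = 1" "y \<in> T" "y \<notin> F"
  shows "u y = 0"
proof -
  obtain v where v: "\<And>y. y \<notin> F \<Longrightarrow> v y = 0" "sum v T = 1" "(\<Sum>y\<in>T. v y *\<^sub>R y) = (\<Sum>y\<in>T. u y *\<^sub>R y)"
    using convex_hull_subset_coordinates[OF assms(1,3,4)] by metis
  then show ?thesis using affine_coordinates_unique[OF assms(1,2), of u v y] assms by simp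
qed

lemma in_convex_hull_subset_iff:
  assumes "finite T" "\<not> affine_dependent T" "F \<subseteq> T" "\<And>y. y \<in> T \<Longrightarrow> 0 \<le> u y" "sum u T = 1"
  shows "(\<Sum>y\<in>T. u y *\<^sub>R y) \<in> convex hull F \<longleftrightarrow> (\<forall>y\<in>T - F. u y = 0)"
proof
  assume "(\<Sum>y\<in>T. u y *\<^sub>R y) \<in> convex hull F"
  then show "\<forall>y\<in>T - F. u y = 0" using coordinates_vanish[OF assms(1-3) _ assms(5)] by blast
next
  assume 0: "\<forall>y\<in>T - F. u y = 0"
  have F: "finite F" using assms finite_subset by blast
  have "sum u T = sum u F" using 0 assms by (intro sum.mono_neutral_right) auto
  moreover have "(\<Sum>y\<in>T. u y *\<^sub>R y) = (\<Sum>y\<in>F. u y *\<^sub>R y)"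
    using 0 assms by (intro sum.mono_neutral_right) auto
  ultimately show "(\<Sum>y\<in>T. u y *\<^sub>R y) \<in> convex hull F"
    unfolding convex_hull_finite[OF F] using assms by auto
qed

lemma convex_hull_Int_subsets:
  assumes "finite T" "\<not> affine_dependent T" "F \<subseteq> T" "G \<subseteq> T"
  shows "convex hull F \<inter> convex hull G = convex hull (F \<inter> G)"
proof
  show "convex hull F \<inter> convex hull G \<subseteq> convex hull (F \<inter> G)"
  proof
    fix x assume x: "x \<in> convex hull F \<inter> convex hull G"
    then have "x \<in> convex hull T" using assms hull_mono by blast
    then obtain u where u: "\<And>y. 0 \<le> u y" "sum u T = 1" "(\<Sum>y\<in>T. u y *\<^sub>R y) = x"
      using convex_hull_subset_coordinates[OF assms(1) subset_refl] by metis
    have "F \<inter> G \<subseteq> T" using assms by blast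
    then show "x \<in> convex hull (F \<inter> G)"
      using x in_convex_hull_subset_iff[OF assms(1,2) _ u(1,2), unfolded u(3)] assms(3,4) by blast
  qed
qed (simp add: hull_mono)

lemma vertex_in_convex_hull:
  assumes "finite T" "\<not> affine_dependent T" "F \<subseteq> T" "v \<in> T" "v \<in> convex hull F"
  shows "v \<in> F"
proof -
  have "v \<in> convex hull ({v} \<inter> F)"
    using convex_hull_Int_subsets[OF assms(1,2) _ assms(3), of "{v}"] assms by simp
  then show ?thesis by (cases "v \<in> F") auto
qed

lemma card_le_of_subset_convex_hull:
  assumes s: "finite s" "\<not> affine_dependent s" and t: "finite t" and sub: "s \<subseteq> convex hull t"
  shows "card s \<le> card t"
proof (cases "s = {}")
  case False
  then obtain a where a: "a \<in> s" by blast
  with sub have "t \<noteq> {}" by auto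
  then obtain b where b: "b \<in> t" by blast
  let ?S = "(\<lambda>x. - a + x) ` (s - {a})" and ?T = "(\<lambda>x. - b + x) ` (t - {b})"
  have hull: "affine hull t = (\<lambda>x. b + x) ` span ?T"
    using affine_hull_insert_span_gen[of b "t - {b}"] b by (simp add: insert_absorb)
  have "- a + x \<in> span ?T" if "x \<in> s" for x
  proof -
    have "x \<in> affine hull t" "a \<in> affine hull t"
      using that a sub convex_hull_subset_affine_hull by blast+
    then obtain p q where "x = b + p" "a = b + q" "p \<in> span ?T" "q \<in> span ?T"
      unfolding hull by blast
    then show ?thesis using span_diff[of p _ q] by simp
  qed
  then have "?S \<subseteq> span ?T" by auto
  moreover have "independent ?S"
    using s(2) affine_dependent_iff_dependent2[OF a] by simp
  moreover have "finite ?T" using t by simp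
  ultimately have "card ?S \<le> card ?T" using independent_span_bound by blast
  also have "\<dots> \<le> card (t - {b})" using t by (intro card_image_le) auto
  finally have "card (s - {a}) \<le> card (t - {b})" by (subst (asm) card_image) auto
  then have "card s - 1 \<le> card t - 1" using a b by simp
  moreover have "card t > 0" using b t card_gt_0_iff by blast
  ultimately show ?thesis by linarith
qed simp

lemma convex_hull_face_Int:
  assumes T: "finite T" "\<not> affine_dependent T" "F \<subseteq> T" and s: "finite s" "s \<subseteq> convex hull T"
  shows "convex hull s \<inter> convex hull F = convex hull (s \<inter> convex hull F)"
proof
  show "convex hull s \<inter> convex hull F \<subseteq> convex hull (s \<inter> convex hull F)"
  proof
    fix y assume y: "y \<in> convex hull s \<inter> convex hull F"
    then obtain u where u: "\<forall>x\<in>s. 0 \<le> u x" "sum u s = 1" "(\<Sum>x\<in>s. u x *\<^sub>R x) = y"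
      using convex_hull_finite[OF s(1)] by auto
    have "\<exists>c. (\<forall>t. 0 \<le> c t) \<and> sum c T = 1 \<and> (\<Sum>t\<in>T. c t *\<^sub>R t) = x" if "x \<in> s" for x
      using convex_hull_subset_coordinates[OF T(1) subset_refl, of x] s(2) that by (metis subsetD)
    then obtain c where c: "\<And>x t. x \<in> s \<Longrightarrow> 0 \<le> c x t" "\<And>x. x \<in> s \<Longrightarrow> sum (c x) T = 1"
      "\<And>x. x \<in> s \<Longrightarrow> (\<Sum>t\<in>T. c x t *\<^sub>R t) = x"
      by metis
    define w where "w t = (\<Sum>x\<in>s. u x * c x t)" for t
    have "(\<Sum>t\<in>T. w t *\<^sub>R t) = (\<Sum>t\<in>T. \<Sum>x\<in>s. u x *\<^sub>R c x t *\<^sub>R t)"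
      by (simp add: w_def scaleR_sum_left)
    also have "\<dots> = (\<Sum>x\<in>s. \<Sum>t\<in>T. u x *\<^sub>R c x t *\<^sub>R t)" by (rule sum.swap)
    also have "\<dots> = (\<Sum>x\<in>s. u x *\<^sub>R x)" by (simp only: scaleR_sum_right[symmetric] c(3) cong: sum.cong)
    finally have wy: "(\<Sum>t\<in>T. w t *\<^sub>R t) = y" using u(3) by simp
    have "sum w T = (\<Sum>x\<in>s. \<Sum>t\<in>T. u x * c x t)" unfolding w_def by (rule sum.swap)
    also have "\<dots> = 1" by (simp add: c(2) u(2) flip: sum_distrib_left)
    finally have w1: "sum w T = 1" .
    have w0: "w t = 0" if "t \<in> T - F" for t
      using coordinates_vanish[OF T, of w t] wy w1 y that by simp
    have "x \<in> convex hull F" if x: "x \<in> s" "u x \<noteq> 0" for x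
    proof -
      have "c x t = 0" if t: "t \<in> T - F" for t
      proof -
        have "\<forall>z\<in>s. u z * c z t = 0"
          using w0[OF t] u(1) c(1) s(1) unfolding w_def
          by (subst (asm) sum_nonneg_eq_0_iff) auto
        then show ?thesis using x by auto
      qed
      then show ?thesis
        using in_convex_hull_subset_iff[OF T, of "c x"] c x by simp
    qed
    then have zero: "\<forall>x\<in>s - s \<inter> convex hull F. u x = 0" by blast
    have "sum u (s \<inter> convex hull F) = 1"
      using u(2) zero s(1) by (subst sum.mono_neutral_left[of s]) auto
    moreover have "(\<Sum>x\<in>s \<inter> convex hull F. u x *\<^sub>R x) = y"
      using u(3) zero s(1) by (subst sum.mono_neutral_left[of s]) auto
    ultimately show "y \<in> convex hull (s \<inter> convex hull F)"
      using convex_hull_finite[of "s \<inter> convex hull F"] s(1) u(1) by auto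
  qed
  have "convex hull (s \<inter> convex hull F) \<subseteq> convex hull F"
    by (rule hull_minimal) auto
  then show "convex hull (s \<inter> convex hull F) \<subseteq> convex hull s \<inter> convex hull F"
    by (simp add: hull_mono)
qed

lemma simplex_touching_all_facets:
  fixes T s :: "point set"
  assumes T: "finite T" "\<not> affine_dependent T" and s: "finite s" "s \<subseteq> convex hull T" "card s = card T"
    and touch: "\<And>e. e \<in> T \<Longrightarrow> \<exists>r\<subseteq>s. card r + 1 = card T \<and> r \<subseteq> convex hull (T - {e})"
  shows "s = T"
proof -
  have "\<exists>v\<in>s. s - {v} \<subseteq> convex hull (T - {e})" if e: "e \<in> T" for e
  proof -
    obtain r where r: "r \<subseteq> s" "card r + 1 = card T" "r \<subseteq> convex hull (T - {e})" using touch[OF e] by blast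
    then have "card (s - r) = 1" using s finite_subset[OF r(1) s(1)] by (simp add: card_Diff_subset)
    then obtain v where "s - r = {v}" by (meson card_1_singletonE)
    then have "v \<in> s" "s - {v} \<subseteq> r" by blast+
    then show ?thesis using r(3) by blast
  qed
  then obtain g where g: "\<And>e. e \<in> T \<Longrightarrow> g e \<in> s" "\<And>e. e \<in> T \<Longrightarrow> s - {g e} \<subseteq> convex hull (T - {e})"
    by metis
  have coord: "\<exists>u. (\<forall>y. 0 \<le> u y) \<and> sum u T = 1 \<and> (\<Sum>y\<in>T. u y *\<^sub>R y) = v" if "v \<in> s" for v
    using convex_hull_subset_coordinates[OF T(1) subset_refl, of v] s(2) that by (metis subsetD)
  have "s \<subseteq> g ` T"
  proof
    fix v assume v: "v \<in> s"
    obtain u where u: "\<forall>y. 0 \<le> u y" "sum u T = 1" "(\<Sum>y\<in>T. u y *\<^sub>R y) = v" using coord[OF v] by blast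
    have "\<exists>e\<in>T. u e \<noteq> 0" using u(2) by (metis sum.neutral zero_neq_one)
    then obtain e where e: "e \<in> T" "u e \<noteq> 0" by blast
    have "v \<notin> convex hull (T - {e})"
      using coordinates_vanish[OF T, of "T - {e}" u e] u e by auto
    then have "v = g e" using g(2)[OF e(1)] v by blast
    then show "v \<in> g ` T" using e by blast
  qed
  moreover have "g ` T \<subseteq> s" using g(1) by blast
  ultimately have gT: "g ` T = s" by blast
  then have inj: "inj_on g T" using s(3) T(1) by (simp add: eq_card_imp_inj_on)
  have "g e = e" if e: "e \<in> T" for e
  proof -
    obtain u where u: "\<forall>y. 0 \<le> u y" "sum u T = 1" "(\<Sum>y\<in>T. u y *\<^sub>R y) = g e" using coord[OF g(1)[OF e]] by blast
    have "u y = 0" if y: "y \<in> T" "y \<noteq> e" for y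
    proof -
      have "g e \<in> s - {g y}" using g(1)[OF e] inj_onD[OF inj, of e y] e y by auto
      then have "g e \<in> convex hull (T - {y})" using g(2)[OF y(1)] by blast
      then show ?thesis using coordinates_vanish[OF T, of "T - {y}" u y] u y by auto
    qed
    then have 0: "\<forall>y\<in>T - {e}. u y = 0" by blast
    have "sum u T = u e" using 0 e T(1) by (subst sum.remove[of _ e]) auto
    moreover have "(\<Sum>y\<in>T. u y *\<^sub>R y) = u e *\<^sub>R e" using 0 e T(1) by (subst sum.remove[of _ e]) auto
    ultimately show ?thesis using u by simp
  qed
  then show ?thesis using gT by simp
qed

section \<open>Geometric complexes\<close>

lemma geometric_complexD:
  assumes "geometric_complex K"
  shows "finite K" "s \<in> K \<Longrightarrow> finite s" "s \<in> K \<Longrightarrow> s \<noteq> {}" "s \<in> K \<Longrightarrow> \<not> affine_dependent s"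
    "s \<in> K \<Longrightarrow> t \<subseteq> s \<Longrightarrow> t \<noteq> {} \<Longrightarrow> t \<in> K"
    "s \<in> K \<Longrightarrow> t \<in> K \<Longrightarrow> convex hull s \<inter> convex hull t = convex hull (s \<inter> t)"
  using assms unfolding geometric_complex_def by (blast, blast, blast, blast, metis, blast)

lemma convex_hull_subset_iff: "convex hull s \<subseteq> convex hull t \<longleftrightarrow> s \<subseteq> convex hull t"
proof
  show "s \<subseteq> convex hull t" if "convex hull s \<subseteq> convex hull t"
    using hull_subset[of s convex] that by (rule order_trans)
qed (simp add: hull_minimal)

lemma geometric_complex_subset:
  assumes K: "geometric_complex K" "s \<in> K" "t \<in> K" and sub: "s \<subseteq> convex hull t"
  shows "s \<subseteq> t"
proof
  fix v assume v: "v \<in> s"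
  then have "v \<in> convex hull (s \<inter> t)"
    using geometric_complexD(6)[OF K] sub hull_subset[of s convex] by blast
  from vertex_in_convex_hull[OF geometric_complexD(2,4)[OF K(1,2)] Int_lower1 v this]
  show "v \<in> t" by simp
qed

definition refines :: "complex_of_points \<Rightarrow> complex_of_points \<Rightarrow> bool" where
  "refines D K \<longleftrightarrow> (\<forall>s\<in>D. \<exists>t\<in>K. s \<subseteq> convex hull t)"

lemma part_in_iff: "s \<in> part_in D t \<longleftrightarrow> s \<in> D \<and> s \<subseteq> convex hull t"
  by (simp add: part_in_def convex_hull_subset_iff)

lemma part_in_mono: "t \<subseteq> t' \<Longrightarrow> part_in D t \<subseteq> part_in D t'"
  unfolding part_in_def using hull_mono[of t t' convex] by blast

lemma refines_trans: "refines E D \<Longrightarrow> refines D K \<Longrightarrow> refines E K"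
  unfolding refines_def by (meson convex_hull_subset_iff[THEN iffD2] subset_trans)

lemma refines_common_face:
  assumes K: "geometric_complex K" and D: "geometric_complex D" and DK: "refines D K"
    and s: "s \<in> D" and t: "t \<in> K" and u: "u \<noteq> {}" "u \<subseteq> convex hull s" "u \<subseteq> convex hull t"
  obtains r where "r \<in> part_in D t" "u \<subseteq> convex hull r"
proof -
  obtain t0 where t0: "t0 \<in> K" "s \<subseteq> convex hull t0" using DK s by (auto simp: refines_def)
  have "convex hull s \<subseteq> convex hull t0" using t0(2) by (simp add: convex_hull_subset_iff)
  then have uc: "u \<subseteq> convex hull (t0 \<inter> t)" using u geometric_complexD(6)[OF K t0(1) t] by blast
  define r where "r = s \<inter> convex hull (t0 \<inter> t)"
  have "convex hull s \<inter> convex hull (t0 \<inter> t) = convex hull r"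
    unfolding r_def using geometric_complexD(2,4)[OF K t0(1)] geometric_complexD(2)[OF D s] t0(2)
    by (intro convex_hull_face_Int[of t0]) auto
  then have ur: "u \<subseteq> convex hull r" using u uc by blast
  then have "r \<noteq> {}" using u by auto
  then have "r \<in> D" using geometric_complexD(5)[OF D s] by (auto simp: r_def)
  moreover have "r \<subseteq> convex hull t" using hull_mono[of "t0 \<inter> t" t convex] by (auto simp: r_def)
  ultimately show ?thesis using that ur by (auto simp: part_in_iff)
qed

lemma geometric_complex_card_le:
  assumes "geometric_complex D" "s \<in> D" "finite t" "s \<subseteq> convex hull t"
  shows "card s \<le> card t"
  using assms geometric_complexD(2,4)[OF assms(1,2)] card_le_of_subset_convex_hull by blast

section \<open>The standard simplex\<close>

lemma lookup_scaleR: "Poly_Mapping.lookup (r *\<^sub>R p) k = r *\<^sub>R Poly_Mapping.lookup p k"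
  by transfer simp

lemma unit_pt_inj: "inj unit_pt"
proof (rule injI)
  fix i j :: nat assume "unit_pt i = unit_pt j"
  then have "Poly_Mapping.lookup (unit_pt i) i = Poly_Mapping.lookup (unit_pt j) i" by simp
  then show "i = j" by (simp add: unit_pt_def lookup_single when_def split: if_splits)
qed

lemma affine_independent_unit_pts:
  assumes "finite I"
  shows "\<not> affine_dependent (unit_pt ` I)"
proof
  assume "affine_dependent (unit_pt ` I)"
  then obtain U where U: "\<exists>v\<in>unit_pt ` I. U v \<noteq> 0" "(\<Sum>v\<in>unit_pt ` I. U v *\<^sub>R v) = 0"
    unfolding affine_dependent_explicit_finite[OF finite_imageI[OF assms]] by blast
  then obtain k where k: "k \<in> I" "U (unit_pt k) \<noteq> 0" by blast
  have "(\<Sum>v\<in>unit_pt ` I. U v *\<^sub>R v) = (\<Sum>i\<in>I. U (unit_pt i) *\<^sub>R unit_pt i)"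
    by (rule sum.reindex_cong[of unit_pt]) (auto intro: inj_on_subset[OF unit_pt_inj])
  then have "0 = Poly_Mapping.lookup (\<Sum>i\<in>I. U (unit_pt i) *\<^sub>R unit_pt i) k" using U(2) by simp
  also have "\<dots> = (\<Sum>i\<in>I. if i = k then U (unit_pt k) else 0)"
    by (simp add: lookup_sum lookup_scaleR unit_pt_def lookup_single when_def if_distrib cong: if_cong)
  also have "\<dots> = U (unit_pt k)" using k assms by simp
  finally show False using k by simp
qed

lemma geometric_complex_simplex:
  fixes T :: "point set"
  assumes "finite T" "\<not> affine_dependent T"
  shows "geometric_complex {s. s \<subseteq> T \<and> s \<noteq> {}}"
  unfolding geometric_complex_def
proof (intro conjI ballI allI impI)
  show "finite {s. s \<subseteq> T \<and> s \<noteq> {}}"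
    by (rule finite_subset[of _ "Pow T"]) (use assms(1) in auto)
  fix s assume s: "s \<in> {s. s \<subseteq> T \<and> s \<noteq> {}}"
  have sT: "s \<subseteq> T" using s by simp
  show "finite s" using finite_subset[OF sT assms(1)] .
  show "\<not> affine_dependent s" using affine_independent_subset[OF assms(2) sT] .
  show "convex hull s \<inter> convex hull t = convex hull (s \<inter> t)" if "t \<in> {s. s \<subseteq> T \<and> s \<noteq> {}}" for t
    using that by (intro convex_hull_Int_subsets[OF assms sT]) simp
  show "s \<noteq> {}" using s by simp
  show "t \<in> {s. s \<subseteq> T \<and> s \<noteq> {}}" if "t \<subseteq> s \<and> t \<noteq> {}" for t
    using sT that by blast
qed

definition std_vertices :: "nat \<Rightarrow> point set" where
  "std_vertices i = unit_pt ` {1..i+1}"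

lemma std_simplex_eq: "std_simplex i = {s. s \<subseteq> std_vertices i \<and> s \<noteq> {}}"
  by (simp add: std_simplex_def std_vertices_def)

lemma card_std_vertices [simp]: "card (std_vertices i) = i + 1"
  unfolding std_vertices_def by (simp add: card_image inj_on_subset[OF unit_pt_inj])

lemma finite_std_vertices [simp]: "finite (std_vertices i)"
  by (simp add: std_vertices_def)

lemma std_vertices_in_std_simplex [simp]: "std_vertices i \<in> std_simplex i"
  by (simp add: std_simplex_eq std_vertices_def)

lemma geometric_complex_std_simplex: "geometric_complex (std_simplex i)"
  unfolding std_simplex_eq
  by (rule geometric_complex_simplex) (auto simp: std_vertices_def affine_independent_unit_pts)

lemma dim_at_most_std_simplex: "dim_at_most d (std_simplex d)"
  unfolding dim_at_most_def std_simplex_eq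
  using card_mono[OF finite_std_vertices, of _ d] by simp

lemma faces_std_simplex: "faces d (std_simplex d) = {std_vertices d}"
proof (intro equalityI subsetI)
  fix s assume "s \<in> faces d (std_simplex d)"
  then have "s \<subseteq> std_vertices d" "card s = card (std_vertices d)"
    by (simp_all add: faces_def std_simplex_eq)
  then show "s \<in> {std_vertices d}" using card_subset_eq[OF finite_std_vertices] by blast
qed (simp add: faces_def)

section \<open>Isomorphisms of subdivisions\<close>

definition restr :: "complex_of_points \<Rightarrow> complex_of_points \<Rightarrow> complex_of_points" where
  "restr D A = (\<Union>t\<in>A. part_in D t)"

definition face_closed :: "complex_of_points \<Rightarrow> bool" where
  "face_closed A \<longleftrightarrow> (\<forall>s\<in>A. \<forall>t. t \<subseteq> s \<and> t \<noteq> {} \<longrightarrow> t \<in> A)"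

lemma face_closedD: "face_closed A \<Longrightarrow> s \<in> A \<Longrightarrow> t \<subseteq> s \<Longrightarrow> t \<noteq> {} \<Longrightarrow> t \<in> A"
  unfolding face_closed_def by metis

lemma simplicial_iso_comp:
  assumes "simplicial_iso f A B" "simplicial_iso g B C"
  shows "simplicial_iso (g \<circ> f) A C"
  using assms unfolding simplicial_iso_def
  by (auto intro: bij_betw_trans simp: image_comp[symmetric] image_image)

lemma simplicial_iso_inv:
  assumes "simplicial_iso f A B"
  shows "simplicial_iso (inv_into (\<Union>A) f) B A"
proof -
  have f: "bij_betw f (\<Union>A) (\<Union>B)" "(`) f ` A = B" using assms by (auto simp: simplicial_iso_def)
  have "inv_into (\<Union>A) f ` f ` s = s" if "s \<in> A" for s
    using f(1) that by (intro inv_into_image_cancel) (auto simp: bij_betw_def)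
  then have "(`) (inv_into (\<Union>A) f) ` B = A"
    unfolding f(2)[symmetric] by (simp add: image_image)
  then show ?thesis using bij_betw_inv_into[OF f(1)] by (simp add: simplicial_iso_def)
qed

lemma simplicial_iso_cong:
  assumes "simplicial_iso f A B" "\<And>v. v \<in> \<Union>A \<Longrightarrow> f v = g v"
  shows "simplicial_iso g A B"
proof -
  have "f ` s = g ` s" if "s \<in> A" for s using that assms(2) by (intro image_cong) auto
  then have "(`) f ` A = (`) g ` A" by (rule image_cong[OF refl])
  then show ?thesis using assms bij_betw_cong[of "\<Union>A" f g] by (simp add: simplicial_iso_def)
qed

locale uniform_subdivision =
  fixes d :: nat and sd :: "complex_of_points \<Rightarrow> complex_of_points"
  assumes uniform: "inclusion_uniform d sd" and d_pos: "d \<ge> 1"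
begin

definition cx :: "complex_of_points \<Rightarrow> bool" where
  "cx K \<longleftrightarrow> geometric_complex K \<and> dim_at_most d K"

lemma cx_geometric: "cx K \<Longrightarrow> geometric_complex K"
  by (simp add: cx_def)

lemma cx_card: "cx K \<Longrightarrow> s \<in> K \<Longrightarrow> card s \<le> d + 1"
  by (simp add: cx_def dim_at_most_def)

lemma sd_is_subdivision:
  assumes "cx K" shows "is_subdivision_of (sd K) K"
  using uniform assms unfolding inclusion_uniform_def subdivision_procedure_def cx_def by blast

lemma sd_refines:
  assumes "cx K" shows "refines (sd K) K"
  using sd_is_subdivision[OF assms] unfolding is_subdivision_of_def refines_def convex_hull_subset_iff by blast

lemma cx_sd:
  assumes K: "cx K" shows "cx (sd K)"
proof -
  have g: "geometric_complex (sd K)" using sd_is_subdivision[OF K] by (simp add: is_subdivision_of_def)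
  moreover have "card s \<le> d + 1" if s: "s \<in> sd K" for s
  proof -
    obtain t where t: "t \<in> K" "s \<subseteq> convex hull t" using sd_refines[OF K] s by (auto simp: refines_def)
    then have "card s \<le> card t"
      using geometric_complex_card_le[OF g s] geometric_complexD(2)[OF cx_geometric[OF K]] by blast
    then show ?thesis using cx_card[OF K t(1)] by simp
  qed
  ultimately show ?thesis by (simp add: cx_def dim_at_most_def)
qed

lemma cx_std_simplex: "cx (std_simplex d)"
  by (simp add: cx_def geometric_complex_std_simplex dim_at_most_std_simplex)

lemma vertex_in_sd:
  assumes K: "cx K" and v: "{v} \<in> K"
  shows "{v} \<in> sd K"
proof -
  have "\<exists>S\<subseteq>sd K. finite S \<and> convex hull {v} = (\<Union>s\<in>S. convex hull s)"
    using sd_is_subdivision[OF K] v unfolding is_subdivision_of_def by blast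
  then obtain S where S: "S \<subseteq> sd K" "{v} = (\<Union>s\<in>S. convex hull s)" by auto
  then obtain s where s: "s \<in> S" "v \<in> convex hull s" by blast
  have "s \<subseteq> {v}" using S(2) s(1) hull_subset[of s convex] by blast
  moreover have "s \<noteq> {}" using s(2) by auto
  ultimately have "s = {v}" by blast
  then show ?thesis using s S by blast
qed

lemma vertices_in_part:
  assumes K: "cx K" and s: "s \<in> K"
  shows "s \<subseteq> \<Union>(part_in (sd K) s)"
proof
  fix v assume v: "v \<in> s"
  then have "{v} \<in> K" using geometric_complexD(5)[OF cx_geometric[OF K] s, of "{v}"] by blast
  then have "{v} \<in> part_in (sd K) s"
    using vertex_in_sd[OF K] v hull_subset[of s convex] by (auto simp: part_in_iff)
  then show "v \<in> \<Union>(part_in (sd K) s)" by blast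
qed

lemma vertex_in_part:
  assumes "cx K" "v \<in> \<Union>(part_in (sd K) s)"
  shows "{v} \<in> part_in (sd K) s"
  using assms geometric_complexD(5)[OF cx_geometric[OF cx_sd[OF assms(1)]], of _ "{v}"]
  by (auto simp: part_in_iff)

lemma part_in_face_closed:
  assumes "geometric_complex D" "s \<in> part_in D t" "r \<subseteq> s" "r \<noteq> {}"
  shows "r \<in> part_in D t"
  using assms geometric_complexD(5)[OF assms(1)] by (auto simp: part_in_iff)

lemma extending_iso_exists:
  assumes K: "cx K" and s: "s \<in> K" and f: "bij_betw f s (unit_pt ` {1..card s - 1 + 1})"
  shows "\<exists>\<phi>. extending_iso sd K (card s - 1) s f \<phi> \<and>
    (\<forall>\<psi>. extending_iso sd K (card s - 1) s f \<psi> \<longrightarrow> \<psi> = \<phi>) \<and>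
    (\<forall>\<rho>. \<rho> \<subseteq> s \<and> \<rho> \<noteq> {} \<longrightarrow>
      (`) \<phi> ` part_in (sd K) \<rho> = part_in (sd (std_simplex (card s - 1))) (f ` \<rho>))"
proof -
  have "card s > 0" using geometric_complexD(2,3)[OF cx_geometric[OF K] s] by (simp add: card_gt_0_iff)
  then have c: "card s = card s - 1 + 1" by simp
  then have "s \<in> faces (card s - 1) K" using s by (simp add: faces_def)
  moreover have "card s - 1 \<le> d" using cx_card[OF K s] by simp
  ultimately have 1: "(\<exists>!\<phi>. extending_iso sd K (card s - 1) s f \<phi>) \<and>
      (\<forall>\<phi>. extending_iso sd K (card s - 1) s f \<phi> \<longrightarrow>
         (\<forall>\<rho>. \<rho> \<subseteq> s \<and> \<rho> \<noteq> {} \<longrightarrow>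
            (`) \<phi> ` part_in (sd K) \<rho> = part_in (sd (std_simplex (card s - 1))) (f ` \<rho>)))"
    using uniform K f unfolding inclusion_uniform_def cx_def by blast
  then show ?thesis by (elim conjE ex1E) (intro exI conjI; assumption | blast)
qed

definition pairing :: "complex_of_points \<Rightarrow> complex_of_points \<Rightarrow> point set \<Rightarrow> (point \<Rightarrow> point) \<Rightarrow> (point \<Rightarrow> point) \<Rightarrow> bool" where
  "pairing K L s f \<theta> \<longleftrightarrow> simplicial_iso \<theta> (part_in (sd K) s) (part_in (sd L) (f ` s)) \<and> (\<forall>v\<in>s. \<theta> v = f v)"

lemma pairing_bij:
  "pairing K L s f \<theta> \<Longrightarrow> bij_betw \<theta> (\<Union>(part_in (sd K) s)) (\<Union>(part_in (sd L) (f ` s)))"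
  by (simp add: pairing_def simplicial_iso_def)

lemma extending_iso_of_pairing:
  assumes K: "cx K" and s: "s \<in> K" and L: "cx L" and t: "f ` s \<in> L" and f: "inj_on f s"
    and \<psi>: "extending_iso sd L (card s - 1) (f ` s) g \<psi>"
    and \<theta>: "pairing K L s f \<theta>"
  shows "extending_iso sd K (card s - 1) s (g \<circ> f) (restrict (\<psi> \<circ> \<theta>) (\<Union>(part_in (sd K) s)))"
  unfolding extending_iso_def
proof (intro conjI ballI)
  have "simplicial_iso (\<psi> \<circ> \<theta>) (part_in (sd K) s) (sd (std_simplex (card s - 1)))"
    using \<psi> \<theta> by (auto simp: extending_iso_def pairing_def intro: simplicial_iso_comp)
  then show "simplicial_iso (restrict (\<psi> \<circ> \<theta>) (\<Union>(part_in (sd K) s))) (part_in (sd K) s) (sd (std_simplex (card s - 1)))"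
    by (rule simplicial_iso_cong) simp
  show "restrict (\<psi> \<circ> \<theta>) (\<Union>(part_in (sd K) s)) v = (g \<circ> f) v" if "v \<in> s" for v
    using that vertices_in_part[OF K s] \<theta> \<psi> by (auto simp: extending_iso_def pairing_def)
qed simp

lemma pairing_unique:
  assumes K: "cx K" and s: "s \<in> K" and L: "cx L" and t: "f ` s \<in> L" and f: "inj_on f s"
    and \<theta>: "pairing K L s f \<theta>" and \<theta>': "pairing K L s f \<theta>'" and v: "v \<in> \<Union>(part_in (sd K) s)"
  shows "\<theta> v = \<theta>' v"
proof -
  have fin: "finite s" using geometric_complexD(2)[OF cx_geometric[OF K] s] .
  have "card s > 0" using fin geometric_complexD(3)[OF cx_geometric[OF K] s] by (simp add: card_gt_0_iff)
  then have ct: "card (f ` s) = card s" "card (unit_pt ` {1..card s - 1 + 1}) = card s"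
    using f by (auto simp: card_image inj_on_subset[OF unit_pt_inj])
  then obtain g where g: "bij_betw g (f ` s) (unit_pt ` {1..card s - 1 + 1})"
    using fin finite_same_card_bij[of "f ` s"] by (metis finite_imageI finite_atLeastAtMost)
  obtain \<psi> where \<psi>: "extending_iso sd L (card s - 1) (f ` s) g \<psi>"
    using extending_iso_exists[OF L t, of g] g ct by auto
  have gf: "bij_betw (g \<circ> f) s (unit_pt ` {1..card s - 1 + 1})"
    using f g by (auto intro: bij_betw_trans inj_on_imp_bij_betw)
  let ?V = "\<Union>(part_in (sd K) s)"
  obtain \<phi> where \<phi>: "\<And>\<zeta>. extending_iso sd K (card s - 1) s (g \<circ> f) \<zeta> \<Longrightarrow> \<zeta> = \<phi>"
    using extending_iso_exists[OF K s gf] by blast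
  have "restrict (\<psi> \<circ> \<theta>) ?V = restrict (\<psi> \<circ> \<theta>') ?V"
    using \<phi>[OF extending_iso_of_pairing[OF K s L t f \<psi> \<theta>]]
      \<phi>[OF extending_iso_of_pairing[OF K s L t f \<psi> \<theta>']] by simp
  then have "restrict (\<psi> \<circ> \<theta>) ?V v = restrict (\<psi> \<circ> \<theta>') ?V v" by (rule arg_cong)
  then have "\<psi> (\<theta> v) = \<psi> (\<theta>' v)" unfolding restrict_apply' [OF v] comp_apply .
  moreover have "\<theta> v \<in> \<Union>(part_in (sd L) (f ` s))" "\<theta>' v \<in> \<Union>(part_in (sd L) (f ` s))"
    using bij_betw_apply[OF pairing_bij[OF \<theta>] v] bij_betw_apply[OF pairing_bij[OF \<theta>'] v] .
  moreover have "inj_on \<psi> (\<Union>(part_in (sd L) (f ` s)))"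
    using \<psi> by (simp add: extending_iso_def simplicial_iso_def bij_betw_def)
  ultimately show ?thesis by (simp add: inj_on_eq_iff)
qed

lemma pairing_exists:
  assumes K: "cx K" and s: "s \<in> K" and L: "cx L" and t: "f ` s \<in> L" and f: "inj_on f s"
  shows "\<exists>\<theta>. pairing K L s f \<theta> \<and>
    (\<forall>\<rho>. \<rho> \<subseteq> s \<and> \<rho> \<noteq> {} \<longrightarrow> (`) \<theta> ` part_in (sd K) \<rho> = part_in (sd L) (f ` \<rho>))"
proof -
  have fin: "finite s" using geometric_complexD(2)[OF cx_geometric[OF K] s] .
  have "card s > 0" using fin geometric_complexD(3)[OF cx_geometric[OF K] s] by (simp add: card_gt_0_iff)
  then have ct: "card (f ` s) = card s" "card (unit_pt ` {1..card s - 1 + 1}) = card s"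
    using f by (auto simp: card_image inj_on_subset[OF unit_pt_inj])
  then obtain g where g: "bij_betw g (f ` s) (unit_pt ` {1..card s - 1 + 1})"
    using fin finite_same_card_bij[of "f ` s"] by (metis finite_imageI finite_atLeastAtMost)
  have gf: "bij_betw (g \<circ> f) s (unit_pt ` {1..card s - 1 + 1})"
    using f g by (auto intro: bij_betw_trans inj_on_imp_bij_betw)
  obtain \<psi> where \<psi>: "extending_iso sd L (card s - 1) (f ` s) g \<psi>"
    and \<psi>f: "\<forall>\<rho>. \<rho> \<subseteq> f ` s \<and> \<rho> \<noteq> {} \<longrightarrow>
      (`) \<psi> ` part_in (sd L) \<rho> = part_in (sd (std_simplex (card s - 1))) (g ` \<rho>)"
    using extending_iso_exists[OF L t, unfolded ct(1), OF g] by (elim exE conjE) (rule that)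
  obtain \<phi> where \<phi>: "extending_iso sd K (card s - 1) s (g \<circ> f) \<phi>"
    and \<phi>f: "\<forall>\<rho>. \<rho> \<subseteq> s \<and> \<rho> \<noteq> {} \<longrightarrow>
      (`) \<phi> ` part_in (sd K) \<rho> = part_in (sd (std_simplex (card s - 1))) ((g \<circ> f) ` \<rho>)"
    using extending_iso_exists[OF K s gf] by (elim exE conjE) (rule that)
  define W where "W = \<Union>(part_in (sd L) (f ` s))"
  define \<theta> where "\<theta> = inv_into W \<psi> \<circ> \<phi>"
  have inj: "inj_on \<psi> W"
    using \<psi> by (simp add: extending_iso_def simplicial_iso_def bij_betw_def W_def)
  have "simplicial_iso \<theta> (part_in (sd K) s) (part_in (sd L) (f ` s))"
    unfolding \<theta>_def W_def using \<phi> \<psi>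
    by (intro simplicial_iso_comp[OF _ simplicial_iso_inv]) (auto simp: extending_iso_def)
  moreover have "\<theta> v = f v" if "v \<in> s" for v
  proof -
    have "f v \<in> W" using vertices_in_part[OF L t] that by (auto simp: W_def)
    moreover have "\<phi> v = \<psi> (f v)" using \<phi> \<psi> that by (simp add: extending_iso_def)
    ultimately show ?thesis using inj by (simp add: \<theta>_def)
  qed
  moreover have "(`) \<theta> ` part_in (sd K) \<rho> = part_in (sd L) (f ` \<rho>)" if \<rho>: "\<rho> \<subseteq> s" "\<rho> \<noteq> {}" for \<rho>
  proof -
    have "(`) \<theta> ` part_in (sd K) \<rho> = (`) (inv_into W \<psi>) ` (`) \<phi> ` part_in (sd K) \<rho>"
      by (simp add: \<theta>_def image_comp image_image comp_def)
    also have "(`) \<phi> ` part_in (sd K) \<rho> = (`) \<psi> ` part_in (sd L) (f ` \<rho>)"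
    proof -
      have "(`) \<phi> ` part_in (sd K) \<rho> = part_in (sd (std_simplex (card s - 1))) (g ` f ` \<rho>)"
        using \<phi>f \<rho> by (simp add: image_comp)
      moreover have "f ` \<rho> \<subseteq> f ` s" "f ` \<rho> \<noteq> {}" using \<rho> by auto
      ultimately show ?thesis using \<psi>f by simp
    qed
    also have "(`) (inv_into W \<psi>) ` (`) \<psi> ` part_in (sd L) (f ` \<rho>) = part_in (sd L) (f ` \<rho>)"
    proof -
      have "inv_into W \<psi> ` \<psi> ` x = x" if "x \<in> part_in (sd L) (f ` \<rho>)" for x
        using that part_in_mono[OF image_mono[OF \<rho>(1)], of "sd L" f] inj
        by (intro inv_into_image_cancel) (auto simp: W_def)
      then show ?thesis by (simp add: image_image)
    qed
    finally show ?thesis .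
  qed
  ultimately show ?thesis unfolding pairing_def by blast
qed

lemma pairing_restrict:
  assumes K: "cx K" and s: "s \<in> K" and L: "cx L" and t: "f ` s \<in> L" and f: "inj_on f s"
    and \<theta>: "pairing K L s f \<theta>" and \<rho>: "\<rho> \<subseteq> s" "\<rho> \<noteq> {}"
  shows "pairing K L \<rho> f \<theta>"
proof -
  obtain \<theta>' where \<theta>': "pairing K L s f \<theta>'"
    and im: "(`) \<theta>' ` part_in (sd K) \<rho> = part_in (sd L) (f ` \<rho>)"
    using pairing_exists[OF K s L t f] \<rho> by metis
  have sub: "\<Union>(part_in (sd K) \<rho>) \<subseteq> \<Union>(part_in (sd K) s)" using part_in_mono[OF \<rho>(1)] by blast
  have eq: "\<theta> v = \<theta>' v" if "v \<in> \<Union>(part_in (sd K) \<rho>)" for v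
    using pairing_unique[OF K s L t f \<theta> \<theta>'] that sub by blast
  have "\<theta> ` x = \<theta>' ` x" if "x \<in> part_in (sd K) \<rho>" for x
    using that eq by (intro image_cong) auto
  then have im': "(`) \<theta> ` part_in (sd K) \<rho> = part_in (sd L) (f ` \<rho>)"
    using im by (simp cong: image_cong)
  have "inj_on \<theta> (\<Union>(part_in (sd K) s))"
    using \<theta> by (simp add: pairing_def simplicial_iso_def bij_betw_def)
  then have "inj_on \<theta> (\<Union>(part_in (sd K) \<rho>))" using sub by (rule inj_on_subset)
  moreover have "\<theta> ` \<Union>(part_in (sd K) \<rho>) = \<Union>(part_in (sd L) (f ` \<rho>))"
    unfolding im'[symmetric] by (rule image_Union)
  ultimately have "simplicial_iso \<theta> (part_in (sd K) \<rho>) (part_in (sd L) (f ` \<rho>))"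
    using im' by (simp add: simplicial_iso_def bij_betw_def)
  then show ?thesis using \<theta> \<rho> by (auto simp: pairing_def)
qed

text \<open>The isomorphisms attached to single simplices agree on common faces by uniqueness, hence glue.\<close>

lemma glue_isos:
  assumes K: "cx K" and L: "cx L" and AK: "A \<subseteq> K"
    and face_closed: "face_closed A"
    and inj: "inj_on \<phi> (\<Union>A)" and im: "\<And>t. t \<in> A \<Longrightarrow> \<phi> ` t \<in> L"
  shows "\<exists>\<Theta>. inj_on \<Theta> (\<Union>(restr (sd K) A)) \<and>
    (\<forall>t\<in>A. (`) \<Theta> ` part_in (sd K) t = part_in (sd L) (\<phi> ` t))"
proof -
  note closed = face_closedD[OF face_closed]
  have injs: "inj_on \<phi> s" if "s \<in> A" for s using inj_on_subset[OF inj] that by blast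
  have "\<exists>\<theta>. pairing K L s \<phi> \<theta>" if "s \<in> A" for s
    using pairing_exists[OF K _ L im injs] AK that by blast
  then obtain \<theta> where \<theta>: "\<And>s. s \<in> A \<Longrightarrow> pairing K L s \<phi> (\<theta> s)" by metis
  have face: "\<theta> s v = \<theta> r v" if "s \<in> A" "r \<subseteq> s" "r \<noteq> {}" "v \<in> \<Union>(part_in (sd K) r)" for s r v
  proof -
    have r: "r \<in> A" using closed that by blast
    have "pairing K L r \<phi> (\<theta> s)"
      using pairing_restrict[OF K _ L im injs \<theta>] that AK by blast
    then show ?thesis using pairing_unique[OF K _ L im injs _ \<theta>] r AK that(4) by blast
  qed
  have common: "s \<inter> t \<noteq> {} \<and> v \<in> \<Union>(part_in (sd K) (s \<inter> t))"
    if "s \<in> K" "t \<in> K" "v \<in> \<Union>(part_in (sd K) s)" "v \<in> \<Union>(part_in (sd K) t)" "cx K" for s t v K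
  proof -
    have "{v} \<in> part_in (sd K) s" "{v} \<in> part_in (sd K) t" using vertex_in_part that by blast+
    then have v: "{v} \<in> sd K" "v \<in> convex hull s" "v \<in> convex hull t" by (auto simp: part_in_iff)
    then have "v \<in> convex hull (s \<inter> t)"
      using geometric_complexD(6)[OF cx_geometric[OF that(5)] that(1,2)] by blast
    moreover from this have "s \<inter> t \<noteq> {}" by auto
    ultimately show ?thesis using v(1) by (auto simp: part_in_iff)
  qed
  have agree: "\<theta> s v = \<theta> t v"
    if "s \<in> A" "t \<in> A" "v \<in> \<Union>(part_in (sd K) s)" "v \<in> \<Union>(part_in (sd K) t)" for s t v
  proof -
    have "s \<inter> t \<noteq> {}" "v \<in> \<Union>(part_in (sd K) (s \<inter> t))" using common[of s K t v] that AK K by blast+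
    then show ?thesis using face[of s "s \<inter> t" v] face[of t "s \<inter> t" v] that by simp
  qed
  define \<Theta> where "\<Theta> v = \<theta> (SOME s. s \<in> A \<and> v \<in> \<Union>(part_in (sd K) s)) v" for v
  have \<Theta>: "\<Theta> v = \<theta> s v" if "s \<in> A" "v \<in> \<Union>(part_in (sd K) s)" for s v
  proof -
    have "(SOME s. s \<in> A \<and> v \<in> \<Union>(part_in (sd K) s)) \<in> A \<and>
        v \<in> \<Union>(part_in (sd K) (SOME s. s \<in> A \<and> v \<in> \<Union>(part_in (sd K) s)))"
      using that by (intro someI[of "\<lambda>s. s \<in> A \<and> v \<in> \<Union>(part_in (sd K) s)"]) simp
    then show ?thesis unfolding \<Theta>_def using agree that by blast
  qed
  note bij = pairing_bij[OF \<theta>]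
  have "inj_on \<Theta> (\<Union>(restr (sd K) A))"
  proof (rule inj_onI)
    fix v w assume "v \<in> \<Union>(restr (sd K) A)" "w \<in> \<Union>(restr (sd K) A)" and eq: "\<Theta> v = \<Theta> w"
    then obtain s t where s: "s \<in> A" "v \<in> \<Union>(part_in (sd K) s)" and t: "t \<in> A" "w \<in> \<Union>(part_in (sd K) t)"
      by (auto simp: restr_def)
    have "\<theta> s v \<in> \<Union>(part_in (sd L) (\<phi> ` s))" using bij_betw_apply[OF bij[OF s(1)] s(2)] .
    moreover have "\<theta> t w \<in> \<Union>(part_in (sd L) (\<phi> ` t))" using bij_betw_apply[OF bij[OF t(1)] t(2)] .
    moreover have e: "\<theta> s v = \<theta> t w" using eq \<Theta> s t by simp
    ultimately have "\<phi> ` s \<inter> \<phi> ` t \<noteq> {} \<and> \<theta> s v \<in> \<Union>(part_in (sd L) (\<phi> ` s \<inter> \<phi> ` t))"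
      using common[OF im[OF s(1)] im[OF t(1)] _ _ L] by simp
    moreover have "\<phi> ` s \<inter> \<phi> ` t = \<phi> ` (s \<inter> t)"
      using s(1) t(1) by (intro inj_on_image_Int[OF inj, symmetric]) auto
    ultimately have st: "s \<inter> t \<noteq> {}" "\<theta> s v \<in> \<Union>(part_in (sd L) (\<phi> ` (s \<inter> t)))" by auto
    define r where "r = s \<inter> t"
    have r: "r \<in> A" "r \<noteq> {}" "r \<subseteq> s" "r \<subseteq> t" using closed[OF s(1), of r] st by (auto simp: r_def)
    obtain x where x: "x \<in> \<Union>(part_in (sd K) r)" "\<theta> r x = \<theta> s v"
      using st(2) bij_betw_imp_surj_on[OF bij[OF r(1)]] unfolding r_def[symmetric] by (metis imageE)
    have xs: "x \<in> \<Union>(part_in (sd K) s)" "x \<in> \<Union>(part_in (sd K) t)"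
      using x(1) part_in_mono[OF r(3)] part_in_mono[OF r(4)] by blast+
    have "\<theta> s x = \<theta> s v" using face[OF s(1) r(3,2) x(1)] x(2) by simp
    then have "x = v" using bij_betw_imp_inj_on[OF bij[OF s(1)]] xs s(2) by (meson inj_onD)
    moreover have "\<theta> t x = \<theta> t w" using face[OF t(1) r(4,2) x(1)] x(2) e by simp
    then have "x = w" using bij_betw_imp_inj_on[OF bij[OF t(1)]] xs t(2) by (meson inj_onD)
    ultimately show "v = w" by simp
  qed
  moreover have "(`) \<Theta> ` part_in (sd K) t = part_in (sd L) (\<phi> ` t)" if t: "t \<in> A" for t
  proof -
    have "\<Theta> ` x = \<theta> t ` x" if "x \<in> part_in (sd K) t" for x
      using \<Theta>[OF t] that by (intro image_cong) auto
    then have "(`) \<Theta> ` part_in (sd K) t = (`) (\<theta> t) ` part_in (sd K) t"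
      by (rule image_cong[OF refl])
    also have "\<dots> = part_in (sd L) (\<phi> ` t)" using \<theta>[OF t] by (simp add: pairing_def simplicial_iso_def)
    finally show ?thesis .
  qed
  ultimately show ?thesis by blast
qed

lemma cx_funpow: "cx K \<Longrightarrow> cx ((sd ^^ n) K)"
  by (induction n) (auto intro: cx_sd)

lemma refines_funpow: "cx K \<Longrightarrow> refines ((sd ^^ n) K) K"
proof (induction n)
  case 0
  then show ?case using hull_subset[of _ convex] by (auto simp: refines_def)
next
  case (Suc n)
  then show ?case using refines_trans[OF sd_refines[OF cx_funpow]] by auto
qed

lemma part_in_sd:
  assumes "cx K" "cx D" "refines D K" "t \<in> K"
  shows "part_in (sd D) t = restr (sd D) (part_in D t)"
proof
  show "part_in (sd D) t \<subseteq> restr (sd D) (part_in D t)"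
  proof
    fix u assume u: "u \<in> part_in (sd D) t"
    then obtain s where s: "s \<in> D" "u \<subseteq> convex hull s"
      using sd_refines[OF assms(2)] by (auto simp: part_in_iff refines_def)
    have "u \<noteq> {}" "u \<subseteq> convex hull t"
      using u geometric_complexD(3)[OF cx_geometric[OF cx_sd[OF assms(2)]]] by (auto simp: part_in_iff)
    then obtain r where "r \<in> part_in D t" "u \<subseteq> convex hull r"
      using refines_common_face[OF cx_geometric[OF assms(1)] cx_geometric[OF assms(2)] assms(3) s(1) assms(4) _ s(2)]
      by metis
    then show "u \<in> restr (sd D) (part_in D t)" using u by (auto simp: restr_def part_in_iff)
  qed
  show "restr (sd D) (part_in D t) \<subseteq> part_in (sd D) t"
  proof
    fix u assume "u \<in> restr (sd D) (part_in D t)"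
    then obtain s where s: "u \<in> sd D" "u \<subseteq> convex hull s" "s \<subseteq> convex hull t"
      by (auto simp: restr_def part_in_iff)
    then have "convex hull s \<subseteq> convex hull t" by (simp add: convex_hull_subset_iff)
    then show "u \<in> part_in (sd D) t" using s by (auto simp: part_in_iff)
  qed
qed

lemma iterated_iso:
  assumes K: "cx K" and L: "cx L" and AK: "A \<subseteq> K"
    and face_closed: "face_closed A"
    and inj: "inj_on \<phi> (\<Union>A)" and im: "\<And>t. t \<in> A \<Longrightarrow> \<phi> ` t \<in> L"
  shows "\<exists>\<Theta>. inj_on \<Theta> (\<Union>(restr ((sd ^^ n) K) A)) \<and>
    (\<forall>t\<in>A. (`) \<Theta> ` part_in ((sd ^^ n) K) t = part_in ((sd ^^ n) L) (\<phi> ` t))"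
proof (induction n)
  case 0
  note closed = face_closedD[OF face_closed]
  have part: "part_in M t = {s. s \<subseteq> t \<and> s \<noteq> {}}" if "cx M" "t \<in> M" for M t
  proof (intro equalityI subsetI)
    fix s assume "s \<in> part_in M t"
    then have s: "s \<in> M" "s \<subseteq> convex hull t" by (auto simp: part_in_iff)
    then show "s \<in> {s. s \<subseteq> t \<and> s \<noteq> {}}"
      using geometric_complex_subset[OF cx_geometric[OF that(1)] s(1) that(2) s(2)]
        geometric_complexD(3)[OF cx_geometric[OF that(1)] s(1)] by simp
  next
    fix s assume "s \<in> {s. s \<subseteq> t \<and> s \<noteq> {}}"
    then have s: "s \<subseteq> t" "s \<noteq> {}" by auto
    then show "s \<in> part_in M t"
      using geometric_complexD(5)[OF cx_geometric[OF that(1)] that(2) s]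
        order_trans[OF s(1) hull_subset[of t convex]] by (simp add: part_in_iff)
  qed
  have "restr K A = A"
  proof
    show "restr K A \<subseteq> A"
    proof
      fix s assume "s \<in> restr K A"
      then obtain t where t: "t \<in> A" "s \<in> part_in K t" by (auto simp: restr_def)
      then have "s \<subseteq> t" "s \<noteq> {}" using part[OF K, of t] AK by auto
      then show "s \<in> A" using closed[OF t(1)] by simp
    qed
    show "A \<subseteq> restr K A"
    proof
      fix s assume s: "s \<in> A"
      then have "s \<in> part_in K s" using AK hull_subset[of s convex] by (auto simp: part_in_iff)
      then show "s \<in> restr K A" using s by (auto simp: restr_def)
    qed
  qed
  moreover have "(`) \<phi> ` part_in K t = part_in L (\<phi> ` t)" if "t \<in> A" for t
  proof -
    have "part_in K t = {s. s \<subseteq> t \<and> s \<noteq> {}}" "part_in L (\<phi> ` t) = {s. s \<subseteq> \<phi> ` t \<and> s \<noteq> {}}"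
      using part[OF K] part[OF L im[OF that]] that AK by auto
    then show ?thesis by (auto simp: subset_image_iff)
  qed
  ultimately show ?case using inj by (intro exI[of _ \<phi>]) simp
next
  case (Suc n)
  define D where "D = (sd ^^ n) K"
  define E where "E = (sd ^^ n) L"
  have D: "cx D" "refines D K" and E: "cx E" "refines E L"
    using cx_funpow refines_funpow K L by (auto simp: D_def E_def)
  obtain \<Theta> where \<Theta>: "inj_on \<Theta> (\<Union>(restr D A))" "\<And>t. t \<in> A \<Longrightarrow> (`) \<Theta> ` part_in D t = part_in E (\<phi> ` t)"
    using Suc.IH D_def E_def by auto
  define A' where "A' = restr D A"
  have A': "A' \<subseteq> D" by (auto simp: A'_def restr_def part_in_iff)
  have closed': "face_closed A'"
    unfolding face_closed_def A'_def restr_def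
    using part_in_face_closed[OF cx_geometric[OF D(1)]] by blast
  have im': "\<Theta> ` t \<in> E" if t: "t \<in> A'" for t
  proof -
    obtain s where "s \<in> A" "t \<in> part_in D s" using t by (auto simp: A'_def restr_def)
    then have "\<Theta> ` t \<in> part_in E (\<phi> ` s)" using \<Theta>(2) by blast
    then show ?thesis by (simp add: part_in_iff)
  qed
  have "\<exists>\<Theta>'. inj_on \<Theta>' (\<Union>(restr (sd D) A')) \<and>
      (\<forall>t\<in>A'. (`) \<Theta>' ` part_in (sd D) t = part_in (sd E) (\<Theta> ` t))"
    by (rule glue_isos[OF D(1) E(1) A' closed' \<Theta>(1)[folded A'_def]]) (rule im')
  then obtain \<Theta>' where \<Theta>': "inj_on \<Theta>' (\<Union>(restr (sd D) A'))"
    "\<forall>t\<in>A'. (`) \<Theta>' ` part_in (sd D) t = part_in (sd E) (\<Theta> ` t)"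
    by (elim exE conjE) (rule that)
  have part: "part_in (sd D) t = restr (sd D) (part_in D t)" if "t \<in> A" for t
    using part_in_sd[OF K D] that AK by blast
  have "restr (sd D) A = restr (sd D) A'"
    unfolding A'_def using part by (auto simp: restr_def)
  moreover have "(`) \<Theta>' ` part_in (sd D) t = part_in (sd E) (\<phi> ` t)" if t: "t \<in> A" for t
  proof -
    have "(`) \<Theta>' ` part_in (sd D) t = (\<Union>s\<in>part_in D t. (`) \<Theta>' ` part_in (sd D) s)"
      unfolding part[OF t] restr_def by (rule image_UN)
    also have "\<dots> = (\<Union>s\<in>part_in D t. part_in (sd E) (\<Theta> ` s))"
      using t by (intro SUP_cong refl bspec[OF \<Theta>'(2)]) (auto simp: A'_def restr_def)
    also have "\<dots> = (\<Union>s\<in>(`) \<Theta> ` part_in D t. part_in (sd E) s)" by simp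
    also have "\<dots> = restr (sd E) (part_in E (\<phi> ` t))" unfolding \<Theta>(2)[OF t] restr_def ..
    also have "\<dots> = part_in (sd E) (\<phi> ` t)" using part_in_sd[OF L E im[OF t]] by simp
    finally show ?thesis .
  qed
  ultimately show ?case using \<Theta>'(1) by (intro exI[of _ \<Theta>']) (simp add: D_def E_def)
qed

section \<open>Counting simplices\<close>

definition touching :: "complex_of_points \<Rightarrow> point set \<Rightarrow> point set \<Rightarrow> complex_of_points" where
  "touching D t F = {s \<in> faces d (part_in D t). \<exists>r\<subseteq>s. card r = d \<and> r \<subseteq> convex hull F}"

lemma finite_faces: "geometric_complex D \<Longrightarrow> finite (faces d (part_in D t))"
  using geometric_complexD(1)[of D] by (simp add: faces_def part_in_def)

lemma finite_touching: "geometric_complex D \<Longrightarrow> finite (touching D t F)"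
  using finite_faces[of D t] by (simp add: touching_def)

lemma faces_part_in_iff: "s \<in> faces d (part_in D t) \<longleftrightarrow> s \<in> D \<and> s \<subseteq> convex hull t \<and> card s = d + 1"
  by (auto simp: faces_def part_in_iff)

lemma face_iso:
  assumes K: "cx K" "t \<in> K" and L: "cx L" "t' \<in> L" and f: "bij_betw f t t'"
  obtains \<Theta> where "inj_on \<Theta> (\<Union>(part_in ((sd ^^ n) K) t))"
    "\<And>r. r \<subseteq> t \<Longrightarrow> r \<noteq> {} \<Longrightarrow> (`) \<Theta> ` part_in ((sd ^^ n) K) r = part_in ((sd ^^ n) L) (f ` r)"
proof -
  let ?A = "{r. r \<subseteq> t \<and> r \<noteq> {}}"
  have sub: "?A \<subseteq> K" using geometric_complexD(5)[OF cx_geometric[OF K(1)] K(2)] by blast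
  have inj: "inj_on f (\<Union>?A)" using f by (auto simp: bij_betw_def intro: inj_on_subset[of f t])
  have im: "f ` r \<in> L" if "r \<in> ?A" for r
  proof (rule geometric_complexD(5)[OF cx_geometric[OF L(1)] L(2)])
    show "f ` r \<subseteq> t'" using that f by (auto simp: bij_betw_def)
    show "f ` r \<noteq> {}" using that by simp
  qed
  have fc: "face_closed ?A" by (auto simp: face_closed_def)
  have "\<exists>\<Theta>. inj_on \<Theta> (\<Union>(restr ((sd ^^ n) K) ?A)) \<and>
      (\<forall>r\<in>?A. (`) \<Theta> ` part_in ((sd ^^ n) K) r = part_in ((sd ^^ n) L) (f ` r))"
    by (rule iterated_iso[OF K(1) L(1) sub fc inj]) (rule im)
  then obtain \<Theta> where \<Theta>: "inj_on \<Theta> (\<Union>(restr ((sd ^^ n) K) ?A))"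
    "\<forall>r\<in>?A. (`) \<Theta> ` part_in ((sd ^^ n) K) r = part_in ((sd ^^ n) L) (f ` r)"
    by (elim exE conjE) (rule that)
  have "t \<in> ?A" using geometric_complexD(3)[OF cx_geometric[OF K(1)] K(2)] by simp
  then have "\<Union>(part_in ((sd ^^ n) K) t) \<subseteq> \<Union>(restr ((sd ^^ n) K) ?A)" unfolding restr_def by blast
  then have "inj_on \<Theta> (\<Union>(part_in ((sd ^^ n) K) t))" by (rule inj_on_subset[OF \<Theta>(1)])
  then show ?thesis using that \<Theta>(2) by simp
qed

lemma part_in_std: "part_in ((sd ^^ n) (std_simplex d)) (std_vertices d) = (sd ^^ n) (std_simplex d)"
proof -
  have "s \<subseteq> convex hull (std_vertices d)" if s: "s \<in> (sd ^^ n) (std_simplex d)" for s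
  proof -
    obtain t where "t \<in> std_simplex d" "s \<subseteq> convex hull t"
      using refines_funpow[OF cx_std_simplex, of n] s by (auto simp: refines_def)
    then show ?thesis using hull_mono[of t "std_vertices d" convex] by (auto simp: std_simplex_eq)
  qed
  then show ?thesis by (auto simp: part_in_iff)
qed

lemma card_image_simplex:
  assumes "inj_on \<Theta> (\<Union>(part_in D t))" "s \<in> part_in D t" "r \<subseteq> s"
  shows "card (\<Theta> ` r) = card r"
proof (rule card_image, rule inj_on_subset[OF assms(1)])
  show "r \<subseteq> \<Union>(part_in D t)" using assms(2,3) by blast
qed

lemma card_faces_part_le:
  assumes K: "cx K" "t \<in> faces d K" and L: "cx L" "t' \<in> faces d L"
  shows "card (faces d (part_in ((sd ^^ n) K) t)) \<le> card (faces d (part_in ((sd ^^ n) L) t'))"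
proof -
  have t: "t \<in> K" "t' \<in> L" "card t = card t'" using K(2) L(2) by (auto simp: faces_def)
  have fin: "finite t" "finite t'"
    using geometric_complexD(2)[OF cx_geometric] K(1) L(1) t by blast+
  obtain f where f: "bij_betw f t t'" using finite_same_card_bij[OF fin t(3)] by blast
  obtain \<Theta> where \<Theta>: "inj_on \<Theta> (\<Union>(part_in ((sd ^^ n) K) t))"
    "\<And>r. r \<subseteq> t \<Longrightarrow> r \<noteq> {} \<Longrightarrow> (`) \<Theta> ` part_in ((sd ^^ n) K) r = part_in ((sd ^^ n) L) (f ` r)"
    using face_iso[OF K(1) t(1) L(1) t(2) f] by blast
  have "t \<noteq> {}" using geometric_complexD(3)[OF cx_geometric[OF K(1)] t(1)] .
  then have im: "(`) \<Theta> ` part_in ((sd ^^ n) K) t = part_in ((sd ^^ n) L) t'"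
    using \<Theta>(2)[of t] f by (simp add: bij_betw_def)
  show ?thesis
  proof (rule card_inj_on_le)
    show "inj_on ((`) \<Theta>) (faces d (part_in ((sd ^^ n) K) t))"
      using inj_on_image[OF \<Theta>(1)] by (rule inj_on_subset) (auto simp: faces_def)
    show "(`) \<Theta> ` faces d (part_in ((sd ^^ n) K) t) \<subseteq> faces d (part_in ((sd ^^ n) L) t')"
    proof
      fix x assume "x \<in> (`) \<Theta> ` faces d (part_in ((sd ^^ n) K) t)"
      then obtain s where s: "x = \<Theta> ` s" "s \<in> part_in ((sd ^^ n) K) t" "card s = d + 1"
        by (auto simp: faces_def)
      then show "x \<in> faces d (part_in ((sd ^^ n) L) t')"
        using card_image_simplex[OF \<Theta>(1) s(2) subset_refl] im by (auto simp: faces_def)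
    qed
    show "finite (faces d (part_in ((sd ^^ n) L) t'))"
      using finite_faces cx_geometric cx_funpow L(1) by blast
  qed
qed

lemma std_face: "std_vertices d \<in> faces d (std_simplex d)"
  by (simp add: faces_std_simplex)

lemma card_faces_part:
  assumes "cx K" "t \<in> faces d K"
  shows "card (faces d (part_in ((sd ^^ n) K) t)) = card (faces d ((sd ^^ n) (std_simplex d)))"
  using card_faces_part_le[OF assms cx_std_simplex std_face, of n]
    card_faces_part_le[OF cx_std_simplex std_face assms, of n] by (simp add: part_in_std)

lemma top_faces_partition:
  assumes K: "cx K" and D: "cx D" "refines D K"
  shows "faces d D = (\<Union>t\<in>faces d K. faces d (part_in D t))"
proof (intro equalityI subsetI)
  fix s assume "s \<in> faces d D"
  then have s: "s \<in> D" "card s = d + 1" by (auto simp: faces_def)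
  obtain t where t: "t \<in> K" "s \<subseteq> convex hull t" using D(2) s(1) by (auto simp: refines_def)
  have "card s \<le> card t"
    using geometric_complex_card_le[OF cx_geometric[OF D(1)] s(1) _ t(2)]
      geometric_complexD(2)[OF cx_geometric[OF K] t(1)] by simp
  then have "t \<in> faces d K" using cx_card[OF K t(1)] s(2) t(1) by (simp add: faces_def)
  then show "s \<in> (\<Union>t\<in>faces d K. faces d (part_in D t))" using s t by (auto simp: faces_part_in_iff)
next
  fix s assume "s \<in> (\<Union>t\<in>faces d K. faces d (part_in D t))"
  then show "s \<in> faces d D" by (auto simp: faces_def part_in_def)
qed

lemma card_le_Int:
  assumes K: "cx K" "t \<in> K" "t' \<in> K" and D: "cx D" "s \<in> D"
    and s: "s \<subseteq> convex hull t" "s \<subseteq> convex hull t'"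
  shows "card s \<le> card (t \<inter> t')"
proof -
  have "s \<subseteq> convex hull (t \<inter> t')"
    using s geometric_complexD(6)[OF cx_geometric[OF K(1)] K(2,3)] by blast
  moreover have "finite (t \<inter> t')" using geometric_complexD(2)[OF cx_geometric[OF K(1)] K(2)] by simp
  ultimately show ?thesis using geometric_complex_card_le[OF cx_geometric[OF D(1)] D(2)] by blast
qed

lemma top_faces_disjoint:
  assumes K: "cx K" and D: "cx D" and t: "t \<in> faces d K" "t' \<in> faces d K" "t \<noteq> t'"
  shows "faces d (part_in D t) \<inter> faces d (part_in D t') = {}"
proof (rule ccontr)
  assume "\<not> ?thesis"
  then obtain s where s: "s \<in> D" "s \<subseteq> convex hull t" "s \<subseteq> convex hull t'" "card s = d + 1"
    by (auto simp: faces_part_in_iff)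
  have t': "t \<in> K" "t' \<in> K" "card t = d + 1" "card t' = d + 1" using t by (auto simp: faces_def)
  then have "finite t" "finite t'" by (metis card.infinite Suc_eq_plus1 nat.distinct(1))+
  moreover have "d + 1 \<le> card (t \<inter> t')" using card_le_Int[OF K t'(1,2) D s(1-3)] s(4) by simp
  ultimately have "t \<inter> t' = t" "t \<inter> t' = t'" using t' by (metis card_seteq inf_le1 inf_le2)+
  then show False using t(3) by blast
qed

lemma card_faces_sd:
  assumes K: "cx K"
  shows "card (faces d (sd K)) = card (faces d K) * card (faces d (sd (std_simplex d)))"
proof -
  have "card (faces d (sd K)) = (\<Sum>t\<in>faces d K. card (faces d (part_in (sd K) t)))"
    unfolding top_faces_partition[OF K cx_sd[OF K] sd_refines[OF K]]
  proof (rule card_UN_disjoint)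
    show "finite (faces d K)" using geometric_complexD(1)[OF cx_geometric[OF K]] by (simp add: faces_def)
    show "\<forall>i\<in>faces d K. finite (faces d (part_in (sd K) i))"
      using finite_faces[OF cx_geometric[OF cx_sd[OF K]]] by blast
    show "\<forall>i\<in>faces d K. \<forall>j\<in>faces d K. i \<noteq> j \<longrightarrow> faces d (part_in (sd K) i) \<inter> faces d (part_in (sd K) j) = {}"
      using top_faces_disjoint[OF K cx_sd[OF K]] by blast
  qed
  also have "\<dots> = (\<Sum>t\<in>faces d K. card (faces d (sd (std_simplex d))))"
    using card_faces_part[OF K, of _ 1] by (intro sum.cong) auto
  finally show ?thesis by simp
qed

lemma card_faces_funpow:
  assumes K: "cx K"
  shows "card (faces d ((sd ^^ n) K)) = card (faces d K) * card (faces d (sd (std_simplex d))) ^ n"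
  by (induction n) (simp_all add: card_faces_sd[OF cx_funpow[OF K]])

definition std_facet :: "point set" where
  "std_facet = std_vertices d - {unit_pt 1}"

definition touch_number :: nat where
  "touch_number = card (touching (sd (std_simplex d)) (std_vertices d) std_facet)"

lemma card_std_facet: "card std_facet = d"
  by (simp add: std_facet_def std_vertices_def card_Diff_singleton card_image inj_on_subset[OF unit_pt_inj])

lemma facet_bij:
  assumes "finite t" "finite t'" "card t = Suc d" "card t' = Suc d" "F \<subseteq> t" "F' \<subseteq> t'" "card F = d" "card F' = d"
  obtains f where "bij_betw f t t'" "f ` F = F'"
proof -
  have fin: "finite F" "finite F'" using assms finite_subset by blast+
  obtain g where g: "bij_betw g F F'" using finite_same_card_bij[OF fin] assms by auto
  have "card (t - F) = 1" "card (t' - F') = 1" using assms fin by (simp_all add: card_Diff_subset)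
  then obtain v v' where v: "t - F = {v}" "t' - F' = {v'}" by (meson card_1_singletonE)
  then have t: "t = insert v F" "v \<notin> F" "t' = insert v' F'" "v' \<notin> F'" using assms by blast+
  define f where "f = g(v := v')"
  have "bij_betw f F F'" using g t(2) by (subst bij_betw_cong[of F f g]) (auto simp: f_def)
  moreover have "f v = v'" by (simp add: f_def)
  ultimately have "bij_betw f t t'" "f ` F = F'"
    using t by (auto simp: bij_betw_def)
  then show ?thesis using that by blast
qed

lemma card_touching_le:
  assumes K: "cx K" "t \<in> faces d K" "F \<subseteq> t" "card F = d"
    and L: "cx L" "t' \<in> faces d L" "F' \<subseteq> t'" "card F' = d"
  shows "card (touching (sd K) t F) \<le> card (touching (sd L) t' F')"
proof -
  have t: "t \<in> K" "t' \<in> L" "card t = Suc d" "card t' = Suc d" using K(2) L(2) by (auto simp: faces_def)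
  have fin: "finite t" "finite t'"
    using geometric_complexD(2)[OF cx_geometric] K(1) L(1) t by blast+
  obtain f where f: "bij_betw f t t'" "f ` F = F'"
    using facet_bij[OF fin t(3,4) K(3) L(3) K(4) L(4)] by blast
  obtain \<Theta> where \<Theta>': "inj_on \<Theta> (\<Union>(part_in ((sd ^^ 1) K) t))"
    "\<And>r. r \<subseteq> t \<Longrightarrow> r \<noteq> {} \<Longrightarrow> (`) \<Theta> ` part_in ((sd ^^ 1) K) r = part_in ((sd ^^ 1) L) (f ` r)"
    using face_iso[OF K(1) t(1) L(1) t(2) f(1)] by blast
  then have \<Theta>: "inj_on \<Theta> (\<Union>(part_in (sd K) t))"
    "\<And>r. r \<subseteq> t \<Longrightarrow> r \<noteq> {} \<Longrightarrow> (`) \<Theta> ` part_in (sd K) r = part_in (sd L) (f ` r)"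
    by simp_all
  have "t \<noteq> {}" "F \<noteq> {}" using t(3) K(4) d_pos by auto
  then have im: "(`) \<Theta> ` part_in (sd K) t = part_in (sd L) t'" "(`) \<Theta> ` part_in (sd K) F = part_in (sd L) F'"
    using \<Theta>(2)[of t] \<Theta>(2)[of F] f K(3) by (auto simp: bij_betw_def)
  show ?thesis
  proof (rule card_inj_on_le)
    show "inj_on ((`) \<Theta>) (touching (sd K) t F)"
      using inj_on_image[OF \<Theta>(1)] by (rule inj_on_subset) (auto simp: faces_def touching_def)
    show "(`) \<Theta> ` touching (sd K) t F \<subseteq> touching (sd L) t' F'"
    proof
      fix x assume "x \<in> (`) \<Theta> ` touching (sd K) t F"
      then obtain s r where s: "x = \<Theta> ` s" "s \<in> part_in (sd K) t" "card s = d + 1"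
        and r: "r \<subseteq> s" "card r = d" "r \<subseteq> convex hull F"
        by (auto simp: faces_def touching_def)
      have "r \<noteq> {}" using r(2) d_pos by auto
      then have "r \<in> sd K"
        using part_in_face_closed[OF cx_geometric[OF cx_sd[OF K(1)]] s(2) r(1)] by (simp add: part_in_iff)
      then have "r \<in> part_in (sd K) F" using r(3) by (simp add: part_in_iff)
      then have "\<Theta> ` r \<in> part_in (sd L) F'" using im(2) by blast
      then have "\<Theta> ` r \<subseteq> x" "card (\<Theta> ` r) = d" "\<Theta> ` r \<subseteq> convex hull F'"
        using card_image_simplex[OF \<Theta>(1) s(2) r(1)] r s(1) by (auto simp: part_in_iff)
      moreover have "x \<in> part_in (sd L) t'" using s(1,2) im(1) by blast
      moreover have "card x = d + 1" using card_image_simplex[OF \<Theta>(1) s(2) subset_refl] s by simp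
      ultimately show "x \<in> touching (sd L) t' F'" unfolding touching_def faces_def by blast
    qed
    show "finite (touching (sd L) t' F')"
      using finite_touching[OF cx_geometric[OF cx_sd[OF L(1)]]] .
  qed
qed

lemma card_touching:
  assumes "cx K" "t \<in> faces d K" "F \<subseteq> t" "card F = d"
  shows "card (touching (sd K) t F) = touch_number"
proof -
  have sub: "std_facet \<subseteq> std_vertices d" by (auto simp: std_facet_def)
  show ?thesis
    unfolding touch_number_def
    using card_touching_le[OF assms cx_std_simplex std_face sub card_std_facet]
      card_touching_le[OF cx_std_simplex std_face sub card_std_facet assms] by simp
qed

text \<open>If every top simplex touched one facet, then by symmetry every top simplex would touch all
  facets, so its vertices would be those of the standard simplex.\<close>

lemma touch_number_less:
  assumes "card (faces d (sd (std_simplex d))) > 1"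
  shows "touch_number < card (faces d (sd (std_simplex d)))"
proof -
  let ?D = "sd (std_simplex d)" and ?V = "std_vertices d"
  have part: "part_in ?D ?V = ?D" using part_in_std[of 1] by simp
  have D: "geometric_complex ?D" using cx_geometric[OF cx_sd[OF cx_std_simplex]] .
  have fin: "finite (faces d ?D)" using finite_faces[OF D, of ?V] part by simp
  have sub: "touching ?D ?V F \<subseteq> faces d ?D" for F using part by (auto simp: touching_def)
  have V: "\<not> affine_dependent ?V"
    using geometric_complexD(4)[OF geometric_complex_std_simplex std_vertices_in_std_simplex] .
  show ?thesis
  proof (rule ccontr)
    assume "\<not> ?thesis"
    then have ge: "card (faces d ?D) \<le> touch_number" by simp
    have all: "touching ?D ?V (?V - {e}) = faces d ?D" if "e \<in> ?V" for e
    proof (rule card_seteq[OF fin sub])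
      show "card (faces d ?D) \<le> card (touching ?D ?V (?V - {e}))"
        using card_touching[OF cx_std_simplex std_face, of "?V - {e}"] that ge
        by (simp add: card_Diff_singleton)
    qed
    have "s = ?V" if s: "s \<in> faces d ?D" for s
    proof (rule simplex_touching_all_facets[OF finite_std_vertices V])
      have s': "s \<in> ?D" "card s = d + 1" using s by (auto simp: faces_def)
      show "finite s" using geometric_complexD(2)[OF D s'(1)] .
      show "s \<subseteq> convex hull ?V" using s'(1) part by (metis part_in_iff)
      show "card s = card ?V" using s' by simp
      show "\<exists>r\<subseteq>s. card r + 1 = card ?V \<and> r \<subseteq> convex hull (?V - {e})" if "e \<in> ?V" for e
        using s all[OF that] by (auto simp: touching_def)
    qed
    then have "faces d ?D \<subseteq> {?V}" by blast
    then have "card (faces d ?D) \<le> card {?V}" by (intro card_mono) auto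
    then show False using assms by simp
  qed
qed

lemma facet_of_touching:
  assumes K: "cx K" "t \<in> K" "F \<subseteq> t" "card F = d" and D: "cx D" "s \<in> part_in D t"
    and r: "r \<in> E" "cx E" "r \<subseteq> convex hull s" "r \<subseteq> convex hull F" "card r = d"
  shows "card (s \<inter> convex hull F) = d" "s \<inter> convex hull F \<in> D" "r \<subseteq> convex hull (s \<inter> convex hull F)"
proof -
  have s: "s \<in> D" "s \<subseteq> convex hull t" using D(2) by (auto simp: part_in_iff)
  have fs: "finite s" using geometric_complexD(2)[OF cx_geometric[OF D(1)] s(1)] .
  have ft: "finite t" "\<not> affine_dependent t"
    using geometric_complexD(2,4)[OF cx_geometric[OF K(1)] K(2)] by auto
  let ?r = "s \<inter> convex hull F"
  show r1: "r \<subseteq> convex hull ?r"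
    using convex_hull_face_Int[OF ft K(3) fs s(2)] r(3,4) by blast
  have "r \<noteq> {}" using r(5) d_pos by auto
  then have "?r \<noteq> {}" using r1 by (auto simp del: Int_iff)
  then show rD: "?r \<in> D" using geometric_complexD(5)[OF cx_geometric[OF D(1)] s(1)] by blast
  have "card r \<le> card ?r"
    using geometric_complex_card_le[OF cx_geometric[OF r(2)] r(1) _ r1] fs by simp
  moreover have "card ?r \<le> card F"
    using geometric_complex_card_le[OF cx_geometric[OF D(1)] rD, of F] finite_subset[OF K(3) ft(1)] by blast
  ultimately show "card ?r = d" using r(5) K(4) by simp
qed

lemma card_touching_funpow:
  assumes K: "cx K" "t \<in> faces d K" "F \<subseteq> t" "card F = d"
  shows "card (touching ((sd ^^ n) K) t F) \<le> touch_number ^ n"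
proof (induction n)
  case 0
  have t: "t \<in> K" "card t = d + 1" using K(2) by (auto simp: faces_def)
  have ft: "finite t" using geometric_complexD(2)[OF cx_geometric[OF K(1)] t(1)] .
  have "touching K t F \<subseteq> {t}"
  proof
    fix s assume "s \<in> touching K t F"
    then have s: "s \<in> K" "s \<subseteq> convex hull t" "card s = d + 1" by (auto simp: touching_def faces_part_in_iff)
    have "s \<subseteq> t" using geometric_complex_subset[OF cx_geometric[OF K(1)] s(1) t(1) s(2)] .
    then show "s \<in> {t}" using card_subset_eq[OF ft] s(3) t(2) by simp
  qed
  then show ?case using card_mono[of "{t}"] by fastforce
next
  case (Suc n)
  define D where "D = (sd ^^ n) K"
  have D: "cx D" "refines D K" using cx_funpow refines_funpow K(1) by (auto simp: D_def)
  have t: "t \<in> K" "card t = d + 1" using K(2) by (auto simp: faces_def)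
  let ?f = "\<lambda>s. s \<inter> convex hull F"
  have key: "s \<in> faces d D" "?f s \<subseteq> s" "card (?f s) = d" if "s \<in> touching D t F" for s
  proof -
    obtain r where s: "s \<in> D" "s \<subseteq> convex hull t" "card s = d + 1" and r: "r \<subseteq> s" "card r = d" "r \<subseteq> convex hull F"
      using \<open>s \<in> touching D t F\<close> unfolding touching_def faces_part_in_iff mem_Collect_eq by blast
    have "r \<noteq> {}" using r(2) d_pos by auto
    then have rD: "r \<in> D" using geometric_complexD(5)[OF cx_geometric[OF D(1)] s(1) r(1)] by blast
    have rs: "r \<subseteq> convex hull s" using r(1) hull_subset[of s convex] by blast
    have sp: "s \<in> part_in D t" using s by (simp add: part_in_iff)
    show "card (?f s) = d" using facet_of_touching(1)[OF K(1) t(1) K(3,4) D(1) sp rD D(1) rs r(3,2)] .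
    show "s \<in> faces d D" using s by (simp add: faces_def)
  qed simp
  have "touching (sd D) t F \<subseteq> (\<Union>s\<in>touching D t F. touching (sd D) s (?f s))"
  proof
    fix x assume "x \<in> touching (sd D) t F"
    then obtain r where x: "x \<in> sd D" "x \<subseteq> convex hull t" "card x = d + 1"
      and r: "r \<subseteq> x" "card r = d" "r \<subseteq> convex hull F"
      unfolding touching_def faces_part_in_iff mem_Collect_eq by blast
    have "x \<in> part_in (sd D) t" using x by (simp add: part_in_iff)
    then have "x \<in> restr (sd D) (part_in D t)" using part_in_sd[OF K(1) D t(1)] by simp
    then obtain s where s: "s \<in> part_in D t" "x \<subseteq> convex hull s" by (auto simp: restr_def part_in_iff)
    have sD: "s \<in> D" "s \<subseteq> convex hull t" using s(1) by (auto simp: part_in_iff)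
    have "card x \<le> card s"
      using geometric_complex_card_le[OF cx_geometric[OF cx_sd[OF D(1)]] x(1) _ s(2)]
        geometric_complexD(2)[OF cx_geometric[OF D(1)] sD(1)] by simp
    then have cs: "card s = d + 1" using cx_card[OF D(1) sD(1)] x(3) by simp
    have "r \<noteq> {}" using r(2) d_pos by auto
    then have rE: "r \<in> sd D" using geometric_complexD(5)[OF cx_geometric[OF cx_sd[OF D(1)]] x(1) r(1)] by blast
    have rs: "r \<subseteq> convex hull s" using r(1) s(2) by blast
    note fot = facet_of_touching[OF K(1) t(1) K(3,4) D(1) s(1) rE cx_sd[OF D(1)] rs r(3,2)]
    have "s \<in> touching D t F"
      unfolding touching_def faces_part_in_iff mem_Collect_eq
      using sD cs fot(1) by (intro conjI exI[of _ "?f s"]) auto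
    moreover have "x \<in> touching (sd D) s (?f s)"
      unfolding touching_def faces_part_in_iff mem_Collect_eq
      using x(1,3) s(2) r(1,2) fot(3) by blast
    ultimately show "x \<in> (\<Union>s\<in>touching D t F. touching (sd D) s (?f s))" by blast
  qed
  moreover have fin: "finite (touching D t F)" using finite_touching[OF cx_geometric[OF D(1)]] .
  ultimately have "card (touching (sd D) t F) \<le> card (\<Union>s\<in>touching D t F. touching (sd D) s (?f s))"
    using finite_touching[OF cx_geometric[OF cx_sd[OF D(1)]]] by (intro card_mono) auto
  also have "\<dots> \<le> (\<Sum>s\<in>touching D t F. card (touching (sd D) s (?f s)))"
    by (rule card_UN_le[OF fin])
  also have "\<dots> = (\<Sum>s\<in>touching D t F. touch_number)"
    using key by (intro sum.cong refl card_touching[OF D(1)])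
  also have "\<dots> \<le> touch_number ^ Suc n"
    using Suc.IH by (simp add: D_def mult.commute)
  finally show ?case by (simp add: D_def)
qed

end

section \<open>Oriented bases\<close>

lemma oriented_basisD:
  assumes "oriented_basis i D B"
  shows "distinct B" "inj_on set (set B)" "set ` set B = faces i D"
    and "a \<in> set B \<Longrightarrow> distinct a" "a \<in> set B \<Longrightarrow> set a \<in> faces i D" "a \<in> set B \<Longrightarrow> length a = i + 1"
proof -
  have B: "\<forall>s\<in>set B. distinct s" "distinct (map set B)" "set ` set B = faces i D"
    using assms by (simp_all add: oriented_basis_def)
  then show "distinct B" "inj_on set (set B)" "set ` set B = faces i D" by (simp_all add: distinct_map)
  assume a: "a \<in> set B"
  then show d: "distinct a" and f: "set a \<in> faces i D" using B by blast+
  show "length a = i + 1" using distinct_card[OF d] f by (simp add: faces_def)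
qed

lemma length_oriented_basis: "oriented_basis i D B \<Longrightarrow> length B = card (faces i D)"
  using oriented_basisD(1-3)[of i D B] by (metis card_image distinct_card)

lemma oriented_basis_exists:
  assumes "geometric_complex D"
  shows "\<exists>B. oriented_basis i D B"
proof -
  have "finite (faces i D)" using geometric_complexD(1)[OF assms] by (simp add: faces_def)
  then obtain xs where xs: "distinct xs" "set xs = faces i D" using finite_distinct_list by metis
  have "\<exists>l. distinct l \<and> set l = s" if "s \<in> faces i D" for s
    using finite_distinct_list[of s] geometric_complexD(2)[OF assms, of s] that by (auto simp: faces_def)
  then obtain l where l: "\<And>s. s \<in> faces i D \<Longrightarrow> distinct (l s) \<and> set (l s) = s" by metis
  have "map set (map l xs) = xs" using l xs by (auto intro!: map_idI)
  then have "oriented_basis i D (map l xs)"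
    unfolding oriented_basis_def using l xs by (metis (no_types, lifting) imageE set_map)
  then show ?thesis ..
qed

lemma laplacian_eq_fmat:
  assumes "distinct B'"
  shows "laplacian B' B = fmat (gram (set B') incidence) B"
proof (intro eq_matI)
  fix i j assume "i < dim_row (fmat (gram (set B') incidence) B)" "j < dim_col (fmat (gram (set B') incidence) B)"
  then show "laplacian B' B $$ (i, j) = fmat (gram (set B') incidence) B $$ (i, j)"
    by (simp add: laplacian_def boundary_matrix_def fmat_def gram_def scalar_prod_def
        sum_list_index[OF assms, symmetric] lessThan_atLeast0)
qed (simp_all add: laplacian_def boundary_matrix_def)

lemma inv_into_basis:
  assumes "oriented_basis i D B"
  shows "bij_betw (inv_into (set B) set) (faces i D) (set B)"
    and "s \<in> faces i D \<Longrightarrow> set (inv_into (set B) set s) = s"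
proof -
  show "bij_betw (inv_into (set B) set) (faces i D) (set B)"
    using oriented_basisD(2,3)[OF assms] by (intro bij_betw_inv_into) (simp add: bij_betw_def)
  show "set (inv_into (set B) set s) = s" if "s \<in> faces i D"
    using that unfolding oriented_basisD(3)[OF assms, symmetric] by (rule f_inv_into_f)
qed

context uniform_subdivision
begin

definition free_facets :: "complex_of_points \<Rightarrow> point list list \<Rightarrow> point list set" where
  "free_facets K B' = {r \<in> set B'. \<not> (\<exists>F\<in>faces (d - 1) K. set r \<subseteq> convex hull F)}"

lemma facet_subset:
  assumes K: "cx K" "t \<in> K" and D: "cx D" "r \<in> D" "card r = d" and F: "F \<in> faces (d - 1) K"
    and r: "r \<subseteq> convex hull t" "r \<subseteq> convex hull F"
  shows "F \<subseteq> t"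
proof -
  have F': "F \<in> K" "card F = d" using F d_pos by (auto simp: faces_def)
  have "finite F" using geometric_complexD(2)[OF cx_geometric[OF K(1)] F'(1)] .
  moreover have "d \<le> card (t \<inter> F)" using card_le_Int[OF K F'(1) D(1,2) r] D(3) by simp
  ultimately have "t \<inter> F = F" using F'(2) by (metis card_seteq inf_le2)
  then show ?thesis by blast
qed

lemma blocks_equal_char_poly:
  assumes K: "cx K" "t \<in> faces d K"
    and B: "oriented_basis (d - 1) ((sd ^^ n) K) B'" "oriented_basis d ((sd ^^ n) K) B"
    and C: "oriented_basis (d - 1) ((sd ^^ n) (std_simplex d)) C'" "oriented_basis d ((sd ^^ n) (std_simplex d)) C"
    and ys: "distinct ys" "set ys = {a \<in> set B. set a \<subseteq> convex hull t}"
  shows "char_poly (fmat (gram (free_facets K B') incidence) ys) =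
    char_poly (fmat (gram (free_facets (std_simplex d) C') incidence) C)"
proof -
  define D where "D = (sd ^^ n) K"
  define S where "S = std_simplex d"
  define V where "V = std_vertices d"
  define E where "E = (sd ^^ n) S"
  have D: "cx D" and S: "cx S" "V \<in> S" and E: "cx E"
    using cx_funpow K(1) cx_std_simplex by (auto simp: D_def E_def S_def V_def)
  have t: "t \<in> K" "card t = d + 1" using K(2) by (auto simp: faces_def)
  note B = B[folded D_def] and C = C[folded S_def, folded E_def]
  have ft: "finite t" using geometric_complexD(2)[OF cx_geometric[OF K(1)] t(1)] .
  obtain f where f: "bij_betw f t V"
    using finite_same_card_bij[OF ft finite_std_vertices, of d] t(2) by (auto simp: V_def)
  obtain \<Theta> where \<Theta>: "inj_on \<Theta> (\<Union>(part_in D t))"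
    and \<Theta>r: "\<And>r. r \<subseteq> t \<Longrightarrow> r \<noteq> {} \<Longrightarrow> (`) \<Theta> ` part_in D r = part_in E (f ` r)"
    using face_iso[OF K(1) t(1) S f, of n] unfolding D_def E_def by blast
  have "t \<noteq> {}" using t(2) by auto
  then have im: "(`) \<Theta> ` part_in D t = E"
    using \<Theta>r[of t] f part_in_std[of n] by (simp add: bij_betw_def E_def S_def V_def)
  have inj\<Theta>: "inj_on ((`) \<Theta>) (part_in D t)" using inj_on_image[OF \<Theta>] .
  have cardim: "card (\<Theta> ` s) = card s" if "s \<in> part_in D t" for s
    using card_image_simplex[OF \<Theta> that subset_refl] .
  have bij_faces: "bij_betw ((`) \<Theta>) (faces i (part_in D t)) (faces i E)" for i
  proof (rule bij_betw_imageI)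
    show "inj_on ((`) \<Theta>) (faces i (part_in D t))"
      by (rule inj_on_subset[OF inj\<Theta>]) (auto simp: faces_def)
    show "(`) \<Theta> ` faces i (part_in D t) = faces i E"
    proof (intro equalityI subsetI)
      fix x assume "x \<in> (`) \<Theta> ` faces i (part_in D t)"
      then obtain s where s: "s \<in> part_in D t" "card s = i + 1" "x = \<Theta> ` s" by (auto simp: faces_def)
      then have "x \<in> E" using im by blast
      then show "x \<in> faces i E" using s cardim[OF s(1)] by (simp add: faces_def)
    next
      fix x assume "x \<in> faces i E"
      then have x: "x \<in> E" "card x = i + 1" by (auto simp: faces_def)
      then obtain s where s: "s \<in> part_in D t" "x = \<Theta> ` s" using im by blast
      then have "s \<in> faces i (part_in D t)" using x(2) cardim[OF s(1)] by (simp add: faces_def)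
      then show "x \<in> (`) \<Theta> ` faces i (part_in D t)" using s(2) by blast
    qed
  qed
  have free_iff: "(\<exists>F\<in>faces (d - 1) K. r \<subseteq> convex hull F) \<longleftrightarrow> (\<exists>F\<in>faces (d - 1) S. \<Theta> ` r \<subseteq> convex hull F)"
    if "r \<in> faces (d - 1) (part_in D t)" for r
  proof
    have r: "r \<in> part_in D t" "card r = d" using that d_pos by (auto simp: faces_def)
    then have r': "r \<in> D" "r \<subseteq> convex hull t" by (auto simp: part_in_iff)
    show "\<exists>F\<in>faces (d - 1) S. \<Theta> ` r \<subseteq> convex hull F" if ex: "\<exists>F\<in>faces (d - 1) K. r \<subseteq> convex hull F"
    proof -
      obtain F where F: "F \<in> faces (d - 1) K" "r \<subseteq> convex hull F" using ex by blast
      have Ft: "F \<subseteq> t" using facet_subset[OF K(1) t(1) D r'(1) r(2) F(1) r'(2) F(2)] .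
      have cF: "card F = d" using F(1) d_pos by (auto simp: faces_def)
      then have "F \<noteq> {}" using d_pos by auto
      moreover have "r \<in> part_in D F" using r'(1) F(2) by (simp add: part_in_iff)
      ultimately have "\<Theta> ` r \<in> part_in E (f ` F)" using \<Theta>r[OF Ft] by blast
      moreover have "card (f ` F) = d" using f Ft cF by (metis bij_betw_def card_image inj_on_subset)
      moreover have "f ` F \<subseteq> V" using f Ft by (auto simp: bij_betw_def)
      ultimately show ?thesis
        using \<open>F \<noteq> {}\<close> d_pos by (intro bexI[of _ "f ` F"]) (auto simp: part_in_iff faces_def S_def std_simplex_eq V_def)
    qed
    show "\<exists>F\<in>faces (d - 1) K. r \<subseteq> convex hull F" if ex: "\<exists>F\<in>faces (d - 1) S. \<Theta> ` r \<subseteq> convex hull F"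
    proof -
      obtain F' where F': "F' \<in> faces (d - 1) S" "\<Theta> ` r \<subseteq> convex hull F'" using ex by blast
      have cF': "card F' = d" "F' \<subseteq> V" using F'(1) d_pos by (auto simp: faces_def S_def std_simplex_eq V_def)
      define F where "F = {x \<in> t. f x \<in> F'}"
      have Ft: "F \<subseteq> t" by (auto simp: F_def)
      have fF: "f ` F = F'" using f cF'(2) by (auto simp: F_def bij_betw_def)
      have cF: "card F = d" using f Ft cF'(1) fF by (metis bij_betw_def card_image inj_on_subset)
      then have "F \<noteq> {}" using d_pos by auto
      have "\<Theta> ` r \<in> part_in E F'" using F'(2) r(1) im by (auto simp: part_in_iff)
      then have "\<Theta> ` r \<in> (`) \<Theta> ` part_in D F" unfolding \<Theta>r[OF Ft \<open>F \<noteq> {}\<close>] fF .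
      then obtain r0 where r0: "r0 \<in> part_in D F" "\<Theta> ` r = \<Theta> ` r0" by blast
      have "r0 \<in> part_in D t" using r0(1) part_in_mono[OF Ft] by blast
      then have "r = r0" using inj_onD[OF inj\<Theta> r0(2) r(1)] by simp
      then have "r \<subseteq> convex hull F" using r0(1) by (simp add: part_in_iff)
      moreover have "F \<in> faces (d - 1) K"
        using geometric_complexD(5)[OF cx_geometric[OF K(1)] t(1) Ft \<open>F \<noteq> {}\<close>] cF d_pos by (simp add: faces_def)
      ultimately show ?thesis by blast
    qed
  qed
  define h where "h = inv_into (set C) set \<circ> (`) \<Theta> \<circ> set"
  define k where "k = inv_into (set C') set \<circ> (`) \<Theta> \<circ> set"
  define R where "R = {r \<in> free_facets K B'. set r \<subseteq> convex hull t}"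
  define G where "G = {r \<in> faces (d - 1) (part_in D t). \<not> (\<exists>F\<in>faces (d - 1) K. r \<subseteq> convex hull F)}"
  define G' where "G' = {r \<in> faces (d - 1) E. \<not> (\<exists>F\<in>faces (d - 1) S. r \<subseteq> convex hull F)}"
  have sub_faces: "bij_betw set {a \<in> set X. set a \<subseteq> convex hull t} (faces i (part_in D t))"
    if "oriented_basis i D X" for i X
  proof (rule bij_betw_imageI)
    show "inj_on set {a \<in> set X. set a \<subseteq> convex hull t}"
      by (rule inj_on_subset[OF oriented_basisD(2)[OF that]]) auto
    have "faces i (part_in D t) = {s \<in> faces i D. s \<subseteq> convex hull t}"
      by (auto simp: faces_def part_in_iff)
    then show "set ` {a \<in> set X. set a \<subseteq> convex hull t} = faces i (part_in D t)"
      unfolding oriented_basisD(3)[OF that, symmetric] by auto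
  qed
  have ys_faces: "bij_betw set (set ys) (faces d (part_in D t))" unfolding ys(2) by (rule sub_faces[OF B(2)])
  have h: "bij_betw h (set ys) (set C)"
    unfolding h_def by (intro bij_betw_trans[OF ys_faces] bij_betw_trans[OF bij_faces] inv_into_basis(1)[OF C(2)])
  have h_set: "set (h a) = \<Theta> ` set a" if "a \<in> set ys" for a
    using inv_into_basis(2)[OF C(2)] bij_betw_apply[OF bij_faces bij_betw_apply[OF ys_faces that]]
    by (simp add: h_def)
  have RG: "bij_betw set R G"
  proof (rule bij_betw_imageI)
    have RB: "R = {r \<in> {a \<in> set B'. set a \<subseteq> convex hull t}. \<not> (\<exists>F\<in>faces (d - 1) K. set r \<subseteq> convex hull F)}"
      by (auto simp: R_def free_facets_def)
    show "inj_on set R"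
      by (rule inj_on_subset[OF oriented_basisD(2)[OF B(1)]]) (auto simp: RB)
    show "set ` R = G"
      unfolding RB G_def bij_betw_imp_surj_on[OF sub_faces[OF B(1)], symmetric] by blast
  qed
  have GG': "bij_betw ((`) \<Theta>) G G'"
  proof (rule bij_betw_imageI)
    show "inj_on ((`) \<Theta>) G" by (rule inj_on_subset[OF inj\<Theta>]) (auto simp: G_def faces_def)
    show "(`) \<Theta> ` G = G'"
      unfolding G_def G'_def bij_betw_imp_surj_on[OF bij_faces, symmetric] using free_iff by blast
  qed
  have G'C: "bij_betw (inv_into (set C') set) G' (free_facets S C')"
  proof (rule bij_betw_imageI)
    show "inj_on (inv_into (set C') set) G'"
      by (rule inj_on_subset[OF bij_betw_imp_inj_on[OF inv_into_basis(1)[OF C(1)]]]) (auto simp: G'_def)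
    show "inv_into (set C') set ` G' = free_facets S C'"
    proof (intro equalityI subsetI)
      fix c assume "c \<in> inv_into (set C') set ` G'"
      then obtain r where r: "r \<in> G'" "c = inv_into (set C') set r" by blast
      then have "r \<in> faces (d - 1) E" by (simp add: G'_def)
      then have "c \<in> set C'" "set c = r"
        using bij_betw_apply[OF inv_into_basis(1)[OF C(1)]] inv_into_basis(2)[OF C(1)] r(2) by auto
      then show "c \<in> free_facets S C'" using r(1) by (simp add: free_facets_def G'_def)
    next
      fix c assume c: "c \<in> free_facets S C'"
      then have "c \<in> set C'" by (simp add: free_facets_def)
      then have "set c \<in> faces (d - 1) E" "inv_into (set C') set (set c) = c"
        using oriented_basisD(5)[OF C(1)] inv_into_f_f[OF oriented_basisD(2)[OF C(1)]] by auto
      then show "c \<in> inv_into (set C') set ` G'"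
        using c by (intro image_eqI[of _ _ "set c"]) (simp_all add: free_facets_def G'_def)
    qed
  qed
  have k: "bij_betw k R (free_facets S C')"
    unfolding k_def by (intro bij_betw_trans[OF RG] bij_betw_trans[OF GG'] G'C)
  have k_set: "set (k r) = \<Theta> ` set r" if "r \<in> R" for r
  proof -
    have "\<Theta> ` set r \<in> G'" using bij_betw_apply[OF GG' bij_betw_apply[OF RG that]] .
    then show ?thesis using inv_into_basis(2)[OF C(1)] by (simp add: k_def G'_def)
  qed
  have part_ys: "set a \<in> part_in D t" if "a \<in> set ys" for a
    using bij_betw_apply[OF ys_faces that] by (simp add: faces_def)
  have part_R: "set r \<in> part_in D t" if "r \<in> R" for r
    using bij_betw_apply[OF RG that] by (simp add: faces_def G_def)
  have inj_a: "inj_on \<Theta> (set a)" if "set a \<in> part_in D t" for a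
    using inj_on_subset[OF \<Theta>] that by blast
  have ysB: "distinct a" "length a = Suc d" if "a \<in> set ys" for a
    using oriented_basisD(4,6)[OF B(2), of a] that ys(2) by auto
  have RB: "distinct r" "Suc (length r) = Suc d" if "r \<in> R" for r
    using oriented_basisD(4,6)[OF B(1), of r] that d_pos by (auto simp: R_def free_facets_def)
  have "\<exists>\<epsilon>. \<epsilon> * \<epsilon> = (1 :: real) \<and> (\<forall>r. distinct r \<and> Suc d = Suc (length r) \<longrightarrow>
      incidence r (h a) = \<epsilon> * incidence r (map \<Theta> a))" if a: "a \<in> set ys" for a
  proof -
    have "h a \<in> set C" using bij_betw_apply[OF h a] .
    then have "distinct (h a)" using oriented_basisD(4)[OF C(2)] by blast
    moreover have "distinct (map \<Theta> a)" using ysB[OF a] inj_a[OF part_ys[OF a]] by (simp add: distinct_map)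
    moreover have "set (map \<Theta> a) = set (h a)" using h_set[OF a] by simp
    ultimately show ?thesis using incidence_permute_simplex[of "map \<Theta> a" "h a"] ysB[OF a] by simp
  qed
  then obtain \<epsilon> :: "point list \<Rightarrow> real" where \<epsilon>: "\<And>a. a \<in> set ys \<Longrightarrow> \<epsilon> a * \<epsilon> a = 1"
    "\<And>a r. a \<in> set ys \<Longrightarrow> distinct r \<Longrightarrow> Suc d = Suc (length r) \<Longrightarrow>
      incidence r (h a) = \<epsilon> a * incidence r (map \<Theta> a)"
    by metis
  have "\<exists>\<delta>. \<delta> * \<delta> = (1 :: real) \<and> (\<forall>s. length s = Suc d \<longrightarrow>
      incidence (k r) s = \<delta> * incidence (map \<Theta> r) s)" if r: "r \<in> R" for r
  proof -
    have "k r \<in> set C'" using bij_betw_apply[OF k r] by (simp add: free_facets_def)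
    then have "distinct (k r)" using oriented_basisD(4)[OF C(1)] by blast
    moreover have "distinct (map \<Theta> r)" using RB[OF r] inj_a[OF part_R[OF r]] by (simp add: distinct_map)
    moreover have "set (map \<Theta> r) = set (k r)" using k_set[OF r] by simp
    ultimately show ?thesis using incidence_permute_facet[of "map \<Theta> r" "k r"] RB[OF r] by simp
  qed
  then obtain \<delta> :: "point list \<Rightarrow> real" where \<delta>: "\<And>r. r \<in> R \<Longrightarrow> \<delta> r * \<delta> r = 1"
    "\<And>r s. r \<in> R \<Longrightarrow> length s = Suc d \<Longrightarrow> incidence (k r) s = \<delta> r * incidence (map \<Theta> r) s"
    by metis
  have inc: "incidence (k r) (h a) = \<delta> r * \<epsilon> a * incidence r a" if r: "r \<in> R" and a: "a \<in> set ys" for r a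
  proof -
    have "h a \<in> set C" using bij_betw_apply[OF h a] .
    then have "length (h a) = Suc d" using oriented_basisD(6)[OF C(2)] by simp
    then have "incidence (k r) (h a) = \<delta> r * incidence (map \<Theta> r) (h a)" by (rule \<delta>(2)[OF r])
    also have "incidence (map \<Theta> r) (h a) = \<epsilon> a * incidence (map \<Theta> r) (map \<Theta> a)"
      using RB[OF r] inj_a[OF part_R[OF r]] by (intro \<epsilon>(2)[OF a]) (simp_all add: distinct_map)
    also have "incidence (map \<Theta> r) (map \<Theta> a) = incidence r a"
    proof (rule incidence_map)
      show "inj_on \<Theta> (set r \<union> set a)"
        by (rule inj_on_subset[OF \<Theta>]) (use part_R[OF r] part_ys[OF a] in blast)
    qed
    finally show ?thesis by simp
  qed
  have "char_poly (fmat (gram (free_facets K B') incidence) ys) =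
    char_poly (fmat (gram (free_facets S C') incidence) C)"
  proof (rule char_poly_fmat_signed_reindex[OF oriented_basisD(1)[OF C(2)] ys(1) h \<epsilon>(1)])
    fix a b assume a: "a \<in> set ys" and b: "b \<in> set ys"
    have "gram (free_facets K B') incidence a b = (\<Sum>r\<in>R. incidence r a * incidence r b)"
      unfolding gram_def
    proof (rule sum.mono_neutral_right)
      show "finite (free_facets K B')" by (simp add: free_facets_def)
      show "\<forall>r\<in>free_facets K B' - R. incidence r a * incidence r b = 0"
      proof
        fix r assume "r \<in> free_facets K B' - R"
        then have "\<not> set r \<subseteq> set a" using a ys(2) by (auto simp: R_def)
        then show "incidence r a * incidence r b = 0" by (simp add: incidence_eq_0)
      qed
    qed (auto simp: R_def)
    also have "\<dots> = (\<Sum>r\<in>R. \<epsilon> a * \<epsilon> b * (incidence (k r) (h a) * incidence (k r) (h b)))"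
    proof (rule sum.cong[OF refl])
      fix r assume r: "r \<in> R"
      have "\<epsilon> a * \<epsilon> b * (incidence (k r) (h a) * incidence (k r) (h b)) =
        (\<delta> r * \<delta> r) * (\<epsilon> a * \<epsilon> a) * (\<epsilon> b * \<epsilon> b) * (incidence r a * incidence r b)"
        unfolding inc[OF r a] inc[OF r b] by (simp only: ac_simps)
      then show "incidence r a * incidence r b = \<epsilon> a * \<epsilon> b * (incidence (k r) (h a) * incidence (k r) (h b))"
        by (simp add: \<delta>(1)[OF r] \<epsilon>(1)[OF a] \<epsilon>(1)[OF b])
    qed
    also have "\<dots> = \<epsilon> a * \<epsilon> b * (\<Sum>r\<in>R. incidence (k r) (h a) * incidence (k r) (h b))"
      by (simp add: sum_distrib_left)
    also have "(\<Sum>r\<in>R. incidence (k r) (h a) * incidence (k r) (h b)) = gram (free_facets S C') incidence (h a) (h b)"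
      unfolding gram_def by (rule sum.reindex_bij_betw[OF k])
    finally show "gram (free_facets K B') incidence a b = \<epsilon> a * \<epsilon> b * gram (free_facets S C') incidence (h a) (h b)" .
  qed
  then show ?thesis by (simp add: S_def)
qed

section \<open>Convergence\<close>

lemma free_spectral_function:
  assumes K: "cx K" "faces d K \<noteq> {}" and nontrivial: "acts_nontrivially d sd"
    and B: "oriented_basis (d - 1) ((sd ^^ n) K) B'" "oriented_basis d ((sd ^^ n) K) B"
    and C: "oriented_basis (d - 1) ((sd ^^ n) (std_simplex d)) C'" "oriented_basis d ((sd ^^ n) (std_simplex d)) C"
  shows "spectral_function (fmat (gram (free_facets K B') incidence) B) =
    spectral_function (fmat (gram (free_facets (std_simplex d) C') incidence) C)"
proof -
  define D where "D = (sd ^^ n) K"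
  have D: "cx D" "refines D K" using cx_funpow refines_funpow K(1) by (auto simp: D_def)
  define S where "S t = {a \<in> set B. set a \<subseteq> convex hull t}" for t
  let ?g = "gram (free_facets K B') incidence"
  have fin: "finite (faces d K)" using geometric_complexD(1)[OF cx_geometric[OF K(1)]] by (simp add: faces_def)
  have Sface: "set a \<in> faces d (part_in D t)" if "a \<in> S t" for a t
    using oriented_basisD(5)[OF B(2), of a] that by (auto simp: S_def faces_def part_in_iff D_def)
  have "char_poly (fmat ?g B) =
    char_poly (fmat (gram (free_facets (std_simplex d) C') incidence) C) ^ card (faces d K)"
  proof (rule char_poly_fmat_blocks[OF fin oriented_basisD(1)[OF B(2)]])
    show "set B = (\<Union>t\<in>faces d K. S t)"
    proof (intro equalityI subsetI)
      fix a assume a: "a \<in> set B"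
      then have "set a \<in> (\<Union>t\<in>faces d K. faces d (part_in D t))"
        using oriented_basisD(5)[OF B(2) a] top_faces_partition[OF K(1) D] by (simp add: D_def)
      then show "a \<in> (\<Union>t\<in>faces d K. S t)" using a by (auto simp: S_def faces_part_in_iff)
    qed (auto simp: S_def)
    show "S i \<inter> S j = {}" if "i \<in> faces d K" "j \<in> faces d K" "i \<noteq> j" for i j
      using top_faces_disjoint[OF K(1) D(1) that] Sface by blast
    show "?g a b = ?g b a" for a b by (rule gram_commute)
    show "?g a b = 0" if ij: "i \<in> faces d K" "j \<in> faces d K" "i \<noteq> j" and a: "a \<in> S i" and b: "b \<in> S j" for i j a b
      unfolding gram_def
    proof (rule sum.neutral, rule ballI, rule ccontr)
      fix r assume r: "r \<in> free_facets K B'" and "incidence r a * incidence r b \<noteq> 0"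
      then have "set r \<subseteq> set a" "set r \<subseteq> set b" using incidence_eq_0 by (metis mult_eq_0_iff)+
      then have rij: "set r \<subseteq> convex hull i" "set r \<subseteq> convex hull j" using a b by (auto simp: S_def)
      have i: "i \<in> K" "card i = d + 1" "j \<in> K" "card j = d + 1" using ij by (auto simp: faces_def)
      have fi: "finite i" "finite j" using geometric_complexD(2)[OF cx_geometric[OF K(1)]] i by blast+
      have rD: "set r \<in> D" "card (set r) = d"
        using oriented_basisD(5)[OF B(1), of r] r d_pos by (auto simp: free_facets_def faces_def D_def)
      then have ge: "d \<le> card (i \<inter> j)" using card_le_Int[OF K(1) i(1,3) D(1) rD(1) rij] by simp
      have "i \<inter> j \<noteq> i"
      proof
        assume "i \<inter> j = i"
        then have "i \<subseteq> j" by blast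
        then show False using card_subset_eq[OF fi(2)] i ij(3) by simp
      qed
      then have "i \<inter> j \<subset> i" by blast
      then have "card (i \<inter> j) < d + 1" using psubset_card_mono[OF fi(1)] i(2) by metis
      then have card: "card (i \<inter> j) = d" using ge by simp
      then have ne: "i \<inter> j \<noteq> {}" using d_pos by auto
      have "i \<inter> j \<in> faces (d - 1) K"
        using geometric_complexD(5)[OF cx_geometric[OF K(1)] i(1) Int_lower1 ne] card d_pos
        by (simp add: faces_def)
      moreover have "set r \<subseteq> convex hull (i \<inter> j)"
        using rij geometric_complexD(6)[OF cx_geometric[OF K(1)] i(1,3)] by blast
      ultimately show False using r by (auto simp: free_facets_def)
    qed
    show "char_poly (fmat ?g ys) = char_poly (fmat (gram (free_facets (std_simplex d) C') incidence) C)"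
      if "t \<in> faces d K" "distinct ys" "set ys = S t" for t ys
      using blocks_equal_char_poly[OF K(1) that(1) B C that(2)] that(3) by (simp add: S_def)
  qed
  moreover have "length B = card (faces d K) * length C"
    using length_oriented_basis[OF B(2)] length_oriented_basis[OF C(2)]
    by (simp add: card_faces_funpow[OF K(1)] card_faces_funpow[OF cx_std_simplex] faces_std_simplex)
  moreover have "length C > 0"
    using length_oriented_basis[OF C(2)] nontrivial
    by (simp add: card_faces_funpow[OF cx_std_simplex] faces_std_simplex acts_nontrivially_def)
  moreover have "card (faces d K) > 0" using fin K(2) by (simp add: card_gt_0_iff)
  ultimately show ?thesis
    using spectral_function_power[OF fmat_carrier fmat_gram_symmetric] fmat_carrier[of ?g B] by metis
qed

lemma sum_incidence_square_le:
  assumes a: "distinct a" and R: "\<And>r. r \<in> R \<Longrightarrow> distinct r" and fin: "finite R"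
  shows "(\<Sum>r\<in>R. (incidence r a)\<^sup>2) \<le> real (card {r \<in> R. set r \<subseteq> set a})"
proof -
  have "(\<Sum>r\<in>R. (incidence r a)\<^sup>2) \<le> (\<Sum>r\<in>R. if set r \<subseteq> set a then 1 else 0)"
  proof (rule sum_mono)
    fix r assume "r \<in> R"
    then have "\<bar>incidence r a\<bar> \<le> 1" using incidence_le_1 a R by blast
    then show "(incidence r a)\<^sup>2 \<le> (if set r \<subseteq> set a then 1 else 0)"
      using incidence_eq_0[of r a] by (auto simp: abs_square_le_1)
  qed
  also have "\<dots> = real (card {r \<in> R. set r \<subseteq> set a})"
    using sum.inter_filter[OF fin, of "\<lambda>_. 1 :: real" "\<lambda>r. set r \<subseteq> set a"] by simp
  finally show ?thesis .
qed

lemma trace_le: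
  assumes B: "oriented_basis (d - 1) D B'" "oriented_basis d D B" and R: "R \<subseteq> set B'"
  shows "(\<Sum>a\<in>set B. \<Sum>r\<in>R. (incidence r a)\<^sup>2) \<le> (real d + 1) * real (length B)"
proof -
  have "(\<Sum>r\<in>R. (incidence r a)\<^sup>2) \<le> real d + 1" if a: "a \<in> set B" for a
  proof -
    have "(\<Sum>r\<in>R. (incidence r a)\<^sup>2) \<le> real (card {r \<in> R. set r \<subseteq> set a})"
      using oriented_basisD(4)[OF B(2) a] oriented_basisD(4)[OF B(1)] R finite_subset[OF R]
      by (intro sum_incidence_square_le) auto
    also have "card {r \<in> R. set r \<subseteq> set a} \<le> card {F. F \<subseteq> set a \<and> card F = d}"
    proof (rule card_inj_on_le)
      show "inj_on set {r \<in> R. set r \<subseteq> set a}"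
        by (rule inj_on_subset[OF oriented_basisD(2)[OF B(1)]]) (use R in auto)
      show "set ` {r \<in> R. set r \<subseteq> set a} \<subseteq> {F. F \<subseteq> set a \<and> card F = d}"
        using oriented_basisD(5)[OF B(1)] R d_pos by (auto simp: faces_def)
      show "finite {F. F \<subseteq> set a \<and> card F = d}"
        by (rule finite_subset[of _ "Pow (set a)"]) auto
    qed
    also have "card {F. F \<subseteq> set a \<and> card F = d} = d + 1"
      using n_subsets[of "set a" d] oriented_basisD(5)[OF B(2) a] by (simp add: faces_def)
    finally show ?thesis by simp
  qed
  then have "(\<Sum>a\<in>set B. \<Sum>r\<in>R. (incidence r a)\<^sup>2) \<le> (\<Sum>a\<in>set B. real d + 1)"
    by (rule sum_mono)
  also have "\<dots> = (real d + 1) * real (length B)"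
    using distinct_card[OF oriented_basisD(1)[OF B(2)]] by simp
  finally show ?thesis .
qed

lemma boundary_trace_le:
  assumes K: "cx K"
    and B: "oriented_basis (d - 1) ((sd ^^ n) K) B'" "oriented_basis d ((sd ^^ n) K) B"
  shows "(\<Sum>a\<in>set B. \<Sum>r\<in>set B' - free_facets K B'. (incidence r a)\<^sup>2) \<le>
    real (card (faces d K)) * ((real d + 1) * real touch_number ^ n)"
proof -
  define D where "D = (sd ^^ n) K"
  have D: "cx D" "refines D K" using cx_funpow refines_funpow K by (auto simp: D_def)
  note B = B[folded D_def]
  define R where "R = set B' - free_facets K B'"
  define S where "S t = {a \<in> set B. set a \<subseteq> convex hull t}" for t
  define Fc where "Fc t = {F. F \<subseteq> t \<and> card F = d}" for t :: "point set"
  have fin: "finite (faces d K)" using geometric_complexD(1)[OF cx_geometric[OF K]] by (simp add: faces_def)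
  have cover: "set B \<subseteq> (\<Union>t\<in>faces d K. S t)"
  proof
    fix a assume a: "a \<in> set B"
    then have "set a \<in> (\<Union>t\<in>faces d K. faces d (part_in D t))"
      using oriented_basisD(5)[OF B(2) a] top_faces_partition[OF K D] by simp
    then show "a \<in> (\<Union>t\<in>faces d K. S t)" using a by (auto simp: S_def faces_part_in_iff)
  qed
  have t_bound: "(\<Sum>a\<in>S t. \<Sum>r\<in>R. (incidence r a)\<^sup>2) \<le> (real d + 1) * real touch_number ^ n"
    if t: "t \<in> faces d K" for t
  proof -
    have t': "t \<in> K" "card t = d + 1" using t by (auto simp: faces_def)
    have ft: "finite t" using geometric_complexD(2)[OF cx_geometric[OF K] t'(1)] .
    have finFc: "finite (Fc t)" unfolding Fc_def by (rule finite_subset[of _ "Pow t"]) (use ft in auto)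
    have cardFc: "card (Fc t) = d + 1" using n_subsets[OF ft, of d] t'(2) by (simp add: Fc_def)
    have a_bound: "(\<Sum>r\<in>R. (incidence r a)\<^sup>2) \<le> (\<Sum>F\<in>Fc t. if set a \<in> touching D t F then 1 else 0)"
      if a: "a \<in> S t" for a
    proof -
      have aB: "a \<in> set B" and at: "set a \<subseteq> convex hull t" using a by (auto simp: S_def)
      have aD: "set a \<in> D" "card (set a) = d + 1" using oriented_basisD(5)[OF B(2) aB] by (auto simp: faces_def)
      have ex: "\<exists>F. F \<in> Fc t \<and> set r \<subseteq> convex hull F" if r: "r \<in> R" "set r \<subseteq> set a" for r
      proof -
        have rB: "r \<in> set B'" using r(1) by (simp add: R_def)
        obtain F where F: "F \<in> faces (d - 1) K" "set r \<subseteq> convex hull F"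
          using r(1) by (auto simp: R_def free_facets_def)
        have rD: "set r \<in> D" "card (set r) = d"
          using oriented_basisD(5)[OF B(1) rB] d_pos by (auto simp: faces_def)
        have "set r \<subseteq> convex hull t" using r(2) at by blast
        then have "F \<subseteq> t" using facet_subset[OF K t'(1) D(1) rD F(1) _ F(2)] by blast
        moreover have "card F = d" using F(1) d_pos by (auto simp: faces_def)
        ultimately show ?thesis using F(2) by (auto simp: Fc_def)
      qed
      define \<phi> where "\<phi> r = (SOME F. F \<in> Fc t \<and> set r \<subseteq> convex hull F)" for r
      have \<phi>: "\<phi> r \<in> Fc t" "set r \<subseteq> convex hull (\<phi> r)" if "r \<in> R" "set r \<subseteq> set a" for r
        using someI_ex[OF ex[OF that]] by (auto simp: \<phi>_def)
      have eq: "set r = set a \<inter> convex hull (\<phi> r)" if r: "r \<in> R" "set r \<subseteq> set a" for r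
      proof (rule card_seteq)
        have rD: "set r \<in> D" "card (set r) = d"
          using oriented_basisD(5)[OF B(1), of r] r(1) d_pos by (auto simp: faces_def R_def)
        show sub: "set r \<subseteq> set a \<inter> convex hull (\<phi> r)" using r(2) \<phi>(2)[OF r] by blast
        have "card (set r) \<noteq> 0" using rD(2) d_pos by simp
        then have "set r \<noteq> {}" by (metis card.empty)
        with sub have ne: "set a \<inter> convex hull (\<phi> r) \<noteq> {}" by (metis subset_empty)
        have "set a \<inter> convex hull (\<phi> r) \<in> D"
          using geometric_complexD(5)[OF cx_geometric[OF D(1)] aD(1) Int_lower1 ne] .
        moreover have "finite (\<phi> r)" "card (\<phi> r) = d"
          using \<phi>(1)[OF r] finite_subset[OF _ ft] by (simp_all add: Fc_def)
        ultimately show "card (set a \<inter> convex hull (\<phi> r)) \<le> card (set r)"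
          using geometric_complex_card_le[OF cx_geometric[OF D(1)], of _ "\<phi> r"] rD(2) by simp
      qed simp
      have "(\<Sum>r\<in>R. (incidence r a)\<^sup>2) \<le> real (card {r \<in> R. set r \<subseteq> set a})"
        using oriented_basisD(4)[OF B(2) aB] oriented_basisD(4)[OF B(1)]
        by (intro sum_incidence_square_le) (auto simp: R_def)
      also have "card {r \<in> R. set r \<subseteq> set a} \<le> card {F \<in> Fc t. set a \<in> touching D t F}"
      proof (rule card_inj_on_le)
        show "inj_on \<phi> {r \<in> R. set r \<subseteq> set a}"
        proof (rule inj_onI)
          fix r r' assume r: "r \<in> {r \<in> R. set r \<subseteq> set a}" "r' \<in> {r \<in> R. set r \<subseteq> set a}" and "\<phi> r = \<phi> r'"
          then have "set r = set r'" using eq[of r] eq[of r'] by simp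
          then show "r = r'" using inj_onD[OF oriented_basisD(2)[OF B(1)]] r by (simp add: R_def)
        qed
        show "\<phi> ` {r \<in> R. set r \<subseteq> set a} \<subseteq> {F \<in> Fc t. set a \<in> touching D t F}"
        proof
          fix F assume "F \<in> \<phi> ` {r \<in> R. set r \<subseteq> set a}"
          then obtain r where r: "r \<in> R" "set r \<subseteq> set a" "F = \<phi> r" by blast
          have "card (set r) = d"
            using oriented_basisD(5)[OF B(1), of r] r(1) d_pos by (auto simp: faces_def R_def)
          then show "F \<in> {F \<in> Fc t. set a \<in> touching D t F}"
            using \<phi>[OF r(1,2)] r aD at unfolding touching_def faces_part_in_iff by blast
        qed
        show "finite {F \<in> Fc t. set a \<in> touching D t F}" using finFc by simp
      qed
      also have "real (card {F \<in> Fc t. set a \<in> touching D t F}) =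
        (\<Sum>F\<in>Fc t. if set a \<in> touching D t F then 1 else 0)"
        using sum.inter_filter[OF finFc, of "\<lambda>_. 1 :: real" "\<lambda>F. set a \<in> touching D t F"] by simp
      finally show ?thesis by simp
    qed
    have finS: "finite (S t)" by (simp add: S_def)
    have "(\<Sum>a\<in>S t. \<Sum>r\<in>R. (incidence r a)\<^sup>2) \<le>
      (\<Sum>a\<in>S t. \<Sum>F\<in>Fc t. if set a \<in> touching D t F then 1 else 0)"
      by (rule sum_mono[OF a_bound])
    also have "\<dots> = (\<Sum>F\<in>Fc t. \<Sum>a\<in>S t. if set a \<in> touching D t F then 1 else 0)"
      by (rule sum.swap)
    also have "\<dots> \<le> (\<Sum>F\<in>Fc t. real touch_number ^ n)"
    proof (rule sum_mono)
      fix F assume F: "F \<in> Fc t"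
      have "(\<Sum>a\<in>S t. if set a \<in> touching D t F then 1 else 0) = real (card {a \<in> S t. set a \<in> touching D t F})"
        using sum.inter_filter[OF finS, of "\<lambda>_. 1 :: real" "\<lambda>a. set a \<in> touching D t F"] by simp
      also have "card {a \<in> S t. set a \<in> touching D t F} \<le> card (touching D t F)"
      proof (rule card_inj_on_le[of set])
        show "inj_on set {a \<in> S t. set a \<in> touching D t F}"
          by (rule inj_on_subset[OF oriented_basisD(2)[OF B(2)]]) (auto simp: S_def)
      qed (use finite_touching[OF cx_geometric[OF D(1)]] in auto)
      also have "card (touching D t F) \<le> touch_number ^ n"
        using card_touching_funpow[OF K t] F by (simp add: Fc_def D_def)
      finally show "(\<Sum>a\<in>S t. if set a \<in> touching D t F then 1 else 0) \<le> real touch_number ^ n" by simp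
    qed
    also have "\<dots> = (real d + 1) * real touch_number ^ n" using cardFc by simp
    finally show ?thesis .
  qed
  have "(\<Sum>a\<in>set B. \<Sum>r\<in>R. (incidence r a)\<^sup>2) \<le> (\<Sum>a\<in>(\<Union>t\<in>faces d K. S t). \<Sum>r\<in>R. (incidence r a)\<^sup>2)"
    using cover fin by (intro sum_mono2) (auto simp: S_def intro: sum_nonneg)
  also have "\<dots> \<le> (\<Sum>t\<in>faces d K. \<Sum>a\<in>S t. \<Sum>r\<in>R. (incidence r a)\<^sup>2)"
  proof -
    have disj: "S i \<inter> S j = {}" if "i \<in> faces d K" "j \<in> faces d K" "i \<noteq> j" for i j
    proof (rule ccontr)
      assume "S i \<inter> S j \<noteq> {}"
      then obtain a where "a \<in> S i" "a \<in> S j" by blast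
      then have "set a \<in> faces d (part_in D i)" "set a \<in> faces d (part_in D j)"
        using oriented_basisD(5)[OF B(2), of a] by (auto simp: S_def faces_def part_in_iff)
      then show False using top_faces_disjoint[OF K D(1) that] by blast
    qed
    show ?thesis
      using fin disj by (subst sum.UNION_disjoint) (auto simp: S_def)
  qed
  also have "\<dots> \<le> (\<Sum>t\<in>faces d K. (real d + 1) * real touch_number ^ n)"
    by (rule sum_mono[OF t_bound])
  finally show ?thesis by (simp add: R_def)
qed

lemma free_facets_mono:
  assumes C: "oriented_basis (d - 1) ((sd ^^ n) (sd K)) C'" and K: "cx K"
  shows "free_facets (sd K) C' \<subseteq> free_facets K C'"
proof
  fix r assume r: "r \<in> free_facets (sd K) C'"
  define E where "E = (sd ^^ n) (sd K)"
  have sK: "cx (sd K)" using cx_sd[OF K] .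
  have E: "cx E" "refines E (sd K)" using cx_funpow refines_funpow sK by (auto simp: E_def)
  have rC: "r \<in> set C'" using r by (simp add: free_facets_def)
  have rE: "set r \<in> E" "card (set r) = d"
    using oriented_basisD(5)[OF C rC] d_pos by (auto simp: faces_def E_def)
  have "\<not> set r \<subseteq> convex hull F" if F: "F \<in> faces (d - 1) K" for F
  proof
    assume rF: "set r \<subseteq> convex hull F"
    have F': "F \<in> K" "card F = d" using F d_pos by (auto simp: faces_def)
    obtain s where s: "s \<in> sd K" "set r \<subseteq> convex hull s" using E(2) rE(1) by (auto simp: refines_def)
    have "set r \<noteq> {}" using rE(2) d_pos by auto
    then obtain q where q: "q \<in> part_in (sd K) F" "set r \<subseteq> convex hull q"
      using refines_common_face[OF cx_geometric[OF K] cx_geometric[OF sK] sd_refines[OF K] s(1) F'(1) _ s(2) rF]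
      by blast
    have q': "q \<in> sd K" "q \<subseteq> convex hull F" using q(1) by (auto simp: part_in_iff)
    have "card (set r) \<le> card q"
      using geometric_complex_card_le[OF cx_geometric[OF E(1)] rE(1) geometric_complexD(2)[OF cx_geometric[OF sK] q'(1)] q(2)] .
    moreover have "card q \<le> card F"
      using geometric_complex_card_le[OF cx_geometric[OF sK] q'(1) geometric_complexD(2)[OF cx_geometric[OF K] F'(1)] q'(2)] .
    ultimately have "q \<in> faces (d - 1) (sd K)" using q'(1) rE(2) F'(2) d_pos by (simp add: faces_def)
    then show False using r q(2) by (auto simp: free_facets_def)
  qed
  then show "r \<in> free_facets K C'" using rC by (auto simp: free_facets_def)
qed

lemma spectral_limit:
  assumes nontrivial: "acts_nontrivially d sd"
  shows "\<exists>\<Lambda>. L1_unit \<Lambda> \<and>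
    (\<forall>K. geometric_complex K \<and> has_dim d K \<longrightarrow>
      (\<forall>B' B. (\<forall>n. oriented_basis (d - 1) ((sd ^^ n) K) (B' n) \<and> oriented_basis d ((sd ^^ n) K) (B n)) \<longrightarrow>
        L1_unit_tendsto (\<lambda>n. spectral_function (laplacian (B' n) (B n))) \<Lambda>))"
proof -
  define \<Delta> where "\<Delta> = std_simplex d"
  define b where "b = card (faces d (sd \<Delta>))"
  have \<Delta>: "cx \<Delta>" "faces d \<Delta> \<noteq> {}" using cx_std_simplex by (auto simp: \<Delta>_def faces_std_simplex)
  have b: "b > 1" using nontrivial by (simp add: acts_nontrivially_def b_def \<Delta>_def)
  have ratio: "touch_number < b" using touch_number_less b by (simp add: b_def \<Delta>_def)
  have "\<forall>n. \<exists>C. oriented_basis i ((sd ^^ n) \<Delta>) C" for i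
    using oriented_basis_exists cx_geometric[OF cx_funpow[OF \<Delta>(1)]] by blast
  then obtain C' C where C: "\<And>n. oriented_basis (d - 1) ((sd ^^ n) \<Delta>) (C' n)" "\<And>n. oriented_basis d ((sd ^^ n) \<Delta>) (C n)"
    by metis
  define M where "M n = fmat (gram (free_facets \<Delta> (C' n)) incidence) (C n)" for n
  define f where "f n = spectral_function (M n)" for n
  have lenC: "length (C n) = b ^ n" for n
    using length_oriented_basis[OF C(2)]
    by (simp add: card_faces_funpow[OF \<Delta>(1)] b_def) (simp add: \<Delta>_def faces_std_simplex)
  have posC: "length (C n) > 0" for n using b by (simp add: lenC)
  have f_eq: "spectral_function (fmat (gram (free_facets K B') incidence) B) = f n"
    if "cx K" "faces d K \<noteq> {}" "oriented_basis (d - 1) ((sd ^^ n) K) B'" "oriented_basis d ((sd ^^ n) K) B" for K B' B n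
    unfolding f_def M_def \<Delta>_def
    using free_spectral_function[OF that(1,2) nontrivial that(3,4)] C by (simp add: \<Delta>_def)
  have mono: "f n x \<le> f (Suc n) x" for n x
  proof -
    have sw: "(sd ^^ Suc n) \<Delta> = (sd ^^ n) (sd \<Delta>)" by (simp add: funpow_swap1)
    have ne: "faces d (sd \<Delta>) \<noteq> {}" using b by (auto simp: b_def)
    have C1: "oriented_basis (d - 1) ((sd ^^ n) (sd \<Delta>)) (C' (Suc n))" "oriented_basis d ((sd ^^ n) (sd \<Delta>)) (C (Suc n))"
      using C[of "Suc n"] by (simp_all only: sw)
    have "f n x = spectral_function (fmat (gram (free_facets (sd \<Delta>) (C' (Suc n))) incidence) (C (Suc n))) x"
      using f_eq[OF cx_sd[OF \<Delta>(1)] ne C1] by simp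
    also have "\<dots> \<le> f (Suc n) x"
      unfolding f_def M_def
      by (rule spectral_function_mono[OF fmat_dims(1) fmat_dims(1) posC])
        (rule eigenvalue_gram_mono[OF _ free_facets_mono[OF C1(1) \<Delta>(1)]], auto simp: free_facets_def)
    finally show ?thesis .
  qed
  have trace: "(\<Sum>i<length (C n). M n $$ (i, i)) \<le> (real d + 1) * real (length (C n))" for n
    unfolding M_def trace_fmat_gram[OF oriented_basisD(1)[OF C(2)]]
    by (rule trace_le[OF C]) (auto simp: free_facets_def)
  have bound: "f n x \<le> (if 0 \<le> x \<and> x < 1 then (real d + 1) / (1 - x) else 0)" for n x
  proof (cases "0 \<le> x \<and> x < 1")
    case True
    have "f n x \<le> (real d + 1) / (1 - x)"
      unfolding f_def
      by (rule spectral_function_le_trace[OF _ _ posC _ _ _ trace])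
        (use True in \<open>auto simp: M_def fmat_gram_symmetric intro: eigenvalue_gram_nonneg\<close>)
    then show ?thesis using True by simp
  next
    case False
    then show ?thesis using posC[of n] by (auto simp: f_def M_def spectral_function_eq)
  qed
  have int: "integrable lborel (f n)" for n unfolding f_def by (rule integrable_spectral_function)
  have integral_le: "(\<integral>x. f n x \<partial>lborel) \<le> real d + 1" for n
  proof -
    have "(\<integral>x. f n x \<partial>lborel) = (\<Sum>i<length (C n). M n $$ (i, i)) / length (C n)"
      by (simp add: f_def M_def integral_spectral_function sum_eigenvalues[OF fmat_carrier fmat_gram_symmetric])
    also have "\<dots> \<le> (real d + 1) * real (length (C n)) / length (C n)"
      using trace[of n] by (rule divide_right_mono) simp
    finally show ?thesis using posC[of n] by simp
  qed
  have "\<exists>\<Lambda>. (\<forall>x. x \<notin> {0..1} \<longrightarrow> \<Lambda> x = 0) \<and> integrable lborel \<Lambda> \<and>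
      (\<lambda>n. \<integral>x. \<bar>f n x - \<Lambda> x\<bar> \<partial>lborel) \<longlonglongrightarrow> 0"
    by (rule increasing_L1_limit[where f = f and C = "real d + 1"
          and b = "\<lambda>x. if 0 \<le> x \<and> x < 1 then (real d + 1) / (1 - x) else 0"])
      (use int mono bound integral_le spectral_function_outside in \<open>simp_all only: f_def\<close>)
  then obtain \<Lambda> where \<Lambda>: "\<forall>x. x \<notin> {0..1} \<longrightarrow> \<Lambda> x = 0" "integrable lborel \<Lambda>"
    "(\<lambda>n. \<integral>x. \<bar>f n x - \<Lambda> x\<bar> \<partial>lborel) \<longlonglongrightarrow> 0"
    by (elim exE conjE) (rule that)
  have "L1_unit_tendsto (\<lambda>n. spectral_function (laplacian (B' n) (B n))) \<Lambda>"
    if K: "cx K" "faces d K \<noteq> {}"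
      and B: "\<And>n. oriented_basis (d - 1) ((sd ^^ n) K) (B' n)" "\<And>n. oriented_basis d ((sd ^^ n) K) (B n)" for K B' B
  proof -
    define g where "g n = spectral_function (laplacian (B' n) (B n))" for n
    have lap: "laplacian (B' n) (B n) = fmat (gram (set (B' n)) incidence) (B n)" for n
      by (rule laplacian_eq_fmat[OF oriented_basisD(1)[OF B(1)]])
    have f: "f n = spectral_function (fmat (gram (free_facets K (B' n)) incidence) (B n))" for n
      using f_eq[OF K B] by simp
    have fin: "finite (faces d K)" using geometric_complexD(1)[OF cx_geometric[OF K(1)]] by (simp add: faces_def)
    then have cK: "card (faces d K) > 0" using K(2) by (simp add: card_gt_0_iff)
    have lenB: "length (B n) = card (faces d K) * b ^ n" for n
      using length_oriented_basis[OF B(2)] by (simp add: card_faces_funpow[OF K(1)] b_def \<Delta>_def)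
    have posB: "length (B n) > 0" for n using b cK by (simp add: lenB)
    have sub: "free_facets K (B' n) \<subseteq> set (B' n)" for n by (auto simp: free_facets_def)
    have le: "f n x \<le> g n x" for n x
      unfolding f g_def lap
      by (rule spectral_function_mono[OF fmat_dims(1) fmat_dims(1) posB])
        (rule eigenvalue_gram_mono[OF _ sub], auto)
    have intg: "integrable lborel (g n)" for n unfolding g_def by (rule integrable_spectral_function)
    have gf: "(\<integral>x. \<bar>g n x - f n x\<bar> \<partial>lborel) \<le> (real d + 1) * (real touch_number / real b) ^ n" for n
    proof -
      let ?R = "free_facets K (B' n)"
      have "(\<integral>x. \<bar>g n x - f n x\<bar> \<partial>lborel) = (\<integral>x. g n x - f n x \<partial>lborel)"
        using le by (intro Bochner_Integration.integral_cong) auto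
      also have "\<dots> = (\<integral>x. g n x \<partial>lborel) - (\<integral>x. f n x \<partial>lborel)" using intg int by simp
      also have "\<dots> = ((\<Sum>a\<in>set (B n). \<Sum>r\<in>set (B' n). (incidence r a)\<^sup>2) -
          (\<Sum>a\<in>set (B n). \<Sum>r\<in>?R. (incidence r a)\<^sup>2)) / length (B n)"
        unfolding f g_def lap integral_spectral_gram[OF oriented_basisD(1)[OF B(2)]]
        by (simp add: diff_divide_distrib)
      also have "\<dots> = (\<Sum>a\<in>set (B n). \<Sum>r\<in>set (B' n) - ?R. (incidence r a)\<^sup>2) / length (B n)"
        using sub[of n] by (simp add: sum_diff sum_subtractf)
      also have "\<dots> \<le> real (card (faces d K)) * ((real d + 1) * real touch_number ^ n) / length (B n)"
        by (rule divide_right_mono[OF boundary_trace_le[OF K(1) B]]) simp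
      also have "\<dots> = (real d + 1) * (real touch_number / real b) ^ n"
        using cK b by (simp add: lenB power_divide)
      finally show ?thesis .
    qed
    have "(\<lambda>n. (real d + 1) * (real touch_number / real b) ^ n) \<longlonglongrightarrow> (real d + 1) * 0"
      using ratio b by (intro tendsto_mult tendsto_const LIMSEQ_realpow_zero) auto
    then have lim: "(\<lambda>n. (real d + 1) * (real touch_number / real b) ^ n + (\<integral>x. \<bar>f n x - \<Lambda> x\<bar> \<partial>lborel)) \<longlonglongrightarrow> 0"
      using tendsto_add[OF _ \<Lambda>(3)] by fastforce
    have upper: "(\<integral>x. \<bar>g n x - \<Lambda> x\<bar> \<partial>lborel) \<le>
        (real d + 1) * (real touch_number / real b) ^ n + (\<integral>x. \<bar>f n x - \<Lambda> x\<bar> \<partial>lborel)" for n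
    proof -
      have i1: "integrable lborel (\<lambda>x. \<bar>g n x - f n x\<bar>)" "integrable lborel (\<lambda>x. \<bar>f n x - \<Lambda> x\<bar>)"
        "integrable lborel (\<lambda>x. \<bar>g n x - \<Lambda> x\<bar>)"
        using intg int \<Lambda>(2) by auto
      have "(\<integral>x. \<bar>g n x - \<Lambda> x\<bar> \<partial>lborel) \<le> (\<integral>x. \<bar>g n x - f n x\<bar> + \<bar>f n x - \<Lambda> x\<bar> \<partial>lborel)"
        using i1 by (intro integral_mono) auto
      also have "\<dots> = (\<integral>x. \<bar>g n x - f n x\<bar> \<partial>lborel) + (\<integral>x. \<bar>f n x - \<Lambda> x\<bar> \<partial>lborel)"
        using i1 by (intro Bochner_Integration.integral_add)
      finally show ?thesis using gf[of n] by simp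
    qed
    have "(\<lambda>n. \<integral>x. \<bar>g n x - \<Lambda> x\<bar> \<partial>lborel) \<longlonglongrightarrow> 0"
      by (rule tendsto_sandwich[OF _ _ tendsto_const lim]) (auto simp: upper)
    moreover have "L1_unit_tendsto g \<Lambda> \<longleftrightarrow> (\<forall>n. integrable lborel (g n)) \<and> integrable lborel \<Lambda> \<and>
        (\<lambda>n. \<integral>x. \<bar>g n x - \<Lambda> x\<bar> \<partial>lborel) \<longlonglongrightarrow> 0"
      using \<Lambda>(1) by (intro L1_unit_tendsto_iff) (auto simp: g_def spectral_function_outside)
    ultimately have "L1_unit_tendsto g \<Lambda>" using intg \<Lambda>(2) by blast
    then show ?thesis unfolding g_def[abs_def] .
  qed
  moreover have "L1_unit \<Lambda>" using \<Lambda>(1,2) L1_unit_iff[of \<Lambda>] by blast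
  ultimately show ?thesis unfolding has_dim_def cx_def by blast
qed

end

theorem theorem1p1:
  fixes d :: nat and sd :: "complex_of_points \<Rightarrow> complex_of_points"
  assumes "d \<ge> 1"
    and "inclusion_uniform d sd"
    and "acts_nontrivially d sd"
  shows "\<exists>\<Lambda> :: real \<Rightarrow> real. L1_unit \<Lambda> \<and>
    (\<forall>K. geometric_complex K \<and> has_dim d K \<longrightarrow>
      (\<forall>(B' :: nat \<Rightarrow> point list list) (B :: nat \<Rightarrow> point list list).
        (\<forall>n. oriented_basis (d - 1) ((sd ^^ n) K) (B' n) \<and> oriented_basis d ((sd ^^ n) K) (B n)) \<longrightarrow>
        L1_unit_tendsto (\<lambda>n. spectral_function (laplacian (B' n) (B n))) \<Lambda>))"
proof -
  interpret uniform_subdivision d sd by standard (rule assms(2), rule assms(1))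
  show ?thesis by (rule spectral_limit[OF assms(3)])
qed

end
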